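(* Consider on $\mathbb C^4$ with coordinates $(S_0,S_1,S_2,S_3)$ the quadratic Poisson bracket (repeated indices summed) $$ \{S_\alpha,S_\beta\}_2=2i\varepsilon_{\alpha\beta\gamma}S_0S_\gamma,\qquad \{S_0,S_\alpha\}_2=i\varepsilon_{\alpha\beta\gamma}S_\beta S_\gamma\bigl(E_2(\omega_\beta)-E_2(\omega_\gamma)\bigr)+2i\varepsilon_{\alpha\beta\gamma}S_\beta\nu'_\gamma $$ and the linear $\mathrm{sl}_2$ Lie-Poisson bracket $\{S_\alpha,S_\beta\}_1=2i\varepsilon_{\alpha\beta\gamma}S_\gamma$ (with $S_0$ central). Then: (1) For $L(z)=\sum_{\alpha=1}^3\bigl(S_\alpha\varphi_\alpha(z)+\tilde\nu_\alpha\varphi_\alpha(z-\omega_\alpha)\bigr)\sigma_\alpha$ and $r^\pm(z,w)=\sum_{\alpha=1}^3\varphi_\alpha(z\pm w)\,\sigma_\alpha\otimes\sigma_\alpha$, the linear bracket is given by $$\{L_1(z),L_2(w)\}_1=-\tfrac12[r^-(z,w),L_1(z)+L_2(w)]+\tfrac12[r^+(z,w),L_1(z)-L_2(w)].$$ (2) The quadratic and the linear brackets are compatible, i.e. their linear combinations are Poisson brackets. (3) The equation of motion of the non-autonomous Zhukovsky-Volterra gyrostat $$\partial_\tau\vec S=\vec S\times(\vec J(\tau)\cdot\vec S)+\vec S\times\vec\nu'$$ is written in terms of the linear bracket as $$\partial_\tau S_\alpha=\{H^{ZVG},S_\alpha\}_1,\qquad H^{ZVG}=-\frac{\pi^2}2\,\mathrm{tr}\bigl(\mathbf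 S\,(\mathbf J(\tau)\cdot\mathbf S+\boldsymbol\nu')\bigr),$$ and can be written in terms of the quadratic bracket in the form $$\partial_\tau S_\alpha=\{H_0,S_\alpha\}_2,\qquad H_0=S_0 .$$
   Context: $\tau$ is in the upper half plane; $\omega_1=\frac12$, $\omega_2=\frac\tau2$, $\omega_3=\frac{1+\tau}2$; Greek indices range over $1,2,3$; $\varepsilon_{\alpha\beta\gamma}$ is the Levi-Civita symbol; $\sigma_\alpha$ are the Pauli matrices. $\tilde\nu_\alpha$ are constants and $\nu'_\alpha=-\tilde\nu_\alpha\exp(-2\pi i\,\omega_\alpha\partial_\tau\omega_\alpha)\bigl(\vartheta'(0)/\vartheta(\omega_\alpha)\bigr)^2$. $\vec J(\tau)\cdot\vec S=(J_1S_1,J_2S_2,J_3S_3)$ with $J_\alpha=\wp(\omega_\alpha,\tau)$; replacing $\wp$ by $E_2$, which differs from it by a term independent of $z$, does not affect the equations of motion. In $H^{ZVG}$, $\mathbf S=\sum S_\alpha T_\alpha$, $\boldsymbol\nu'=\sum\nu'_\alpha T_\alpha$, $\mathbf J(\tau)\cdot\mathbf S=\sum E_2(\omega_\alpha)S_\alpha T_\alpha$, in the basis of $\mathrm{sl}(2,\mathbb C)$ with $T_1=\frac1{i\pi}\sigma_1$, $T_2=\frac1{i\pi}\sigma_2$, $T_3=-\frac1{i\pi}\sigma_3$. $\vartheta(z)=\sum_{j\in\mathbb Z}\exp\bigl(\pi i(j+\frac12)^2\tau+2\pi i(j+\frac12)(z+\frac12)\bigr)$, $E_2(z)=-\partial_z^2\log\vartheta(z)$,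 $\wp$ is the Weierstrass function of $\mathbb Z+\tau\mathbb Z$, $$\phi(u,z)=\frac{\vartheta(u+z)\vartheta'(0)}{\vartheta(u)\vartheta(z)},\qquad \varphi_\alpha(z)=\exp(2\pi i z\,\partial_\tau\omega_\alpha)\,\phi(z,\omega_\alpha).$$ $L_1=L\otimes1$, $L_2=1\otimes L$, and $\{L_1(z),L_2(w)\}$ is the matrix of brackets of matrix entries; $\times$ is the cross product on $\mathbb C^3$.
   Formalization: In (3), constants as printed are inconsistent: {H^ZVG,S}_1=4iS×(J·S)+2iS×ν' and {S_0,S}_2=-2iS×(J·S)+2iS×ν'. Proved instead: S solves the linear (quadratic) Hamiltonian equation iff 4iS (resp. -2iS) solves the gyrostat with ν̃ replaced by 2iν̃. *)

theory Defs
  imports "HOL-Analysis.Analysis"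
begin

section \<open>Theta functions and the Weierstrass function\<close>

definition upper_half_plane :: "complex set" where
  "upper_half_plane = {\<tau>. Im \<tau> > 0}"

definition lattice :: "complex \<Rightarrow> complex set" where
  "lattice \<tau> = {of_int m + of_int n * \<tau> | m n. True}"

definition theta :: "complex \<Rightarrow> complex \<Rightarrow> complex" where
  "theta \<tau> z = (\<Sum>\<^sub>\<infinity>j::int. exp (of_real pi * \<i> * (of_int j + 1/2)^2 * \<tau>
      + 2 * of_real pi * \<i> * (of_int j + 1/2) * (z + 1/2)))"

text \<open>The second logarithmic derivative is written as the derivative of \<open>\<vartheta>'/\<vartheta>\<close>: composing with
  the principal branch \<^const>\<open>Ln\<close> would introduce spurious branch cuts.\<close>

definition E2 :: "complex \<Rightarrow> complex \<Rightarrow> complex" where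
  "E2 \<tau> z = - deriv (\<lambda>u. deriv (theta \<tau>) u / theta \<tau> u) z"

definition weierstrass_p :: "complex \<Rightarrow> complex \<Rightarrow> complex" where
  "weierstrass_p \<tau> z = 1 / z^2 + (\<Sum>\<^sub>\<infinity>(m::int, n::int) \<in> - {(0, 0)}.
      1 / (z - (of_int m + of_int n * \<tau>))^2 - 1 / (of_int m + of_int n * \<tau>)^2)"

definition phi :: "complex \<Rightarrow> complex \<Rightarrow> complex \<Rightarrow> complex" where
  "phi \<tau> u z = theta \<tau> (u + z) * deriv (theta \<tau>) 0 / (theta \<tau> u * theta \<tau> z)"

text \<open>Greek indices are elements of the type \<^typ>\<open>3\<close>, i.e. \<open>1\<close>, \<open>2\<close> and \<open>3\<close> (where \<open>3 = 0\<close>).\<close>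

definition omega :: "3 \<Rightarrow> complex \<Rightarrow> complex" where
  "omega \<alpha> \<tau> = (if \<alpha> = 1 then 1/2 else if \<alpha> = 2 then \<tau>/2 else (1 + \<tau>)/2)"

definition varphi :: "complex \<Rightarrow> 3 \<Rightarrow> complex \<Rightarrow> complex" where
  "varphi \<tau> \<alpha> z = exp (2 * of_real pi * \<i> * z * deriv (omega \<alpha>) \<tau>) * phi \<tau> z (omega \<alpha> \<tau>)"

definition nu' :: "complex^3 \<Rightarrow> complex \<Rightarrow> complex^3" where
  "nu' \<nu> \<tau> = (\<chi> \<alpha>. - (\<nu> $ \<alpha>) * exp (- 2 * of_real pi * \<i> * omega \<alpha> \<tau> * deriv (omega \<alpha>) \<tau>)
      * (deriv (theta \<tau>) 0 / theta \<tau> (omega \<alpha> \<tau>))^2)"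


section \<open>Matrices\<close>

definition levi_civita :: "3 \<Rightarrow> 3 \<Rightarrow> 3 \<Rightarrow> complex" where
  "levi_civita \<alpha> \<beta> \<gamma> =
    (if (\<alpha>, \<beta>, \<gamma>) \<in> {(1, 2, 3), (2, 3, 1), (3, 1, 2)} then 1
     else if (\<alpha>, \<beta>, \<gamma>) \<in> {(3, 2, 1), (1, 3, 2), (2, 1, 3)} then - 1
     else 0)"

text \<open>The library's cross product is only available for real vectors.\<close>

definition ccross :: "complex^3 \<Rightarrow> complex^3 \<Rightarrow> complex^3" where
  "ccross u v = (\<chi> \<alpha>. \<Sum>\<beta>\<in>UNIV. \<Sum>\<gamma>\<in>UNIV. levi_civita \<alpha> \<beta> \<gamma> * u $ \<beta> * v $ \<gamma>)"

definition mscale :: "complex \<Rightarrow> complex^'n^'m \<Rightarrow> complex^'n^'m" (infixr \<open>*ms\<close> 75) where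
  "c *ms A = map_matrix ((*) c) A"

definition kron :: "complex^'n^'n \<Rightarrow> complex^'m^'m \<Rightarrow> complex^('n \<times> 'm)^('n \<times> 'm)" where
  "kron A B = (\<chi> i j. A $ fst i $ fst j * B $ snd i $ snd j)"

definition commutator :: "complex^'n^'n \<Rightarrow> complex^'n^'n \<Rightarrow> complex^'n^'n" where
  "commutator A B = A ** B - B ** A"

definition pauli :: "3 \<Rightarrow> complex^2^2" where
  "pauli \<alpha> = (if \<alpha> = 1 then vector [vector [0, 1], vector [1, 0]]
     else if \<alpha> = 2 then vector [vector [0, - \<i>], vector [\<i>, 0]]
     else vector [vector [1, 0], vector [0, - 1]])"

definition T_basis :: "3 \<Rightarrow> complex^2^2" where
  "T_basis \<alpha> = (if \<alpha> = 3 then - (1 / (\<i> * of_real pi)) else 1 / (\<i> * of_real pi)) *ms pauli \<alpha>"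


section \<open>Poisson brackets on affine space\<close>

text \<open>Poisson brackets are taken on the algebra of polynomial functions on \<open>\<complex>\<^sup>n\<close>.\<close>

inductive_set polyfun :: "(complex^'n \<Rightarrow> complex) set" where
  const: "(\<lambda>x. c) \<in> polyfun"
| coord: "(\<lambda>x. x $ a) \<in> polyfun"
| add: "f \<in> polyfun \<Longrightarrow> g \<in> polyfun \<Longrightarrow> (\<lambda>x. f x + g x) \<in> polyfun"
| mult: "f \<in> polyfun \<Longrightarrow> g \<in> polyfun \<Longrightarrow> (\<lambda>x. f x * g x) \<in> polyfun"

type_synonym 'n bracket =
  "(complex^'n \<Rightarrow> complex) \<Rightarrow> (complex^'n \<Rightarrow> complex) \<Rightarrow> (complex^'n \<Rightarrow> complex)"

definition poisson_bracket :: "'n::finite bracket \<Rightarrow> bool" where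
  "poisson_bracket B \<longleftrightarrow>
    (\<forall>f\<in>polyfun. \<forall>g\<in>polyfun. B f g \<in> polyfun) \<and>
    (\<forall>f\<in>polyfun. \<forall>g\<in>polyfun. \<forall>h\<in>polyfun. \<forall>a b x.
       B (\<lambda>y. a * f y + b * g y) h x = a * B f h x + b * B g h x) \<and>
    (\<forall>f\<in>polyfun. \<forall>g\<in>polyfun. \<forall>x. B f g x = - B g f x) \<and>
    (\<forall>f\<in>polyfun. \<forall>g\<in>polyfun. \<forall>h\<in>polyfun. \<forall>x.
       B (\<lambda>y. f y * g y) h x = f x * B g h x + B f h x * g x) \<and>
    (\<forall>f\<in>polyfun. \<forall>g\<in>polyfun. \<forall>h\<in>polyfun. \<forall>x.
       B f (B g h) x + B g (B h f) x + B h (B f g) x = 0)"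

definition partial :: "'n \<Rightarrow> (complex^'n \<Rightarrow> complex) \<Rightarrow> complex^'n \<Rightarrow> complex" where
  "partial a f x = deriv (\<lambda>t. f (x + axis a t)) 0"

text \<open>The biderivation with prescribed brackets \<open>{x\<^sub>a, x\<^sub>b} = P a b\<close> of the coordinates.\<close>

definition bracket_of :: "('n \<Rightarrow> 'n \<Rightarrow> complex^'n \<Rightarrow> complex) \<Rightarrow> 'n::finite bracket" where
  "bracket_of P f g x = (\<Sum>a\<in>UNIV. \<Sum>b\<in>UNIV. partial a f x * partial b g x * P a b x)"

text \<open>For matrix-valued \<open>L\<close>, \<open>M\<close> this is \<open>{L \<otimes> 1, 1 \<otimes> M}\<close>, whose entry at row \<open>(i, k)\<close> and column
  \<open>(j, l)\<close> is \<open>{L\<^sub>i\<^sub>j, M\<^sub>k\<^sub>l}\<close>.\<close>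

definition tensor_bracket :: "'n::finite bracket \<Rightarrow> (complex^'n \<Rightarrow> complex^'m^'m) \<Rightarrow>
    (complex^'n \<Rightarrow> complex^'k^'k) \<Rightarrow> complex^'n \<Rightarrow> complex^('m \<times> 'k)^('m \<times> 'k)" where
  "tensor_bracket B L M x =
    (\<chi> i j. B (\<lambda>y. L y $ fst i $ fst j) (\<lambda>y. M y $ snd i $ snd j) x)"


section \<open>The linear and the quadratic bracket\<close>

text \<open>On \<open>\<complex>\<^sup>4\<close> the coordinate \<open>S\<^sub>0\<close> has index \<^const>\<open>None\<close> and \<open>S\<^sub>\<alpha>\<close> has index \<open>Some \<alpha>\<close>.\<close>

type_synonym phase = "complex^(3 option)"

definition S0 :: "phase \<Rightarrow> complex" where
  "S0 x = x $ None"

definition Svec :: "phase \<Rightarrow> complex^3" where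
  "Svec x = (\<chi> \<alpha>. x $ Some \<alpha>)"

definition linear_tensor :: "3 option \<Rightarrow> 3 option \<Rightarrow> phase \<Rightarrow> complex" where
  "linear_tensor a b x = (case (a, b) of
      (Some \<alpha>, Some \<beta>) \<Rightarrow> \<Sum>\<gamma>\<in>UNIV. 2 * \<i> * levi_civita \<alpha> \<beta> \<gamma> * Svec x $ \<gamma>
    | _ \<Rightarrow> 0)"

definition S0_bracket :: "complex^3 \<Rightarrow> complex \<Rightarrow> 3 \<Rightarrow> phase \<Rightarrow> complex" where
  "S0_bracket \<nu> \<tau> \<alpha> x =
    (\<Sum>\<beta>\<in>UNIV. \<Sum>\<gamma>\<in>UNIV. \<i> * levi_civita \<alpha> \<beta> \<gamma> * Svec x $ \<beta> * Svec x $ \<gamma>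
        * (E2 \<tau> (omega \<beta> \<tau>) - E2 \<tau> (omega \<gamma> \<tau>)))
    + (\<Sum>\<beta>\<in>UNIV. \<Sum>\<gamma>\<in>UNIV. 2 * \<i> * levi_civita \<alpha> \<beta> \<gamma> * Svec x $ \<beta> * nu' \<nu> \<tau> $ \<gamma>)"

definition quadratic_tensor :: "complex^3 \<Rightarrow> complex \<Rightarrow> 3 option \<Rightarrow> 3 option \<Rightarrow> phase \<Rightarrow> complex" where
  "quadratic_tensor \<nu> \<tau> a b x = (case (a, b) of
      (Some \<alpha>, Some \<beta>) \<Rightarrow> \<Sum>\<gamma>\<in>UNIV. 2 * \<i> * levi_civita \<alpha> \<beta> \<gamma> * S0 x * Svec x $ \<gamma>
    | (None, Some \<alpha>) \<Rightarrow> S0_bracket \<nu> \<tau> \<alpha> x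
    | (Some \<alpha>, None) \<Rightarrow> - S0_bracket \<nu> \<tau> \<alpha> x
    | (None, None) \<Rightarrow> 0)"

definition linear_bracket :: "(3 option) bracket" where
  "linear_bracket = bracket_of linear_tensor"

definition quadratic_bracket :: "complex^3 \<Rightarrow> complex \<Rightarrow> (3 option) bracket" where
  "quadratic_bracket \<nu> \<tau> = bracket_of (quadratic_tensor \<nu> \<tau>)"

definition Lax :: "complex^3 \<Rightarrow> complex \<Rightarrow> complex \<Rightarrow> phase \<Rightarrow> complex^2^2" where
  "Lax \<nu> \<tau> z x = (\<Sum>\<alpha>\<in>UNIV.
      (Svec x $ \<alpha> * varphi \<tau> \<alpha> z + \<nu> $ \<alpha> * varphi \<tau> \<alpha> (z - omega \<alpha> \<tau>)) *ms pauli \<alpha>)"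

text \<open>Both r-matrices are values of this function: \<open>r\<^sup>\<plusminus>(z, w) = r_matrix \<tau> (z \<plusminus> w)\<close>.\<close>

definition r_matrix :: "complex \<Rightarrow> complex \<Rightarrow> complex^(2 \<times> 2)^(2 \<times> 2)" where
  "r_matrix \<tau> u = (\<Sum>\<alpha>\<in>UNIV. varphi \<tau> \<alpha> u *ms kron (pauli \<alpha>) (pauli \<alpha>))"


section \<open>The Zhukovsky-Volterra gyrostat\<close>

definition J_times :: "complex \<Rightarrow> complex^3 \<Rightarrow> complex^3" where
  "J_times \<tau> S = (\<chi> \<alpha>. weierstrass_p \<tau> (omega \<alpha> \<tau>) * S $ \<alpha>)"

definition ZVG_solution :: "complex^3 \<Rightarrow> complex set \<Rightarrow> (complex \<Rightarrow> complex^3) \<Rightarrow> bool" where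
  "ZVG_solution \<nu> U S \<longleftrightarrow> (\<forall>\<tau>\<in>U. \<forall>\<alpha>. ((\<lambda>t. S t $ \<alpha>) has_field_derivative
      (ccross (S \<tau>) (J_times \<tau> (S \<tau>)) + ccross (S \<tau>) (nu' \<nu> \<tau>)) $ \<alpha>) (at \<tau>))"

definition H_ZVG :: "complex^3 \<Rightarrow> complex \<Rightarrow> phase \<Rightarrow> complex" where
  "H_ZVG \<nu> \<tau> x = - ((of_real pi)^2 / 2) * trace
     ((\<Sum>\<alpha>\<in>UNIV. Svec x $ \<alpha> *ms T_basis \<alpha>)
      ** ((\<Sum>\<alpha>\<in>UNIV. (E2 \<tau> (omega \<alpha> \<tau>) * Svec x $ \<alpha>) *ms T_basis \<alpha>)
          + (\<Sum>\<alpha>\<in>UNIV. nu' \<nu> \<tau> $ \<alpha> *ms T_basis \<alpha>)))"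

text \<open>The equations \<open>\<partial>\<^sub>\<tau> S\<^sub>\<alpha> = {H, S\<^sub>\<alpha>}\<close> for \<open>\<alpha> = 1, 2, 3\<close>, with Hamiltonian and bracket
  depending on the time \<open>\<tau>\<close>, along a curve \<open>X\<close> in \<open>\<complex>\<^sup>4\<close>.\<close>

definition hamiltonian_flow :: "(complex \<Rightarrow> (3 option) bracket) \<Rightarrow> (complex \<Rightarrow> phase \<Rightarrow> complex) \<Rightarrow>
    complex set \<Rightarrow> (complex \<Rightarrow> phase) \<Rightarrow> bool" where
  "hamiltonian_flow B H U X \<longleftrightarrow> (\<forall>\<tau>\<in>U. \<forall>\<alpha>. ((\<lambda>t. Svec (X t) $ \<alpha>) has_field_derivative
      B \<tau> (H \<tau>) (\<lambda>x. Svec x $ \<alpha>) (X \<tau>)) (at \<tau>))"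

text \<open>With these normalisations the Hamiltonian vector fields on the \<open>S\<close>-space are
  \<open>{H_ZVG, S}\<^sub>1 = 4\<i> S \<times> (J \<cdot> S) + 2\<i> S \<times> \<nu>'\<close> and \<open>{S\<^sub>0, S}\<^sub>2 = - 2\<i> S \<times> (J \<cdot> S) + 2\<i> S \<times> \<nu>'\<close>. Since
  \<^const>\<open>nu'\<close> is linear in \<open>\<nu>\<close>, they become the gyrostat equation for the rescaled variables
  \<open>4\<i> S\<close> and \<open>- 2\<i> S\<close> respectively, in both cases with the rescaled constants \<open>2\<i> \<nu>\<close>.\<close>

end

(* All analytic input comes from one rigidity principle: a function that is multiplied by constants
   of modulus 1 under the two periods and has only removable singularities is constant, and it is
   zero if one of the constants is not 1. Comparing theta with its q-product in this way locates its
   zeros. The same principle gives the addition formula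
     phi_c(z) phi_a(w) = phi_c(z - w) phi_b(w) - phi_a(z - w) phi_b(z)
   for distinct a, b, c, whose combinations with w replaced by -w are the coefficients of the
   r-matrix relation, and it shows that E2 differs from the Weierstrass function by a constant.
   Compatibility is a polynomial identity, since the Jacobiator is a derivation in each argument and
   may be tested on coordinates. *)

theory Submission
  imports Defs "HOL-Complex_Analysis.Complex_Analysis"
begin

text \<open>Division by zero yields 0, so a quotient of entire functions has an arbitrary value
  wherever its denominator vanishes; the rigidity principle is therefore phrased with limits. Theta
  itself is outside its scope, since its multiplier under \<tau> depends on the point: only
  quotients with matching multipliers qualify. The comparison with the product locates zeros only if
  theta is not identically zero, which is why a Fourier coefficient is computed. The constants \<nu>
  enter \<open>Lax\<close> but not the linear bracket, so their contribution to the r-matrix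
  relation must cancel. The reason: a shift by the half period \<omega>_\<beta> replaces
  varphi_\<beta>(u) by \<kappa> / varphi_\<beta>(u), with the constant \<kappa> that also relates
  \<open>nu'\<close> to \<nu>. The \<nu> terms thus become the addition formula with the weights of
  z and w exchanged. Compatibility has a conceptual origin: for nonzero a, a times the quadratic
  bracket plus b times the linear one is a times the quadratic bracket with S_0 translated by b /
  a.\<close>

no_notation fps_nth (infixl "$" 75)

subsection \<open>Quasi-periodic functions\<close>

lemma quasi_periodic_of_int:
  fixes f :: "complex \<Rightarrow> complex"
  assumes per: "\<And>w. f (w + k) = u * f w" and u: "u \<noteq> 0"
  shows "f (w + of_int m * k) = u powi m * f w"
proof -
  have pos: "f (w + of_nat n * k) = u ^ n * f w" for w n
  proof (induction n)
    case (Suc n)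
    have "w + of_nat (Suc n) * k = (w + of_nat n * k) + k"
      by (simp add: algebra_simps)
    then show ?case by (simp only: per Suc.IH power_Suc mult.assoc)
  qed simp
  show ?thesis
  proof (cases m)
    case (nonneg n)
    then show ?thesis using pos[of w n] by simp
  next
    case (neg n)
    have "f w = u ^ Suc n * f (w + of_int m * k)"
      using pos[of "w + of_int m * k" "Suc n"] unfolding neg by (simp del: of_nat_Suc)
    then show ?thesis using u by (simp only: neg power_int_minus power_int_of_nat) (simp add: field_simps)
  qed
qed

text \<open>Multipliers transport limits just as they transport values; at a singular point only the
  limit carries information.\<close>

lemma tendsto_quasi_periodic:
  fixes f :: "complex \<Rightarrow> complex"
  assumes "f \<midarrow>a\<rightarrow> L" "\<And>w. f (w + k) = u * f w"
  shows "f \<midarrow>a + k\<rightarrow> u * L"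
proof -
  have "(\<lambda>x. f (x + - k)) \<midarrow>a - - k\<rightarrow> L"
    using LIM_offset[OF assms(1), of "- k"] .
  then have "(\<lambda>x. u * f (x + - k)) \<midarrow>a + k\<rightarrow> u * L"
    by (intro tendsto_mult_left) simp
  moreover have "u * f (x + - k) = f x" for x
    using assms(2)[of "x + - k"] by (metis add.assoc add.left_inverse add_0_right)
  ultimately show ?thesis by (simp only:)
qed

text \<open>The inverse multipliers carry a limit at a lattice translate back to z, so removability
  of a singularity has to be checked at one translate only.\<close>

lemma tendsto_quasi_periodic_lattice:
  fixes f :: "complex \<Rightarrow> complex"
  assumes "f \<midarrow>z + of_int m + of_int n * \<tau>\<rightarrow> c"
    and "\<And>w. f (w + 1) = u * f w" "\<And>w. f (w + \<tau>) = v * f w" "u \<noteq> 0" "v \<noteq> 0"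
  shows "\<exists>c. f \<midarrow>z\<rightarrow> c"
proof -
  have 1: "f (w + of_int (-m) * 1) = u powi (-m) * f w" for w
    using assms(2,4) by (rule quasi_periodic_of_int)
  have 2: "f (w + of_int (-n) * \<tau>) = v powi (-n) * f w" for w
    using assms(3,5) by (rule quasi_periodic_of_int)
  from tendsto_quasi_periodic[OF tendsto_quasi_periodic[OF assms(1) 1] 2]
  show ?thesis by auto
qed

lemma bounded_quasi_periodic:
  fixes g :: "complex \<Rightarrow> complex"
  assumes cont: "continuous_on UNIV g" and \<tau>: "Im \<tau> > 0"
    and per: "\<And>w. g (w + 1) = u * g w" "\<And>w. g (w + \<tau>) = v * g w" "norm u = 1" "norm v = 1"
  shows "bounded (range g)"
proof -
  define K where "K = (\<lambda>(a, b). of_real a + of_real b * \<tau>) ` ({0..1::real} \<times> {0..1::real})"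
  have "compact K"
    unfolding K_def
    by (intro compact_continuous_image compact_Times compact_Icc)
       (auto intro!: continuous_intros simp: case_prod_unfold)
  then have "bounded (g ` K)"
    by (intro compact_imp_bounded compact_continuous_image continuous_on_subset[OF cont]) auto
  then obtain B where B: "\<And>z. z \<in> K \<Longrightarrow> norm (g z) \<le> B"
    by (auto simp: bounded_iff)
  have "norm (g z) \<le> B" for z
  proof -
    \<comment> \<open>\<open>a\<close> and \<open>b\<close> are the real coordinates of z in the
      basis 1, \<tau>. Removing their integer parts moves z into the period parallelogram
      \<open>K\<close>, and multipliers of modulus 1 preserve the norm.\<close>
    define b where "b = Im z / Im \<tau>"
    define a where "a = Re z - b * Re \<tau>"
    have z: "z = of_real a + of_real b * \<tau>"
      using \<tau> by (simp add: a_def b_def complex_eq_iff)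
    define w where "w = z + of_int (- \<lfloor>a\<rfloor>) * 1 + of_int (- \<lfloor>b\<rfloor>) * \<tau>"
    have "w = (\<lambda>(a, b). of_real a + of_real b * \<tau>) (frac a, frac b)"
      by (simp add: w_def z frac_def algebra_simps)
    moreover have "(frac a, frac b) \<in> {0..1::real} \<times> {0..1::real}"
      using frac_lt_1[of a] frac_lt_1[of b] by (auto intro: less_imp_le)
    ultimately have "w \<in> K" unfolding K_def by blast
    have "u \<noteq> 0" "v \<noteq> 0" using per by auto
    have "g w = v powi (- \<lfloor>b\<rfloor>) * g (z + of_int (- \<lfloor>a\<rfloor>) * 1)"
      unfolding w_def using per(2) \<open>v \<noteq> 0\<close> by (rule quasi_periodic_of_int)
    also have "g (z + of_int (- \<lfloor>a\<rfloor>) * 1) = u powi (- \<lfloor>a\<rfloor>) * g z"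
      using per(1) \<open>u \<noteq> 0\<close> by (rule quasi_periodic_of_int)
    finally have "g w = v powi (- \<lfloor>b\<rfloor>) * (u powi (- \<lfloor>a\<rfloor>) * g z)" .
    then have "norm (g w) = norm (g z)"
      using per by (simp add: norm_mult norm_power_int)
    then show ?thesis using B[OF \<open>w \<in> K\<close>] by simp
  qed
  then show ?thesis by (auto simp: bounded_iff)
qed

text \<open>Removing the singularities gives a bounded entire function, to which Liouville applies;
  its value c satisfies c = u c = v c. The conclusion speaks of limits because f itself may take
  wrong values at isolated points.\<close>

lemma quasi_elliptic_constant:
  fixes f :: "complex \<Rightarrow> complex"
  assumes \<tau>: "Im \<tau> > 0"
    and iso: "\<And>z. isolated_singularity_at f z"
    and lim: "\<And>z. \<exists>m n. \<exists>c. f \<midarrow>z + of_int m + of_int n * \<tau>\<rightarrow> c"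
    and per: "\<And>w. f (w + 1) = u * f w" "\<And>w. f (w + \<tau>) = v * f w" "norm u = 1" "norm v = 1"
  obtains c where "\<And>z. f \<midarrow>z\<rightarrow> c" "u \<noteq> 1 \<or> v \<noteq> 1 \<Longrightarrow> c = 0"
proof -
  have "u \<noteq> 0" "v \<noteq> 0" using per by auto
  have lim': "\<exists>c. f \<midarrow>z\<rightarrow> c" for z
    using lim[of z] tendsto_quasi_periodic_lattice[where f = f and \<tau> = \<tau>, OF _ per(1,2) \<open>u \<noteq> 0\<close> \<open>v \<noteq> 0\<close>] by blast
  define g where "g = remove_sings f"
  have g: "f \<midarrow>z\<rightarrow> g z" for z
    using lim'[of z] remove_sings_eqI unfolding g_def by blast
  have "g analytic_on {z}" for z
    unfolding g_def using g iso remove_sings_analytic_at by blast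
  then have hol: "g holomorphic_on UNIV"
    using analytic_on_analytic_at analytic_imp_holomorphic by blast
  have per1: "g (z + 1) = u * g z" for z
    using tendsto_quasi_periodic[where f = f and k = 1, OF g per(1)] g LIM_unique by blast
  have per2: "g (z + \<tau>) = v * g z" for z
    using tendsto_quasi_periodic[where f = f and k = \<tau>, OF g per(2)] g LIM_unique by blast
  have "g constant_on UNIV"
    by (intro Liouville_theorem hol bounded_quasi_periodic[OF _ \<tau> per1 per2]
        holomorphic_on_imp_continuous_on per)
  then obtain c where c: "\<And>z. g z = c" by (auto simp: constant_on_def)
  show ?thesis
    using that[of c] g per1[of 0] per2[of 0] unfolding c by auto
qed

section \<open>Sums over the integers and series of holomorphic functions\<close>

lemma summable_on_int_abs:
  fixes g :: "nat \<Rightarrow> real"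
  assumes "summable g" "\<And>n. g n \<ge> 0"
  shows "(\<lambda>j::int. g (nat \<bar>j\<bar>)) summable_on UNIV"
proof -
  have g: "g summable_on UNIV"
    using assms by (intro norm_summable_imp_summable_on) auto
  have "(\<lambda>j::int. g (nat \<bar>j\<bar>)) summable_on range int"
    by (subst summable_on_reindex) (use g in \<open>auto simp: o_def\<close>)
  moreover have "(\<lambda>j::int. g (nat \<bar>j\<bar>)) summable_on range (\<lambda>n. - int n)"
    by (subst summable_on_reindex) (use g in \<open>auto simp: o_def inj_def\<close>)
  ultimately have "(\<lambda>j::int. g (nat \<bar>j\<bar>)) summable_on range int \<union> range (\<lambda>n. - int n)"
    by (rule summable_on_union)
  moreover have "UNIV = range int \<union> range (\<lambda>n. - int n)"
  proof (intro UNIV_eq_I)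
    fix x :: int
    show "x \<in> range int \<union> range (\<lambda>n. - int n)"
      by (cases x rule: int_cases2) auto
  qed
  ultimately show ?thesis by simp
qed

text \<open>The M-test gives uniform convergence along the net of finite subsets, which passes
  holomorphy to the limit. The majorant may vary with the point, so that series without a global
  bound, such as theta, are covered.\<close>

lemma holomorphic_infsum:
  fixes f :: "'a \<Rightarrow> complex \<Rightarrow> complex"
  assumes "open S" "\<And>n. n \<in> X \<Longrightarrow> f n holomorphic_on S"
    and bound: "\<And>z. z \<in> S \<Longrightarrow> \<exists>r M. r > 0 \<and> cball z r \<subseteq> S \<and> M summable_on X \<and>
      (\<forall>n\<in>X. \<forall>w\<in>cball z r. norm (f n w) \<le> M n)"
  shows "(\<lambda>z. \<Sum>\<^sub>\<infinity>n\<in>X. f n z) holomorphic_on S"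
proof -
  have "(\<lambda>z. \<Sum>\<^sub>\<infinity>n\<in>X. f n z) field_differentiable at z" if z: "z \<in> S" for z
  proof -
    obtain r M where r: "r > 0" "cball z r \<subseteq> S" "M summable_on X"
        "\<And>n w. n \<in> X \<Longrightarrow> w \<in> cball z r \<Longrightarrow> norm (f n w) \<le> M n"
      using bound[OF z] by metis
    have sum: "(\<lambda>z. \<Sum>n\<in>N. f n z) holomorphic_on S" if "N \<subseteq> X" for N
      using that assms(2) by (intro holomorphic_on_sum) auto
    have ul: "uniform_limit (cball z r) (\<lambda>N w. \<Sum>n\<in>N. f n w) (\<lambda>w. \<Sum>\<^sub>\<infinity>n\<in>X. f n w)
        (finite_subsets_at_top X)"
      by (rule Weierstrass_m_test_general) (use r in auto)
    have ev: "eventually (\<lambda>N. continuous_on (cball z r) (\<lambda>w. \<Sum>n\<in>N. f n w) \<and>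
        (\<lambda>w. \<Sum>n\<in>N. f n w) holomorphic_on ball z r) (finite_subsets_at_top X)"
    proof (rule eventually_finite_subsets_at_top_weakI)
      fix N assume "N \<subseteq> X"
      show "continuous_on (cball z r) (\<lambda>w. \<Sum>n\<in>N. f n w) \<and>
          (\<lambda>w. \<Sum>n\<in>N. f n w) holomorphic_on ball z r"
        using holomorphic_on_subset[OF sum[OF \<open>N \<subseteq> X\<close>]] r(2) ball_subset_cball[of z r]
          holomorphic_on_imp_continuous_on by blast
    qed
    have "(\<lambda>z. \<Sum>\<^sub>\<infinity>n\<in>X. f n z) holomorphic_on ball z r"
      using holomorphic_uniform_limit[OF ev ul finite_subsets_at_top_neq_bot] by blast
    then show ?thesis
      using r(1) by (meson centre_in_ball holomorphic_on_imp_differentiable_at open_ball)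
  qed
  then show ?thesis
    by (auto simp: holomorphic_on_def field_differentiable_at_within)
qed

subsection \<open>The theta series\<close>

definition theta_term :: "complex \<Rightarrow> complex \<Rightarrow> int \<Rightarrow> complex" where
  "theta_term \<tau> z j = exp (of_real pi * \<i> * (of_int j + 1/2)^2 * \<tau>
      + 2 * of_real pi * \<i> * (of_int j + 1/2) * (z + 1/2))"

lemma theta_eq_infsum: "theta \<tau> z = (\<Sum>\<^sub>\<infinity>j. theta_term \<tau> z j)"
  by (simp add: theta_def theta_term_def)

text \<open>The negative quadratic exponent beats the linear one uniformly on a horizontal strip,
  which leaves a geometric majorant in the absolute value of j.\<close>

lemma theta_term_bound:
  assumes \<tau>: "Im \<tau> > 0"
  obtains M where "M summable_on UNIV"
    "\<And>z j. \<bar>Im z\<bar> \<le> R \<Longrightarrow> norm (theta_term \<tau> z j) \<le> M j"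
proof -
  define y where "y = pi * Im \<tau>"
  have y: "y > 0" using \<tau> by (simp add: y_def)
  \<comment> \<open>The quotient is the maximum over t of
    \<open>(2 * pi * R + 1) * t - y * t^2\<close>, where the extra 1 buys the decay exp(-|t|). The
    summand 1/2 pays for passing from t = j + 1/2 to j.\<close>
  define K where "K = (2 * pi * R + 1)^2 / (4 * y) + 1/2"
  define M where "M j = exp K * exp (-1) ^ nat \<bar>j\<bar>" for j :: int
  have "summable (\<lambda>n. exp K * exp (-1) ^ n :: real)"
    by (intro summable_mult summable_geometric) auto
  then have "M summable_on UNIV"
    unfolding M_def by (rule summable_on_int_abs) auto
  moreover have "norm (theta_term \<tau> z j) \<le> M j" if R: "\<bar>Im z\<bar> \<le> R" for z j
  proof -
    define t where "t = real_of_int j + 1/2"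
    have "norm (theta_term \<tau> z j) = exp (- y * t^2 - 2 * pi * t * Im z)"
      by (simp add: theta_term_def t_def y_def power2_eq_square algebra_simps)
    also have "- y * t^2 - 2 * pi * t * Im z \<le> - y * \<bar>t\<bar>^2 + 2 * pi * R * \<bar>t\<bar>"
    proof -
      have "- (t * Im z) \<le> \<bar>t\<bar> * \<bar>Im z\<bar>" by (metis abs_ge_minus_self abs_mult)
      also have "\<dots> \<le> \<bar>t\<bar> * R" using R by (intro mult_left_mono) auto
      finally have "2 * pi * - (t * Im z) \<le> 2 * pi * (\<bar>t\<bar> * R)"
        by (intro mult_left_mono) auto
      then show ?thesis by (simp add: algebra_simps)
    qed
    also have "\<dots> \<le> (2 * pi * R + 1)^2 / (4 * y) - \<bar>t\<bar>"
    proof -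
      have "0 \<le> (2 * y * \<bar>t\<bar> - (2 * pi * R + 1))^2 / (4 * y)" using y by simp
      also have "\<dots> = y * \<bar>t\<bar>^2 - (2 * pi * R + 1) * \<bar>t\<bar> + (2 * pi * R + 1)^2 / (4 * y)"
        using y by (simp add: power2_eq_square field_simps)
      finally show ?thesis by (simp add: algebra_simps)
    qed
    also have "\<dots> \<le> K + (- 1) * of_nat (nat \<bar>j\<bar>)"
      unfolding K_def t_def by linarith
    finally have "norm (theta_term \<tau> z j) \<le> exp (K + (- 1) * of_nat (nat \<bar>j\<bar>))"
      by simp
    also have "\<dots> = M j"
      unfolding M_def exp_add by (subst exp_of_nat2_mult) simp
    finally show ?thesis .
  qed
  ultimately show ?thesis using that by blast
qed

lemma holomorphic_theta_term: "(\<lambda>z. theta_term \<tau> z j) holomorphic_on S"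
  unfolding theta_term_def by (intro holomorphic_intros)

lemma holomorphic_theta:
  assumes "Im \<tau> > 0"
  shows "theta \<tau> holomorphic_on S"
proof -
  have "theta \<tau> holomorphic_on UNIV"
    unfolding theta_eq_infsum[abs_def]
  proof (rule holomorphic_infsum)
    fix z :: complex
    obtain M where M: "M summable_on UNIV"
        "\<And>w j. \<bar>Im w\<bar> \<le> \<bar>Im z\<bar> + 1 \<Longrightarrow> norm (theta_term \<tau> w j) \<le> M j"
      using theta_term_bound[OF assms] by metis
    have "\<bar>Im w\<bar> \<le> \<bar>Im z\<bar> + 1" if "w \<in> cball z 1" for w
      using that abs_Im_le_cmod[of "z - w"] by (auto simp: dist_norm)
    with M show "\<exists>r M. r > 0 \<and> cball z r \<subseteq> UNIV \<and> M summable_on UNIV \<and>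
        (\<forall>j\<in>UNIV. \<forall>w\<in>cball z r. norm (theta_term \<tau> w j) \<le> M j)"
      by (intro exI[of _ 1] exI[of _ M]) auto
  qed (auto intro: holomorphic_theta_term)
  then show ?thesis by (rule holomorphic_on_subset) auto
qed

lemma exp_pi_i_odd: "exp (2 * of_real pi * \<i> * (of_int j + 1/2)) = -1"
proof -
  have "exp (2 * of_real pi * \<i> * (of_int j + 1/2)) =
      exp ((2 * of_int j * of_real pi) * \<i>) * exp (of_real pi * \<i>)"
    unfolding exp_add[symmetric] by (rule arg_cong[where f = exp]) (simp add: algebra_simps)
  also have "exp ((2 * of_int j * of_real pi) * \<i>) = 1"
    using exp_integer_2pi[of "of_int j"] by simp
  finally show ?thesis by simp
qed

text \<open>The substitution j -> -1 - j negates j + 1/2. Each term then changes by exp(2 \<pi> i (j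
  + 1/2)) = -1, an effect of the offset 1/2 that is added to z.\<close>

lemma theta_minus: "theta \<tau> (- z) = - theta \<tau> z"
proof -
  have "bij_betw (\<lambda>j::int. - 1 - j) UNIV UNIV"
    by (rule bij_betwI[where g = "\<lambda>j. - 1 - j"]) auto
  then have "theta \<tau> (- z) = (\<Sum>\<^sub>\<infinity>j. theta_term \<tau> (- z) (- 1 - j))"
    unfolding theta_eq_infsum by (rule infsum_reindex_bij_betw[symmetric])
  also have "\<dots> = (\<Sum>\<^sub>\<infinity>j. (-1) * theta_term \<tau> z j)"
  proof (rule infsum_cong)
    fix j
    have "theta_term \<tau> (- z) (- 1 - j) * exp (2 * of_real pi * \<i> * (of_int j + 1/2)) = theta_term \<tau> z j"
      unfolding theta_term_def exp_add[symmetric]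
      by (rule arg_cong[where f = exp]) (simp add: field_simps power2_eq_square)
    then show "theta_term \<tau> (- z) (- 1 - j) = (-1) * theta_term \<tau> z j"
      unfolding exp_pi_i_odd by (simp add: minus_equation_iff)
  qed
  finally show ?thesis unfolding infsum_cmult_right' theta_eq_infsum by simp
qed

lemma theta_0: "theta \<tau> 0 = 0"
  using theta_minus[of \<tau> 0] by simp

lemma theta_plus_1: "theta \<tau> (z + 1) = - theta \<tau> z"
proof -
  have "theta_term \<tau> (z + 1) j = (-1) * theta_term \<tau> z j" for j
  proof -
    have "theta_term \<tau> (z + 1) j = exp (2 * of_real pi * \<i> * (of_int j + 1/2)) * theta_term \<tau> z j"
      unfolding theta_term_def exp_add[symmetric]
      by (rule arg_cong[where f = exp]) (simp add: field_simps)
    then show ?thesis unfolding exp_pi_i_odd .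
  qed
  then have "theta \<tau> (z + 1) = (\<Sum>\<^sub>\<infinity>j. (-1) * theta_term \<tau> z j)"
    unfolding theta_eq_infsum by (rule infsum_cong)
  then show ?thesis unfolding infsum_cmult_right' theta_eq_infsum by simp
qed

text \<open>Completing the square, (j + 1/2)^2 + 2 (j + 1/2) = (j + 3/2)^2 - 1, turns the
  translation by \<tau> into a shift of the summation index.\<close>

lemma theta_plus_tau:
  "theta \<tau> (z + \<tau>) = - exp (- of_real pi * \<i> * \<tau> - 2 * of_real pi * \<i> * z) * theta \<tau> z"
proof -
  define c where "c = - exp (- of_real pi * \<i> * \<tau> - 2 * of_real pi * \<i> * z)"
  have "theta_term \<tau> (z + \<tau>) j = c * theta_term \<tau> z (j + 1)" for j
  proof -
    have "theta_term \<tau> (z + \<tau>) j = exp (- of_real pi * \<i> * \<tau> - 2 * of_real pi * \<i> * z)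
        * exp (- of_real pi * \<i>) * theta_term \<tau> z (j + 1)"
      unfolding theta_term_def exp_add[symmetric]
      by (rule arg_cong[where f = exp]) (simp add: field_simps power2_eq_square)
    then show ?thesis by (simp add: c_def exp_minus exp_pi_i)
  qed
  then have "theta \<tau> (z + \<tau>) = c * (\<Sum>\<^sub>\<infinity>j. theta_term \<tau> z (j + 1))"
    unfolding theta_eq_infsum infsum_cmult_right'[symmetric] by (rule infsum_cong)
  also have "bij_betw (\<lambda>j::int. j + 1) UNIV UNIV"
    by (rule bij_betwI[where g = "\<lambda>j. j - 1"]) auto
  then have "(\<Sum>\<^sub>\<infinity>j. theta_term \<tau> z (j + 1)) = theta \<tau> z"
    unfolding theta_eq_infsum by (rule infsum_reindex_bij_betw)
  finally show ?thesis unfolding c_def .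
qed

lemma has_integral_exp_int:
  "((\<lambda>x::real. exp (2 * of_real pi * \<i> * of_int j * of_real x)) has_integral (if j = 0 then 1 else 0)) {0..1}"
proof (cases "j = 0")
  case True
  then show ?thesis using has_integral_const_real[of "1::complex" 0 1] by simp
next
  case False
  define c where "c = 2 * of_real pi * \<i> * of_int j"
  have "c \<noteq> 0" using False by (simp add: c_def)
  have "((\<lambda>x. exp (c * of_real x)) has_integral
      (exp (c * of_real 1) / c - exp (c * of_real 0) / c)) {0..1}"
  proof (rule fundamental_theorem_of_calculus)
    fix x :: real
    have "((\<lambda>z. exp (c * z) / c) has_field_derivative exp (c * of_real x)) (at (of_real x))"
      using \<open>c \<noteq> 0\<close> by (auto intro!: derivative_eq_intros)
    from has_vector_derivative_real_field[OF this]
    show "((\<lambda>x. exp (c * of_real x) / c) has_vector_derivative exp (c * of_real x)) (at x within {0..1})" .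
  qed simp
  moreover have "exp c = 1"
    using exp_integer_2pi[of "of_int j"] by (simp add: c_def mult_ac)
  ultimately show ?thesis using False by (simp add: c_def)
qed

text \<open>The zeroth Fourier coefficient of \<open>x \<mapsto> exp (- \<pi> i x) \<vartheta> x\<close> does not vanish.\<close>

lemma theta_not_identically_zero:
  assumes "Im \<tau> > 0"
  shows "\<exists>z. theta \<tau> z \<noteq> 0"
proof (rule ccontr)
  assume "\<not> ?thesis"
  then have zero: "theta \<tau> z = 0" for z by blast
  \<comment> \<open>The factor exp(-\<pi> i x) makes the half-integral frequencies integral, so that
    integration over [0, 1] isolates the term j = 0.\<close>
  define f where "f j x = exp (- of_real pi * \<i> * of_real x) * theta_term \<tau> (of_real x) j" for j x
  have f_eq: "f j x = theta_term \<tau> 0 j * exp (2 * of_real pi * \<i> * of_int j * of_real x)" for j x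
    unfolding f_def theta_term_def exp_add[symmetric]
    by (rule arg_cong[where f = exp]) (simp add: field_simps)
  obtain M where M: "M summable_on UNIV"
      "\<And>z j. \<bar>Im z\<bar> \<le> 0 \<Longrightarrow> norm (theta_term \<tau> z j) \<le> M j"
    using theta_term_bound[OF assms] by metis
  have "norm (f j x) \<le> M j" for j x
    using M(2)[of "of_real x" j] by (simp add: f_def norm_mult)
  then have "uniform_limit (cbox 0 1) (\<lambda>X x. \<Sum>j\<in>X. f j x) (\<lambda>x. \<Sum>\<^sub>\<infinity>j. f j x)
      (finite_subsets_at_top UNIV)"
    by (intro Weierstrass_m_test_general[OF _ M(1)])
  moreover have "(\<Sum>\<^sub>\<infinity>j. f j x) = 0" for x
    unfolding f_def infsum_cmult_right' theta_eq_infsum[symmetric] zero by simp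
  ultimately have lim: "uniform_limit (cbox 0 1) (\<lambda>X x. \<Sum>j\<in>X. f j x) (\<lambda>x. 0)
      (finite_subsets_at_top UNIV)" by simp
  have "continuous_on (cbox 0 1) (\<lambda>x. \<Sum>j\<in>X. f j x)" for X
    unfolding f_eq by (intro continuous_intros)
  then obtain I J where IJ: "\<And>X. ((\<lambda>x. \<Sum>j\<in>X. f j x) has_integral I X) (cbox 0 1)"
      "((\<lambda>x. 0) has_integral J) (cbox (0::real) 1)" "(I \<longlongrightarrow> J) (finite_subsets_at_top UNIV)"
    using uniform_limit_integral_cbox[OF lim _ finite_subsets_at_top_neq_bot] by blast
  have "J = 0" using IJ(2) by (simp add: has_integral_0_eq)
  \<comment> \<open>Every finite index set containing 0 gives the same integral, so the net of
    integrals is eventually constant.\<close>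
  have "eventually (\<lambda>X. I X = theta_term \<tau> 0 0) (finite_subsets_at_top UNIV)"
    unfolding eventually_finite_subsets_at_top
  proof (intro exI[of _ "{0}"] conjI allI impI)
    fix X :: "int set" assume X: "finite X \<and> {0} \<subseteq> X \<and> X \<subseteq> UNIV"
    have "((\<lambda>x. \<Sum>j\<in>X. f j x) has_integral (\<Sum>j\<in>X. theta_term \<tau> 0 j * (if j = 0 then 1 else 0))) (cbox 0 1)"
      unfolding f_eq cbox_interval using X
      by (intro has_integral_sum has_integral_mult_right has_integral_exp_int) auto
    also have "(\<Sum>j\<in>X. theta_term \<tau> 0 j * (if j = 0 then 1 else 0)) = theta_term \<tau> 0 0"
      using X by (simp add: if_distrib sum.delta cong: if_cong)
    finally show "I X = theta_term \<tau> 0 0" using IJ(1) has_integral_unique by blast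
  qed auto
  then have "(I \<longlongrightarrow> theta_term \<tau> 0 0) (finite_subsets_at_top UNIV)"
    by (rule tendsto_eventually)
  then have "theta_term \<tau> 0 0 = 0"
    using IJ(3) \<open>J = 0\<close> tendsto_unique finite_subsets_at_top_neq_bot by blast
  then show False by (simp add: theta_term_def)
qed

subsection \<open>The zeros of the theta function\<close>

lemma isolated_singularity_quotient:
  assumes "f holomorphic_on UNIV" "g holomorphic_on UNIV"
  shows "isolated_singularity_at (\<lambda>z. f z / g z) z"
proof (rule meromorphic_on_isolated_singularity, rule meromorphic_on_divide)
  show "f meromorphic_on {z}" "g meromorphic_on {z}"
    using assms analytic_on_open[of UNIV] analytic_on_subset[of _ UNIV "{z}"]
    by (auto intro!: analytic_on_imp_meromorphic_on)
qed

section \<open>The q-Pochhammer product (x; q) with infinitely many factors\<close>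

definition qprod :: "complex \<Rightarrow> complex \<Rightarrow> complex" where
  "qprod q x = (\<Prod>n. 1 - q ^ n * x)"

lemma convergent_qprod:
  fixes q x :: complex
  assumes "norm q < 1"
  shows "convergent_prod (\<lambda>n. 1 - q ^ n * x)"
proof -
  have "summable (\<lambda>n. norm q ^ n * norm x)"
    using assms by (intro summable_mult2 summable_geometric) auto
  then have "abs_convergent_prod (\<lambda>n. 1 - q ^ n * x)"
    by (simp add: abs_convergent_prod_conv_summable norm_mult norm_power)
  then show ?thesis by (rule abs_convergent_prod_imp_convergent_prod)
qed

text \<open>A product that converges in the sense of \<open>has_prod\<close> has a nonzero tail, so
  it vanishes only through one of its factors.\<close>

lemma qprod_eq_0_iff:
  assumes "norm q < 1"
  shows "qprod q x = 0 \<longleftrightarrow> (\<exists>n. q ^ n * x = 1)"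
proof -
  have "(\<lambda>n. 1 - q ^ n * x) has_prod qprod q x"
    unfolding qprod_def using convergent_prod_has_prod[OF convergent_qprod[OF assms]] .
  from has_prod_eq_0_iff[OF this] show ?thesis by auto
qed

lemma qprod_rec:
  assumes "norm q < 1"
  shows "qprod q x = (1 - x) * qprod q (q * x)"
proof (cases "x = 1")
  \<comment> \<open>A vanishing head factor cannot be split off by division; here both sides are
    0.\<close>
  case True
  then have "\<exists>n. q ^ n * x = 1" by (intro exI[of _ 0]) simp
  then show ?thesis using qprod_eq_0_iff[OF assms, of x] True by simp
next
  case False
  have "(\<Prod>n. 1 - q ^ Suc n * x) = qprod q x / (1 - q ^ 0 * x)"
    unfolding qprod_def
    by (rule prodinf_split_head[OF convergent_qprod[OF assms]]) (use False in auto)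
  then show ?thesis using False by (simp add: qprod_def mult_ac)
qed

text \<open>Locally uniform convergence of the sum of the norms of q^n x makes the partial products
  converge locally uniformly.\<close>

lemma holomorphic_qprod:
  assumes "norm q < 1"
  shows "qprod q holomorphic_on UNIV"
proof -
  have "qprod q field_differentiable at z" for z
  proof -
    define g where "g x = lim (\<lambda>N. \<Prod>n<N. 1 + - (q ^ n * x))" for x
    have "uniform_limit (cball z 1) (\<lambda>N x. \<Sum>n<N. norm (- (q ^ n * x)))
        (\<lambda>x. \<Sum>n. norm (- (q ^ n * x))) sequentially"
    proof (rule Weierstrass_m_test)
      fix n x assume "x \<in> cball z 1"
      then have "norm x \<le> norm z + 1"
        using norm_triangle_ineq2[of x z] by (simp add: dist_norm norm_minus_commute)
      then show "norm (norm (- (q ^ n * x))) \<le> norm q ^ n * (norm z + 1)"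
        by (simp add: norm_mult norm_power mult_left_mono)
    next
      show "summable (\<lambda>n. norm q ^ n * (norm z + 1))"
        using assms by (intro summable_mult2 summable_geometric) auto
    qed
    then have "uniformly_convergent_on (cball z 1) (\<lambda>N x. \<Sum>n<N. norm (- (q ^ n * x)))"
      by (auto simp: uniformly_convergent_on_def)
    then have "uniformly_convergent_on (cball z 1) (\<lambda>N x. \<Prod>n<N. 1 + - (q ^ n * x))"
      by (intro uniformly_convergent_on_prod continuous_intros) auto
    then have ul: "uniform_limit (cball z 1) (\<lambda>N x. \<Prod>n<N. 1 + - (q ^ n * x)) g sequentially"
      unfolding g_def by (simp add: uniformly_convergent_uniform_limit_iff)
    have ev: "eventually (\<lambda>N. continuous_on (cball z 1) (\<lambda>x. \<Prod>n<N. 1 + - (q ^ n * x)) \<and>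
        (\<lambda>x. \<Prod>n<N. 1 + - (q ^ n * x)) holomorphic_on ball z 1) sequentially"
      by (intro always_eventually allI conjI continuous_intros holomorphic_intros)
    have "g holomorphic_on ball z 1"
      using holomorphic_uniform_limit[OF ev ul] by auto
    then have "qprod q holomorphic_on ball z 1"
    proof (rule holomorphic_transform)
      fix x
      have "(\<lambda>N. \<Prod>n\<le>N. 1 - q ^ n * x) \<longlonglongrightarrow> qprod q x"
        unfolding qprod_def by (rule convergent_prod_LIMSEQ[OF convergent_qprod[OF assms]])
      then have "(\<lambda>N. \<Prod>n<N. 1 - q ^ n * x) \<longlonglongrightarrow> qprod q x"
        by (simp add: LIMSEQ_lessThan_iff_atMost)
      then show "g x = qprod q x" unfolding g_def by (auto intro: limI)
    qed
    then show ?thesis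
      by (meson centre_in_ball holomorphic_on_imp_differentiable_at open_ball zero_less_one)
  qed
  then show ?thesis by (auto simp: holomorphic_on_def field_differentiable_at_within)
qed

text \<open>By the Jacobi triple product identity, \<open>\<vartheta>\<close> is a constant multiple of the following function.\<close>

definition theta_product :: "complex \<Rightarrow> complex \<Rightarrow> complex" where
  "theta_product \<tau> z = exp (- of_real pi * \<i> * z) *
     qprod (exp (2 * of_real pi * \<i> * \<tau>)) (exp (2 * of_real pi * \<i> * z)) *
     qprod (exp (2 * of_real pi * \<i> * \<tau>)) (exp (2 * of_real pi * \<i> * (\<tau> - z)))"

lemma norm_nome_less_1: "Im \<tau> > 0 \<Longrightarrow> norm (exp (2 * of_real pi * \<i> * \<tau>)) < 1"
  by simp

lemma holomorphic_theta_product: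
  assumes "Im \<tau> > 0"
  shows "theta_product \<tau> holomorphic_on UNIV"
proof -
  have *: "(\<lambda>z. qprod (exp (2 * of_real pi * \<i> * \<tau>)) (g z)) holomorphic_on UNIV"
    if "g holomorphic_on UNIV" for g
    using holomorphic_on_compose_gen[OF that holomorphic_qprod[OF norm_nome_less_1[OF assms]]]
    by (simp add: o_def)
  show ?thesis
    unfolding theta_product_def[abs_def] by (intro holomorphic_intros *)
qed

lemma qprod_exp_rec:
  assumes "Im \<tau> > 0"
  shows "qprod (exp (2 * of_real pi * \<i> * \<tau>)) (exp (2 * of_real pi * \<i> * z)) =
    (1 - exp (2 * of_real pi * \<i> * z)) *
      qprod (exp (2 * of_real pi * \<i> * \<tau>)) (exp (2 * of_real pi * \<i> * (z + \<tau>)))"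
proof -
  have "exp (2 * of_real pi * \<i> * (z + \<tau>)) = exp (2 * of_real pi * \<i> * \<tau>) * exp (2 * of_real pi * \<i> * z)"
    unfolding exp_add[symmetric] by (rule arg_cong[where f = exp]) (simp add: algebra_simps)
  then show ?thesis by (simp only: qprod_rec[OF norm_nome_less_1[OF assms], symmetric])
qed

lemma exp_2pi_i_plus_int: "exp (2 * of_real pi * \<i> * (z + of_int n)) = exp (2 * of_real pi * \<i> * z)"
proof -
  have "exp ((2 * of_int n * of_real pi) * \<i>) = (1 :: complex)"
    using exp_integer_2pi[of "of_int n"] by simp
  then show ?thesis by (simp add: ring_distribs exp_add mult_ac)
qed

lemma theta_product_plus_1: "theta_product \<tau> (z + 1) = - theta_product \<tau> z"
proof -
  have "exp (2 * of_real pi * \<i> * (\<tau> - (z + 1))) = exp (2 * of_real pi * \<i> * (\<tau> - z))"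
    using exp_2pi_i_plus_int[of "\<tau> - z" "-1"] by (simp add: algebra_simps)
  moreover have "exp (- of_real pi * \<i> * (z + 1)) = - exp (- of_real pi * \<i> * z)"
    by (simp add: ring_distribs exp_diff exp_pi_i)
  ultimately show ?thesis
    using exp_2pi_i_plus_int[of z 1] by (simp add: theta_product_def)
qed

text \<open>The translation moves one factor from the first q-product to the second, and 1 - 1/e =
  -(1 - e) / e. Both recursions are used in the direction that avoids dividing by 1 - e, which may
  vanish.\<close>

lemma theta_product_plus_tau:
  assumes "Im \<tau> > 0"
  shows "theta_product \<tau> (z + \<tau>) =
    - exp (- of_real pi * \<i> * \<tau> - 2 * of_real pi * \<i> * z) * theta_product \<tau> z"
proof -
  define P where "P z = qprod (exp (2 * of_real pi * \<i> * \<tau>)) (exp (2 * of_real pi * \<i> * z))" for z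
  define e where "e = exp (2 * of_real pi * \<i> * z)"
  have e: "e \<noteq> 0" by (simp add: e_def)
  have 1: "P z = (1 - e) * P (z + \<tau>)"
    unfolding P_def e_def by (rule qprod_exp_rec[OF assms])
  have "P (- z) = (1 - exp (2 * of_real pi * \<i> * (- z))) * P (- z + \<tau>)"
    unfolding P_def by (rule qprod_exp_rec[OF assms])
  then have 2: "P (- z) = (1 - 1 / e) * P (\<tau> - z)"
    by (simp add: e_def exp_minus field_simps)
  have "theta_product \<tau> (z + \<tau>) = exp (- of_real pi * \<i> * (z + \<tau>)) * P (z + \<tau>) * P (- z)"
    by (simp add: theta_product_def P_def)
  also have "\<dots> = exp (- of_real pi * \<i> * (z + \<tau>)) * (- 1 / e) * (P z * P (\<tau> - z))"
    unfolding 1 2 using e by (simp add: field_simps)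
  also have "\<dots> = - (exp (- of_real pi * \<i> * \<tau>) / e) * (exp (- of_real pi * \<i> * z) * P z * P (\<tau> - z))"
    by (simp add: ring_distribs exp_add exp_diff exp_minus field_simps)
  also have "exp (- of_real pi * \<i> * \<tau>) / e = exp (- of_real pi * \<i> * \<tau> - 2 * of_real pi * \<i> * z)"
    by (simp add: e_def exp_diff)
  finally show ?thesis by (simp add: theta_product_def P_def)
qed

lemma qprod_exp_zeros:
  assumes "Im \<tau> > 0" "qprod (exp (2 * of_real pi * \<i> * \<tau>)) (exp (2 * of_real pi * \<i> * z)) = 0"
  obtains n :: nat and m :: int where "z = of_int m - of_nat n * \<tau>"
proof -
  obtain n where "exp (2 * of_real pi * \<i> * \<tau>) ^ n * exp (2 * of_real pi * \<i> * z) = 1"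
    using assms(2) unfolding qprod_eq_0_iff[OF norm_nome_less_1[OF assms(1)]] by blast
  moreover have "exp (2 * of_real pi * \<i> * (z + of_nat n * \<tau>)) =
      exp (2 * of_real pi * \<i> * \<tau>) ^ n * exp (2 * of_real pi * \<i> * z)"
    unfolding exp_of_nat_mult[symmetric] exp_add[symmetric]
    by (rule arg_cong[where f = exp]) (simp add: algebra_simps)
  ultimately have "exp (2 * of_real pi * \<i> * (z + of_nat n * \<tau>)) = 1"
    by simp
  then obtain m :: int where "Re (2 * of_real pi * \<i> * (z + of_nat n * \<tau>)) = 0"
      "Im (2 * of_real pi * \<i> * (z + of_nat n * \<tau>)) = of_int (2 * m) * pi"
    unfolding exp_eq_1 by blast
  then have "z = of_int m - of_nat n * \<tau>"
    by (auto simp: complex_eq_iff)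
  then show ?thesis using that by blast
qed

lemma lattice_0: "0 \<in> lattice \<tau>"
  unfolding lattice_def by (auto intro!: exI[of _ 0])

lemma theta_product_zeros:
  assumes "Im \<tau> > 0" "theta_product \<tau> z = 0"
  shows "z \<in> lattice \<tau>"
proof -
  from assms(2) consider
      "qprod (exp (2 * of_real pi * \<i> * \<tau>)) (exp (2 * of_real pi * \<i> * z)) = 0"
    | "qprod (exp (2 * of_real pi * \<i> * \<tau>)) (exp (2 * of_real pi * \<i> * (\<tau> - z))) = 0"
    by (auto simp: theta_product_def)
  then show ?thesis
  proof cases
    case 1
    then obtain n m where "z = of_int m - of_nat n * \<tau>"
      using qprod_exp_zeros[OF assms(1)] by metis
    then have "z = of_int m + of_int (- int n) * \<tau>" by simp
    then show ?thesis unfolding lattice_def by blast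
  next
    case 2
    then obtain n m where "\<tau> - z = of_int m - of_nat n * \<tau>"
      using qprod_exp_zeros[OF assms(1)] by metis
    then have "z = of_int (- m) + of_int (int n + 1) * \<tau>" by (simp add: algebra_simps)
    then show ?thesis unfolding lattice_def by blast
  qed
qed

lemma theta_product_0: "Im \<tau> > 0 \<Longrightarrow> theta_product \<tau> 0 = 0"
  using qprod_exp_rec[of \<tau> 0] by (simp add: theta_product_def)

text \<open>Splitting off 1 - exp(2 \<pi> i z), which has a simple zero at 0, leaves a cofactor with
  value \<open>P \<tau>\<close> squared at 0. The zeros of \<open>P\<close> are of the form m - n
  \<tau> with n \<ge> 0, so \<tau> is not among them.\<close>

lemma theta_product_deriv_0:
  assumes "Im \<tau> > 0"
  obtains d where "(theta_product \<tau> has_field_derivative d) (at 0)" "d \<noteq> 0"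
proof -
  define P where "P z = qprod (exp (2 * of_real pi * \<i> * \<tau>)) (exp (2 * of_real pi * \<i> * z))" for z
  define K where "K z = exp (- of_real pi * \<i> * z) * P (z + \<tau>) * P (\<tau> - z)" for z
  have eq: "theta_product \<tau> = (\<lambda>z. (1 - exp (2 * of_real pi * \<i> * z)) * K z)"
  proof
    fix z
    have "P z = (1 - exp (2 * of_real pi * \<i> * z)) * P (z + \<tau>)"
      unfolding P_def by (rule qprod_exp_rec[OF assms])
    then have "exp (- of_real pi * \<i> * z) * P z * P (\<tau> - z) =
        (1 - exp (2 * of_real pi * \<i> * z)) * K z"
      by (simp only: K_def mult_ac)
    then show "theta_product \<tau> z = (1 - exp (2 * of_real pi * \<i> * z)) * K z"
      by (simp only: theta_product_def P_def)
  qed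
  have *: "(\<lambda>z. P (g z)) holomorphic_on UNIV" if "g holomorphic_on UNIV" for g
    using holomorphic_on_compose_gen[OF _ holomorphic_qprod[OF norm_nome_less_1[OF assms]],
      of "\<lambda>z. exp (2 * of_real pi * \<i> * g z)" UNIV] that
    by (simp add: o_def P_def[abs_def] holomorphic_intros)
  have "K holomorphic_on UNIV"
    unfolding K_def[abs_def] by (intro holomorphic_intros *)
  then have "(K has_field_derivative deriv K 0) (at 0)"
    using holomorphic_derivI open_UNIV by blast
  then have "(theta_product \<tau> has_field_derivative (- (2 * of_real pi * \<i>)) * K 0) (at 0)"
    unfolding eq by (auto intro!: derivative_eq_intros)
  moreover have "P \<tau> \<noteq> 0"
  proof
    assume "P \<tau> = 0"
    then obtain n m where "\<tau> = of_int m - of_nat n * \<tau>"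
      using qprod_exp_zeros[OF assms] unfolding P_def by metis
    from arg_cong[OF this, of Im] have "(1 + of_nat n) * Im \<tau> = 0" by (simp add: algebra_simps)
    then show False using assms by (simp add: add_eq_0_iff)
  qed
  then have "(- (2 * of_real pi * \<i>)) * K 0 \<noteq> 0" by (simp add: K_def)
  ultimately show ?thesis using that by blast
qed

section \<open>Comparison of the theta series with its product\<close>

lemma zero_shift_of_int:
  fixes f :: "complex \<Rightarrow> complex"
  assumes "\<And>w. f (w + k) = 0 \<longleftrightarrow> f w = 0"
  shows "f (w + of_int m * k) = 0 \<longleftrightarrow> f w = 0"
proof -
  \<comment> \<open>The multiplier of theta under \<tau> is not constant, but the indicator of the
    nonzero set is periodic, and \<open>quasi_periodic_of_int\<close> applies to it with multiplier
    1.\<close>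
  define g where "g w = (if f w = 0 then 0 else 1 :: complex)" for w
  have "g (w + of_int m * k) = 1 powi m * g w"
    by (rule quasi_periodic_of_int) (auto simp: g_def assms)
  then show ?thesis by (auto simp: g_def split: if_splits)
qed

lemma theta_lattice_eq_0:
  assumes "z \<in> lattice \<tau>"
  shows "theta \<tau> z = 0"
proof -
  obtain m n where z: "z = of_int m + of_int n * \<tau>"
    using assms unfolding lattice_def by blast
  have 1: "theta \<tau> (w + 1) = 0 \<longleftrightarrow> theta \<tau> w = 0" for w by (simp add: theta_plus_1)
  have 2: "theta \<tau> (w + \<tau>) = 0 \<longleftrightarrow> theta \<tau> w = 0" for w by (simp add: theta_plus_tau)
  have "theta \<tau> (0 + of_int m * 1 + of_int n * \<tau>) = 0"
    unfolding zero_shift_of_int[where f = "theta \<tau>" and k = \<tau>, OF 2]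
    unfolding zero_shift_of_int[where f = "theta \<tau>" and k = 1, OF 1] by (rule theta_0)
  then show ?thesis by (simp add: z)
qed

text \<open>Both functions have the same multipliers, and at lattice points the simple zero of the
  product is met by a zero of theta, so the quotient is elliptic without poles. A point where theta
  is nonzero shows that the constant is nonzero.\<close>

lemma theta_quotient_const:
  assumes \<tau>: "Im \<tau> > 0"
  obtains c where "\<And>z. (\<lambda>w. theta \<tau> w / theta_product \<tau> w) \<midarrow>z\<rightarrow> c" "c \<noteq> 0"
proof -
  define f where "f w = theta \<tau> w / theta_product \<tau> w" for w
  note hol = holomorphic_theta[OF \<tau>, of UNIV] holomorphic_theta_product[OF \<tau>]
  have cont: "f \<midarrow>z\<rightarrow> f z" if "z \<notin> lattice \<tau>" for z
  proof -
    have "isCont (theta \<tau>) z" "isCont (theta_product \<tau>) z"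
      using hol[THEN holomorphic_on_imp_continuous_on] by (simp_all add: continuous_on_eq_continuous_at)
    moreover have "theta_product \<tau> z \<noteq> 0" using theta_product_zeros[OF \<tau>] that by blast
    ultimately show ?thesis unfolding f_def by (intro tendsto_divide isContD)
  qed
  obtain d where d: "(theta_product \<tau> has_field_derivative d) (at 0)" "d \<noteq> 0"
    using theta_product_deriv_0[OF \<tau>] .
  have "(theta \<tau> has_field_derivative deriv (theta \<tau>) 0) (at 0)"
    using holomorphic_derivI[OF hol(1)] by auto
  then have lim0: "f \<midarrow>0\<rightarrow> deriv (theta \<tau>) 0 / d"
    unfolding f_def[abs_def] using d theta_0 theta_product_0[OF \<tau>]
    by (intro lhopital_complex_simple) auto
  have lim: "\<exists>m n c. f \<midarrow>z + of_int m + of_int n * \<tau>\<rightarrow> c" for z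
  proof (cases "z \<in> lattice \<tau>")
    case True
    then obtain m n where "z = of_int m + of_int n * \<tau>" unfolding lattice_def by blast
    then have "z + of_int (- m) + of_int (- n) * \<tau> = 0" by simp
    then show ?thesis using lim0 by metis
  next
    case False
    then show ?thesis using cont[of z] by (intro exI[of _ 0] exI[of _ "f z"]) simp
  qed
  have iso: "isolated_singularity_at f z" for z
    unfolding f_def[abs_def] by (rule isolated_singularity_quotient[OF hol])
  have per: "f (w + 1) = 1 * f w" "f (w + \<tau>) = 1 * f w" for w
    by (simp_all add: f_def theta_plus_1 theta_product_plus_1 theta_plus_tau theta_product_plus_tau[OF \<tau>])
  obtain c where c: "\<And>z. f \<midarrow>z\<rightarrow> c"
    using quasi_elliptic_constant[where f = f, OF \<tau> iso lim per] by auto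
  obtain z where z: "theta \<tau> z \<noteq> 0" using theta_not_identically_zero[OF \<tau>] by blast
  then have "z \<notin> lattice \<tau>" using theta_lattice_eq_0 by blast
  then have "c = f z" "theta_product \<tau> z \<noteq> 0"
    using cont c LIM_unique theta_product_zeros[OF \<tau>] by blast+
  then have "c \<noteq> 0" using z by (simp add: f_def)
  with c that show ?thesis unfolding f_def by blast
qed

text \<open>Off the lattice the product does not vanish and the quotient by it is continuous; a zero
  of theta there would make the nonzero constant 0.\<close>

lemma theta_eq_0_iff:
  assumes \<tau>: "Im \<tau> > 0"
  shows "theta \<tau> z = 0 \<longleftrightarrow> z \<in> lattice \<tau>"
proof
  assume zero: "theta \<tau> z = 0"
  show "z \<in> lattice \<tau>"
  proof (rule ccontr)
    assume "z \<notin> lattice \<tau>"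
    then have nz: "theta_product \<tau> z \<noteq> 0" using theta_product_zeros[OF \<tau>] by blast
    obtain c where c: "(\<lambda>w. theta \<tau> w / theta_product \<tau> w) \<midarrow>z\<rightarrow> c" "c \<noteq> 0"
      using theta_quotient_const[OF \<tau>] by metis
    have "isCont (theta \<tau>) z" "isCont (theta_product \<tau>) z"
      using holomorphic_theta[OF \<tau>, of UNIV] holomorphic_theta_product[OF \<tau>]
      by (auto dest!: holomorphic_on_imp_continuous_on simp: continuous_on_eq_continuous_at)
    then have "(\<lambda>w. theta \<tau> w / theta_product \<tau> w) \<midarrow>z\<rightarrow> theta \<tau> z / theta_product \<tau> z"
      using nz by (intro tendsto_divide isContD)
    then have "c = 0" using c(1) zero LIM_unique by fastforce
    with c(2) show False by simp
  qed
qed (rule theta_lattice_eq_0)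

lemma theta_has_derivative:
  "Im \<tau> > 0 \<Longrightarrow> (theta \<tau> has_field_derivative deriv (theta \<tau>) z) (at z)"
  using holomorphic_derivI[OF holomorphic_theta[of \<tau> UNIV]] by auto

lemma deriv_theta_0_nonzero:
  assumes \<tau>: "Im \<tau> > 0"
  shows "deriv (theta \<tau>) 0 \<noteq> 0"
proof -
  obtain c where c: "(\<lambda>w. theta \<tau> w / theta_product \<tau> w) \<midarrow>0\<rightarrow> c" "c \<noteq> 0"
    using theta_quotient_const[OF \<tau>] by metis
  obtain d where d: "(theta_product \<tau> has_field_derivative d) (at 0)" "d \<noteq> 0"
    using theta_product_deriv_0[OF \<tau>] .
  have "(\<lambda>w. theta \<tau> w / theta_product \<tau> w) \<midarrow>0\<rightarrow> deriv (theta \<tau>) 0 / d"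
    using d theta_0 theta_product_0[OF \<tau>] theta_has_derivative[OF \<tau>]
    by (intro lhopital_complex_simple) auto
  then have "deriv (theta \<tau>) 0 / d = c" using c LIM_unique by blast
  then show ?thesis using c d by auto
qed

subsection \<open>The functions \<open>\<phi>\<^sub>\<alpha>\<close>\<close>

definition omega_deriv :: "3 \<Rightarrow> complex" where
  "omega_deriv \<alpha> = (if \<alpha> = 1 then 0 else 1/2)"

lemma deriv_omega: "deriv (omega \<alpha>) \<tau> = omega_deriv \<alpha>"
proof -
  have "(omega \<alpha> has_field_derivative omega_deriv \<alpha>) (at \<tau>)"
    unfolding omega_def[abs_def] omega_deriv_def
    by (cases "\<alpha> = 1"; cases "\<alpha> = 2") (auto intro!: derivative_eq_intros)
  then show ?thesis by (rule DERIV_imp_deriv)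
qed

lemma cases_3: "\<alpha> = 1 \<or> \<alpha> = 2 \<or> (\<alpha> :: 3) = 3"
  using exhaust_3 by blast

lemma omega_not_in_lattice:
  assumes "Im \<tau> > 0"
  shows "omega \<alpha> \<tau> \<notin> lattice \<tau>"
proof
  assume "omega \<alpha> \<tau> \<in> lattice \<tau>"
  then obtain m n :: int where mn: "omega \<alpha> \<tau> = of_int m + of_int n * \<tau>"
    unfolding lattice_def by blast
  \<comment> \<open>Coordinates of the period 2 \<omega>_\<alpha>. At least one of them is odd,
    whereas doubling a lattice point makes both even.\<close>
  define a b :: int where "a = (if \<alpha> = 2 then 0 else 1)" and "b = (if \<alpha> = 1 then 0 else 1)"
  have ab: "a = 1 \<or> b = 1" by (simp add: a_def b_def)
  have "2 * omega \<alpha> \<tau> = of_int a + of_int b * \<tau>"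
    using cases_3[of \<alpha>] by (auto simp: omega_def a_def b_def)
  then have eq: "of_int a + of_int b * \<tau> = of_int (2 * m) + of_int (2 * n) * \<tau>"
    unfolding mn by (simp add: algebra_simps)
  from arg_cong[OF eq, of Im] have "real_of_int b * Im \<tau> = real_of_int (2 * n) * Im \<tau>" by simp
  then have "real_of_int b = real_of_int (2 * n)" using assms by simp
  then have b: "b = 2 * n" by linarith
  from eq have "complex_of_int a = of_int (2 * m)" unfolding b by simp
  then have "a = 2 * m" using of_int_eq_iff by blast
  with b ab show False by presburger
qed

lemma theta_omega_nonzero: "Im \<tau> > 0 \<Longrightarrow> theta \<tau> (omega \<alpha> \<tau>) \<noteq> 0"
  using theta_eq_0_iff omega_not_in_lattice by blast

text \<open>The arguments differ by the period 2 \<omega>_\<alpha>, which is 1, \<tau> or 1 +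
  \<tau>. Centring them at z removes the constant part of the exponential multiplier.\<close>

lemma theta_plus_omega:
  "theta \<tau> (z + omega \<alpha> \<tau>) =
    - exp (- 4 * of_real pi * \<i> * omega_deriv \<alpha> * z) * theta \<tau> (z - omega \<alpha> \<tau>)"
proof -
  consider "\<alpha> = 1" | "\<alpha> = 2" | "\<alpha> = 3" using cases_3 by blast
  then show ?thesis
  proof cases
    case 1
    have "z - 1/2 + 1 = z + 1/2" by simp
    then show ?thesis using theta_plus_1[of \<tau> "z - 1/2"] 1
      by (simp only: omega_def omega_deriv_def) simp
  next
    case 2
    have "theta \<tau> (z - \<tau>/2 + \<tau>) =
        - exp (- of_real pi * \<i> * \<tau> - 2 * of_real pi * \<i> * (z - \<tau>/2)) * theta \<tau> (z - \<tau>/2)"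
      by (rule theta_plus_tau)
    also have "- of_real pi * \<i> * \<tau> - 2 * of_real pi * \<i> * (z - \<tau>/2) = - 4 * of_real pi * \<i> * (1/2) * z"
      by (simp add: field_simps)
    also have "z - \<tau>/2 + \<tau> = z + \<tau>/2" by (simp add: field_simps)
    finally show ?thesis using 2 by (simp add: omega_def omega_deriv_def)
  next
    case 3
    have "theta \<tau> (z - (1 + \<tau>)/2 + 1 + \<tau>) =
        - exp (- of_real pi * \<i> * \<tau> - 2 * of_real pi * \<i> * (z - (1 + \<tau>)/2 + 1)) * - theta \<tau> (z - (1 + \<tau>)/2)"
      unfolding theta_plus_tau theta_plus_1 ..
    also have "- of_real pi * \<i> * \<tau> - 2 * of_real pi * \<i> * (z - (1 + \<tau>)/2 + 1) =
        - 4 * of_real pi * \<i> * (1/2) * z - of_real pi * \<i>"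
      by (simp add: field_simps)
    also have "exp (- 4 * of_real pi * \<i> * (1/2) * z - of_real pi * \<i>) = - exp (- 4 * of_real pi * \<i> * (1/2) * z)"
      by (simp add: exp_diff exp_pi_i)
    also have "z - (1 + \<tau>)/2 + 1 + \<tau> = z + (1 + \<tau>)/2" by (simp add: field_simps)
    finally show ?thesis using 3 by (simp add: omega_def omega_deriv_def)
  qed
qed

text \<open>Clearing the denominator theta(z) removes the poles: this numerator is entire, and its
  value theta'(0) at 0 is the same for all \<alpha>, which gives the three functions residue 1
  there.\<close>

definition varphi_num :: "complex \<Rightarrow> 3 \<Rightarrow> complex \<Rightarrow> complex" where
  "varphi_num \<tau> \<alpha> z = exp (2 * of_real pi * \<i> * omega_deriv \<alpha> * z) * theta \<tau> (z + omega \<alpha> \<tau>)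
     * (deriv (theta \<tau>) 0 / theta \<tau> (omega \<alpha> \<tau>))"

lemma varphi_eq: "varphi \<tau> \<alpha> z = varphi_num \<tau> \<alpha> z / theta \<tau> z"
  by (simp add: varphi_def phi_def varphi_num_def deriv_omega mult_ac)

lemma holomorphic_theta_compose:
  assumes "Im \<tau> > 0" "g holomorphic_on S"
  shows "(\<lambda>z. theta \<tau> (g z)) holomorphic_on S"
  using holomorphic_on_compose_gen[OF assms(2) holomorphic_theta[OF assms(1), of UNIV]]
  by (simp add: o_def)

lemma holomorphic_varphi_num:
  assumes "Im \<tau> > 0" "g holomorphic_on S"
  shows "(\<lambda>z. varphi_num \<tau> \<alpha> (g z)) holomorphic_on S"
  unfolding varphi_num_def
  by (intro holomorphic_intros holomorphic_theta_compose assms)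

lemma varphi_num_0: "Im \<tau> > 0 \<Longrightarrow> varphi_num \<tau> \<alpha> 0 = deriv (theta \<tau>) 0"
  using theta_omega_nonzero by (simp add: varphi_num_def)

text \<open>The pairs (\<open>mult_1 \<alpha>\<close>, \<open>mult_tau \<alpha>\<close>) are the
  three nontrivial sign characters of the lattice; the product of two distinct ones is the
  third.\<close>

definition mult_1 :: "3 \<Rightarrow> complex" where
  "mult_1 \<alpha> = (if \<alpha> = 1 then 1 else - 1)"

definition mult_tau :: "3 \<Rightarrow> complex" where
  "mult_tau \<alpha> = (if \<alpha> = 2 then 1 else - 1)"

lemma varphi_num_plus_1: "varphi_num \<tau> \<alpha> (z + 1) = - mult_1 \<alpha> * varphi_num \<tau> \<alpha> z"
proof -
  have "z + 1 + omega \<alpha> \<tau> = (z + omega \<alpha> \<tau>) + 1" by simp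
  then have "theta \<tau> (z + 1 + omega \<alpha> \<tau>) = - theta \<tau> (z + omega \<alpha> \<tau>)"
    by (simp only: theta_plus_1)
  moreover have "exp (2 * of_real pi * \<i> * omega_deriv \<alpha> * (z + 1)) =
      mult_1 \<alpha> * exp (2 * of_real pi * \<i> * omega_deriv \<alpha> * z)"
    by (simp add: omega_deriv_def mult_1_def ring_distribs exp_add exp_pi_i)
  ultimately show ?thesis by (simp add: varphi_num_def)
qed

text \<open>The exponential prefactor is chosen to make the multiplier a sign. Beyond the multiplier
  of theta at z, prefactor and theta together contribute exp(2 \<pi> i d) with d = \<tau>
  \<open>omega_deriv \<alpha>\<close> - \<omega>_\<alpha>, and d is 0 for \<alpha> = 2 and -1/2
  otherwise.\<close>

lemma varphi_num_plus_tau: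
  "varphi_num \<tau> \<alpha> (z + \<tau>) = mult_tau \<alpha> *
     (- exp (- of_real pi * \<i> * \<tau> - 2 * of_real pi * \<i> * z)) * varphi_num \<tau> \<alpha> z"
proof -
  have "z + \<tau> + omega \<alpha> \<tau> = (z + omega \<alpha> \<tau>) + \<tau>" by simp
  then have "theta \<tau> (z + \<tau> + omega \<alpha> \<tau>) =
      - exp (- of_real pi * \<i> * \<tau> - 2 * of_real pi * \<i> * (z + omega \<alpha> \<tau>)) * theta \<tau> (z + omega \<alpha> \<tau>)"
    by (simp only: theta_plus_tau)
  then have "varphi_num \<tau> \<alpha> (z + \<tau>) = - (exp (2 * of_real pi * \<i> * omega_deriv \<alpha> * (z + \<tau>)) *
      exp (- of_real pi * \<i> * \<tau> - 2 * of_real pi * \<i> * (z + omega \<alpha> \<tau>))) *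
      theta \<tau> (z + omega \<alpha> \<tau>) * (deriv (theta \<tau>) 0 / theta \<tau> (omega \<alpha> \<tau>))"
    unfolding varphi_num_def by (simp only: mult.assoc mult_minus_left mult_minus_right)
  also have "exp (2 * of_real pi * \<i> * omega_deriv \<alpha> * (z + \<tau>)) *
      exp (- of_real pi * \<i> * \<tau> - 2 * of_real pi * \<i> * (z + omega \<alpha> \<tau>)) =
      mult_tau \<alpha> * exp (- of_real pi * \<i> * \<tau> - 2 * of_real pi * \<i> * z) *
        exp (2 * of_real pi * \<i> * omega_deriv \<alpha> * z)"
  proof -
    have "2 * of_real pi * \<i> * omega_deriv \<alpha> * (z + \<tau>) +
        (- of_real pi * \<i> * \<tau> - 2 * of_real pi * \<i> * (z + omega \<alpha> \<tau>)) =
        (- of_real pi * \<i> * \<tau> - 2 * of_real pi * \<i> * z) + 2 * of_real pi * \<i> * omega_deriv \<alpha> * z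
        + (if \<alpha> = 2 then 0 else - (of_real pi * \<i>))"
      using cases_3[of \<alpha>] by (auto simp: omega_def omega_deriv_def field_simps)
    moreover have "exp (if \<alpha> = 2 then 0 else - (of_real pi * \<i>)) = mult_tau \<alpha>"
      by (simp add: mult_tau_def exp_minus exp_pi_i)
    ultimately show ?thesis by (simp only: exp_add[symmetric]) (simp only: exp_add mult_ac)
  qed
  finally show ?thesis unfolding varphi_num_def by (simp only: mult_ac mult_minus_left mult_minus_right)
qed

text \<open>Reflection turns z - \<omega>_\<alpha> into -z + \<omega>_\<alpha>, and
  \<open>theta_plus_omega\<close> leads back to z + \<omega>_\<alpha>. Its exponential is the
  inverse square of the prefactor at z, exactly what the reflected prefactor lacks.\<close>

lemma varphi_minus: "varphi \<tau> \<alpha> (- z) = - varphi \<tau> \<alpha> z"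
proof -
  define e where "e = exp (2 * of_real pi * \<i> * omega_deriv \<alpha> * z)"
  have e: "e \<noteq> 0" by (simp add: e_def)
  have 1: "exp (2 * of_real pi * \<i> * omega_deriv \<alpha> * (- z)) = 1 / e"
    by (simp add: e_def exp_minus field_simps)
  have "exp (- 4 * of_real pi * \<i> * omega_deriv \<alpha> * z) = 1 / (e * e)"
    unfolding e_def exp_add[symmetric] by (simp add: exp_minus field_simps)
  then have 2: "theta \<tau> (z + omega \<alpha> \<tau>) = - (1 / (e * e)) * theta \<tau> (z - omega \<alpha> \<tau>)"
    unfolding theta_plus_omega[of \<tau> z \<alpha>] by simp
  have 3: "theta \<tau> (- z + omega \<alpha> \<tau>) = - theta \<tau> (z - omega \<alpha> \<tau>)"
    using theta_minus[of \<tau> "z - omega \<alpha> \<tau>"] by simp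
  show ?thesis
    unfolding varphi_eq varphi_num_def 1 2 3 theta_minus e_def[symmetric] using e by simp
qed

text \<open>The shift by \<omega>_\<alpha> exchanges zeros and poles: theta(z) cancels, and theta at
  z + \<omega>_\<alpha> and at z - \<omega>_\<alpha> agree up to an exponential. The resulting
  constant is the factor by which \<open>nu'\<close> multiplies \<nu>.\<close>

lemma varphi_minus_omega:
  assumes \<tau>: "Im \<tau> > 0" and z: "z \<notin> lattice \<tau>" "z - omega \<alpha> \<tau> \<notin> lattice \<tau>"
  shows "varphi \<tau> \<alpha> z * varphi \<tau> \<alpha> (z - omega \<alpha> \<tau>) =
      - exp (- 2 * of_real pi * \<i> * omega_deriv \<alpha> * omega \<alpha> \<tau>) *
        (deriv (theta \<tau>) 0 / theta \<tau> (omega \<alpha> \<tau>))^2"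
    and "varphi \<tau> \<alpha> z \<noteq> 0"
proof -
  define C where "C = deriv (theta \<tau>) 0 / theta \<tau> (omega \<alpha> \<tau>)"
  have nz: "theta \<tau> z \<noteq> 0" "theta \<tau> (z - omega \<alpha> \<tau>) \<noteq> 0"
    using z theta_eq_0_iff[OF \<tau>] by auto
  have exps: "exp (2 * of_real pi * \<i> * omega_deriv \<alpha> * z) *
      exp (2 * of_real pi * \<i> * omega_deriv \<alpha> * (z - omega \<alpha> \<tau>)) *
      exp (- 4 * of_real pi * \<i> * omega_deriv \<alpha> * z) =
      exp (- 2 * of_real pi * \<i> * omega_deriv \<alpha> * omega \<alpha> \<tau>)"
    unfolding exp_add[symmetric] by (rule arg_cong[where f = exp]) (simp add: algebra_simps)
  have "varphi \<tau> \<alpha> z * varphi \<tau> \<alpha> (z - omega \<alpha> \<tau>) =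
      - (exp (2 * of_real pi * \<i> * omega_deriv \<alpha> * z) *
      exp (2 * of_real pi * \<i> * omega_deriv \<alpha> * (z - omega \<alpha> \<tau>)) *
      exp (- 4 * of_real pi * \<i> * omega_deriv \<alpha> * z)) * C^2"
    unfolding varphi_eq varphi_num_def theta_plus_omega[of \<tau> z] C_def[symmetric]
    using nz by (simp add: field_simps power2_eq_square)
  then show "varphi \<tau> \<alpha> z * varphi \<tau> \<alpha> (z - omega \<alpha> \<tau>) =
      - exp (- 2 * of_real pi * \<i> * omega_deriv \<alpha> * omega \<alpha> \<tau>) *
        (deriv (theta \<tau>) 0 / theta \<tau> (omega \<alpha> \<tau>))^2"
    unfolding exps C_def .
  show "varphi \<tau> \<alpha> z \<noteq> 0"
    unfolding varphi_eq varphi_num_def theta_plus_omega[of \<tau> z]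
    using nz deriv_theta_0_nonzero[OF \<tau>] theta_omega_nonzero[OF \<tau>] by simp
qed

text \<open>As functions of \<open>z\<close> both sides have the same multipliers, not both \<open>1\<close>, and their
  difference has no poles.\<close>

lemma varphi_addition:
  assumes \<tau>: "Im \<tau> > 0" and z: "z \<notin> lattice \<tau>" and w: "w \<notin> lattice \<tau>" and zw: "z - w \<notin> lattice \<tau>"
    and neq: "\<alpha> \<noteq> \<beta>" "\<beta> \<noteq> \<gamma>" "\<alpha> \<noteq> \<gamma>"
  shows "varphi \<tau> \<gamma> z * varphi \<tau> \<alpha> w =
    varphi \<tau> \<gamma> (z - w) * varphi \<tau> \<beta> w - varphi \<tau> \<alpha> (z - w) * varphi \<tau> \<beta> z"
proof -
  \<comment> \<open>\<open>N\<close> over \<open>D\<close> is the difference of the two sides as a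
    function of z, brought to the common denominator theta(u) theta(u - w).\<close>
  define N where "N u = varphi_num \<tau> \<gamma> u * theta \<tau> (u - w) * varphi \<tau> \<alpha> w
      - varphi_num \<tau> \<gamma> (u - w) * theta \<tau> u * varphi \<tau> \<beta> w
      + varphi_num \<tau> \<alpha> (u - w) * varphi_num \<tau> \<beta> u" for u
  define D where "D u = theta \<tau> u * theta \<tau> (u - w)" for u
  define Q where "Q u = N u / D u" for u
  have hN: "N holomorphic_on UNIV"
    unfolding N_def[abs_def]
    by (intro holomorphic_intros holomorphic_theta_compose holomorphic_varphi_num \<tau>)
  have hD: "D holomorphic_on UNIV"
    unfolding D_def[abs_def] by (intro holomorphic_intros holomorphic_theta_compose \<tau>)
  have mult: "mult_1 \<gamma> = mult_1 \<alpha> * mult_1 \<beta>" "mult_tau \<gamma> = mult_tau \<alpha> * mult_tau \<beta>"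
      "mult_1 \<gamma> \<noteq> 1 \<or> mult_tau \<gamma> \<noteq> 1"
      "norm (mult_1 \<gamma>) = 1" "norm (mult_tau \<gamma>) = 1"
    using neq cases_3[of \<alpha>] cases_3[of \<beta>] cases_3[of \<gamma>]
    by (auto simp: mult_1_def mult_tau_def)
  have per1: "Q (u + 1) = mult_1 \<gamma> * Q u" for u
  proof -
    have s: "u + 1 - w = (u - w) + 1" by simp
    have "N (u + 1) = mult_1 \<gamma> * N u"
      unfolding N_def s theta_plus_1 varphi_num_plus_1 mult(1) by (simp add: algebra_simps)
    moreover have "D (u + 1) = D u" unfolding D_def s theta_plus_1 by simp
    ultimately show ?thesis by (simp add: Q_def)
  qed
  have per2: "Q (u + \<tau>) = mult_tau \<gamma> * Q u" for u
  proof -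
    have s: "u + \<tau> - w = (u - w) + \<tau>" by simp
    define k where "k u = - exp (- of_real pi * \<i> * \<tau> - 2 * of_real pi * \<i> * u)" for u
    have k: "k u \<noteq> 0" for u by (simp add: k_def)
    have "N (u + \<tau>) = mult_tau \<gamma> * N u * (k u * k (u - w))"
      unfolding N_def s theta_plus_tau varphi_num_plus_tau mult(2) k_def[symmetric]
      by (simp add: algebra_simps)
    moreover have "D (u + \<tau>) = D u * (k u * k (u - w))"
      unfolding D_def s theta_plus_tau k_def[symmetric] by simp
    ultimately show ?thesis using k by (simp add: Q_def)
  qed
  have cont: "Q \<midarrow>u\<rightarrow> Q u" if "u \<notin> lattice \<tau>" "u - w \<notin> lattice \<tau>" for u
  proof -
    have "isCont N u" "isCont D u"
      using hN hD by (auto dest!: holomorphic_on_imp_continuous_on simp: continuous_on_eq_continuous_at)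
    moreover have "D u \<noteq> 0" using that theta_eq_0_iff[OF \<tau>] by (simp add: D_def)
    ultimately show ?thesis unfolding Q_def[abs_def] by (intro tendsto_divide isContD)
  qed
  have derD: "(D has_field_derivative deriv (theta \<tau>) u * theta \<tau> (u - w)
      + theta \<tau> u * deriv (theta \<tau>) (u - w)) (at u)" for u
    unfolding D_def[abs_def]
    by (auto intro!: derivative_eq_intros DERIV_chain2[where f = "theta \<tau>"] theta_has_derivative[OF \<tau>])
  have derN: "(N has_field_derivative deriv N u) (at u)" for u
    using holomorphic_derivI[OF hN] by auto
  have nz: "theta \<tau> w \<noteq> 0" "deriv (theta \<tau>) 0 \<noteq> 0" "theta \<tau> (- w) \<noteq> 0"
    using w theta_eq_0_iff[OF \<tau>] deriv_theta_0_nonzero[OF \<tau>] by (auto simp: theta_minus)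
  \<comment> \<open>The residue at 0 cancels because varphi_\<alpha> is odd, the one at w because
    varphi_\<alpha> and varphi_\<gamma> have equal residues at 0.\<close>
  have "N 0 = deriv (theta \<tau>) 0 * theta \<tau> (- w) * (varphi \<tau> \<alpha> w + varphi \<tau> \<alpha> (- w))"
    using nz by (simp add: N_def theta_0 varphi_num_0[OF \<tau>] varphi_eq[of _ _ "- w"] field_simps)
  then have N0: "N 0 = 0" by (simp add: varphi_minus)
  have Nw: "N w = 0"
    using nz by (simp add: N_def theta_0 varphi_num_0[OF \<tau>] varphi_eq[of _ \<beta> w])
  \<comment> \<open>As w is not in the lattice, \<open>D\<close> has simple zeros at 0 and at w, so
    one application of L'Hopital's rule settles each point.\<close>
  have lim0: "Q \<midarrow>0\<rightarrow> deriv N 0 / (deriv (theta \<tau>) 0 * theta \<tau> (0 - w) + theta \<tau> 0 * deriv (theta \<tau>) (0 - w))"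
    unfolding Q_def[abs_def] by (rule lhopital_complex_simple[OF derN derD N0 _ _ refl])
      (use nz in \<open>simp_all add: D_def theta_0\<close>)
  have limw: "Q \<midarrow>w\<rightarrow> deriv N w / (deriv (theta \<tau>) w * theta \<tau> (w - w) + theta \<tau> w * deriv (theta \<tau>) (w - w))"
    unfolding Q_def[abs_def] by (rule lhopital_complex_simple[OF derN derD Nw _ _ refl])
      (use nz in \<open>simp_all add: D_def theta_0\<close>)
  have lim: "\<exists>m n c. Q \<midarrow>u + of_int m + of_int n * \<tau>\<rightarrow> c" for u
  proof -
    consider "u \<in> lattice \<tau>" | "u - w \<in> lattice \<tau>" | "u \<notin> lattice \<tau>" "u - w \<notin> lattice \<tau>" by blast
    then show ?thesis
    proof cases
      case 1
      then obtain m n where "u = of_int m + of_int n * \<tau>" unfolding lattice_def by blast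
      then have "u + of_int (- m) + of_int (- n) * \<tau> = 0" by simp
      then show ?thesis using lim0 by metis
    next
      case 2
      then obtain m n where "u - w = of_int m + of_int n * \<tau>" unfolding lattice_def by blast
      then have "u + of_int (- m) + of_int (- n) * \<tau> = w" by (simp add: algebra_simps)
      then show ?thesis using limw by metis
    next
      case 3
      then show ?thesis using cont[of u] by (intro exI[of _ 0] exI[of _ "Q u"]) simp
    qed
  qed
  have iso: "isolated_singularity_at Q u" for u
    unfolding Q_def[abs_def] by (rule isolated_singularity_quotient[OF hN hD])
  obtain c where "\<And>u. Q \<midarrow>u\<rightarrow> c" "c = 0"
    using quasi_elliptic_constant[where f = Q, OF \<tau> iso lim per1 per2 mult(4,5)] mult(3) by metis
  then have "Q z = 0" using cont[OF z zw] LIM_unique by blast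
  moreover have nz': "theta \<tau> z \<noteq> 0" "theta \<tau> (z - w) \<noteq> 0"
    using z zw theta_eq_0_iff[OF \<tau>] by auto
  ultimately have "N z = 0" by (simp add: Q_def D_def)
  then show ?thesis
    using nz' unfolding N_def by (simp add: varphi_eq[of _ _ z] varphi_eq[of _ _ "z - w"] field_simps)
qed

subsection \<open>The Weierstrass function\<close>

definition lattice_pt :: "complex \<Rightarrow> int \<times> int \<Rightarrow> complex" where
  "lattice_pt \<tau> p = of_int (fst p) + of_int (snd p) * \<tau>"

lemma lattice_eq_range: "lattice \<tau> = range (lattice_pt \<tau>)"
  by (simp add: set_eq_iff lattice_def lattice_pt_def image_iff split_paired_Ex)

lemma lattice_diff:
  assumes "a \<in> lattice \<tau>" "b \<in> lattice \<tau>"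
  shows "a - b \<in> lattice \<tau>"
proof -
  obtain m n k l :: int where "a = of_int m + of_int n * \<tau>" "b = of_int k + of_int l * \<tau>"
    using assms unfolding lattice_def by blast
  then have "a - b = of_int (m - k) + of_int (n - l) * \<tau>" by (simp add: algebra_simps)
  then show ?thesis unfolding lattice_def by blast
qed

section \<open>Geometry of the lattice\<close>

lemma lattice_norm_bound:
  assumes "Im \<tau> > 0"
  obtains c where "c > 0" "\<And>m n. c * (\<bar>of_int m\<bar> + \<bar>of_int n\<bar>) \<le> norm (lattice_pt \<tau> (m, n))"
proof -
  \<comment> \<open>For a lattice point x = m + n \<tau>, the imaginary part bounds |n| by |x| / Im
    \<tau>, and then m = x - n \<tau> bounds |m| by |x| (1 + |\<tau>| / Im \<tau>); \<open>K\<close>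
    collects both.\<close>
  define K where "K = 1 + (norm \<tau> + 1) / Im \<tau>"
  have K: "K > 0" using assms by (simp add: K_def add_pos_nonneg)
  have "(\<bar>of_int m\<bar> + \<bar>of_int n\<bar>) \<le> K * norm (lattice_pt \<tau> (m, n))" for m n
  proof -
    define x where "x = lattice_pt \<tau> (m, n)"
    have "\<bar>of_int n\<bar> * Im \<tau> = \<bar>Im x\<bar>" using assms by (simp add: x_def lattice_pt_def abs_mult)
    also have "\<dots> \<le> norm x" by (rule abs_Im_le_cmod)
    finally have n: "\<bar>of_int n\<bar> \<le> norm x / Im \<tau>" using assms by (simp add: field_simps)
    have "complex_of_int m = x - of_int n * \<tau>" by (simp add: x_def lattice_pt_def)
    then have "norm (complex_of_int m) \<le> norm x + norm (of_int n * \<tau>)"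
      by (simp only: norm_triangle_ineq4)
    then have "\<bar>of_int m\<bar> \<le> norm x + \<bar>of_int n\<bar> * norm \<tau>" by (simp add: norm_mult)
    also have "\<dots> \<le> norm x + norm x / Im \<tau> * norm \<tau>"
      using n by (intro add_left_mono mult_right_mono) auto
    finally show ?thesis using n assms unfolding x_def[symmetric] K_def by (simp add: field_simps)
  qed
  then have "(1 / K) * (\<bar>of_int m\<bar> + \<bar>of_int n\<bar>) \<le> norm (lattice_pt \<tau> (m, n))" for m n
    using K by (simp add: field_simps)
  then show ?thesis using that[of "1 / K"] K by simp
qed

lemma lattice_separated:
  assumes "Im \<tau> > 0"
  obtains c where "c > 0" "\<And>p. p \<noteq> (0, 0) \<Longrightarrow> c \<le> norm (lattice_pt \<tau> p)"
proof -
  obtain c where c: "c > 0" "\<And>m n. c * (\<bar>of_int m\<bar> + \<bar>of_int n\<bar>) \<le> norm (lattice_pt \<tau> (m, n))"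
    using lattice_norm_bound[OF assms] by metis
  have "c \<le> norm (lattice_pt \<tau> p)" if "p \<noteq> (0, 0)" for p
  proof -
    obtain m n where mn: "p = (m, n)" by (cases p)
    have "1 \<le> \<bar>m\<bar> + \<bar>n\<bar>" using that mn by auto
    then have "1 \<le> \<bar>real_of_int m\<bar> + \<bar>real_of_int n\<bar>" by linarith
    then have "c * 1 \<le> c * (\<bar>real_of_int m\<bar> + \<bar>real_of_int n\<bar>)"
      using c(1) by (intro mult_left_mono) auto
    then show ?thesis using c(2)[of m n] mn by simp
  qed
  with c(1) that show ?thesis by blast
qed

text \<open>One radius serves all lattice points, because the lattice is closed under differences
  and its nonzero points stay away from 0.\<close>

lemma lattice_isolated:
  assumes "Im \<tau> > 0"
  obtains r where "r > 0" "\<And>z. z \<in> lattice \<tau> \<Longrightarrow> ball z r - {z} \<subseteq> - lattice \<tau>"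
proof -
  obtain c where c: "c > 0" "\<And>p. p \<noteq> (0, 0) \<Longrightarrow> c \<le> norm (lattice_pt \<tau> p)"
    using lattice_separated[OF assms] by metis
  have "u \<notin> lattice \<tau>" if "z \<in> lattice \<tau>" "u \<in> ball z c - {z}" for z u
  proof
    assume "u \<in> lattice \<tau>"
    then have "u - z \<in> range (lattice_pt \<tau>)"
      using lattice_diff that(1) unfolding lattice_eq_range[symmetric] by blast
    then obtain p where p: "u - z = lattice_pt \<tau> p" by blast
    then have "p \<noteq> (0, 0)" using that by (auto simp: lattice_pt_def)
    then show False using c(2)[of p] that p by (simp add: dist_norm norm_minus_commute)
  qed
  then show ?thesis using that[of c] c(1) by blast
qed

lemma open_lattice_complement:
  assumes "Im \<tau> > 0"
  shows "open (- lattice \<tau>)"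
proof -
  have "- lattice \<tau> = theta \<tau> -` (- {0})" using theta_eq_0_iff[OF assms] by auto
  also have "open \<dots>"
    using holomorphic_on_imp_continuous_on[OF holomorphic_theta[OF assms, of UNIV]]
    by (intro open_vimage) auto
  finally show ?thesis .
qed

text \<open>Since \<open>1 / 0 = 0\<close>, the term for \<open>p = (0, 0)\<close> is \<open>1 / z\<^sup>2\<close>.\<close>

definition wp_term :: "complex \<Rightarrow> complex \<Rightarrow> int \<times> int \<Rightarrow> complex" where
  "wp_term \<tau> z p = 1 / (z - lattice_pt \<tau> p)^2 - 1 / (lattice_pt \<tau> p)^2"

text \<open>A substitute for the inverse cube of the norm of a lattice point, in product form: the
  double series then splits into two convergent series of exponent 3/2.\<close>

definition cubic_majorant :: "int \<times> int \<Rightarrow> real" where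
  "cubic_majorant p = (1 + real (nat \<bar>fst p\<bar>)) powr (-3/2) * (1 + real (nat \<bar>snd p\<bar>)) powr (-3/2)"

lemma summable_cubic_majorant: "cubic_majorant summable_on UNIV"
proof -
  define a where "a j = (1 + real (nat \<bar>j\<bar>)) powr (-3/2)" for j :: int
  have "summable (\<lambda>n. real n powr (-3/2))" by (simp add: summable_real_powr_iff)
  then have "summable (\<lambda>n. real (Suc n) powr (-3/2))" by (subst summable_Suc_iff)
  then have "summable (\<lambda>n. (1 + real n) powr (-3/2))" by simp
  then have a: "a summable_on UNIV"
    unfolding a_def by (rule summable_on_int_abs) auto
  have "(\<lambda>(m, n). a m * a n) summable_on UNIV \<times> UNIV"
  proof (rule summable_on_SigmaI)
    show "((\<lambda>n. case (m, n) of (m, n) \<Rightarrow> a m * a n) has_sum a m * infsum a UNIV) UNIV" for m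
      unfolding prod.case by (intro has_sum_cmult_right has_sum_infsum a)
    show "(\<lambda>m. a m * infsum a UNIV) summable_on UNIV"
      by (intro summable_on_cmult_left a)
  qed (auto simp: a_def)
  then show ?thesis by (simp add: cubic_majorant_def[abs_def] a_def case_prod_unfold)
qed

lemma wp_term_bound:
  assumes "Im \<tau> > 0" "R > 0"
  obtains K where "\<And>z p. norm z \<le> R \<Longrightarrow> 2 * R \<le> norm (lattice_pt \<tau> p) \<Longrightarrow>
    norm (wp_term \<tau> z p) \<le> K * cubic_majorant p"
proof -
  obtain c where c: "c > 0" "\<And>m n. c * (\<bar>of_int m\<bar> + \<bar>of_int n\<bar>) \<le> norm (lattice_pt \<tau> (m, n))"
    using lattice_norm_bound[OF assms(1)] by metis
  have "norm (wp_term \<tau> z p) \<le> 10 * R * (2 / c) ^ 3 * cubic_majorant p"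
    if z: "norm z \<le> R" and p: "2 * R \<le> norm (lattice_pt \<tau> p)" for z p
  proof -
    define x where "x = lattice_pt \<tau> p"
    have x: "2 * R \<le> norm x" "norm x > 0" using p assms(2) by (auto simp: x_def)
    have xz: "norm x / 2 \<le> norm (z - x)"
      using norm_triangle_ineq2[of x z] x z by (simp add: norm_minus_commute)
    then have zx0: "z - x \<noteq> 0" "x \<noteq> 0" using x by auto
    have "wp_term \<tau> z p = (x^2 - (z - x)^2) / ((z - x)^2 * x^2)"
      using zx0 unfolding wp_term_def x_def[symmetric] by (simp add: diff_divide_distrib)
    also have "x^2 - (z - x)^2 = z * (2 * x - z)" by (simp add: power2_eq_square algebra_simps)
    finally have "norm (wp_term \<tau> z p) = norm z * norm (2 * x - z) / (norm (z - x) ^ 2 * norm x ^ 2)"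
      by (simp add: norm_mult norm_divide norm_power)
    \<comment> \<open>Here norm z is at most half of norm x, which bounds norm (2 x - z) from above
      by 5/2 norm x and norm (z - x) from below by half of norm x. The constant 10 below is 5/2
      times 4.\<close>
    also have "\<dots> \<le> R * (5 / 2 * norm x) / ((norm x / 2) ^ 2 * norm x ^ 2)"
    proof (rule frac_le)
      have "norm (2 * x - z) \<le> norm (2 * x) + norm z" by (rule norm_triangle_ineq4)
      then have "norm (2 * x - z) \<le> 5 / 2 * norm x" using z x by (simp add: norm_mult)
      then show "norm z * norm (2 * x - z) \<le> R * (5 / 2 * norm x)"
        using z assms(2) by (intro mult_mono) auto
      show "(norm x / 2) ^ 2 * norm x ^ 2 \<le> norm (z - x) ^ 2 * norm x ^ 2"
        using xz x by (intro mult_right_mono power_mono) auto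
    qed (use assms(2) x in auto)
    also have "\<dots> = 10 * R * (1 / norm x) ^ 3"
      using x(2) by (simp add: field_simps power2_eq_square power3_eq_cube)
    also have "\<dots> \<le> 10 * R * ((2 / c) ^ 3 * cubic_majorant p)"
    proof -
      obtain m n where mn: "p = (m, n)" by (cases p)
      define u v where "u = 1 + real (nat \<bar>m\<bar>)" and "v = 1 + real (nat \<bar>n\<bar>)"
      have uv: "u \<ge> 1" "v \<ge> 1" by (auto simp: u_def v_def)
      have "p \<noteq> (0, 0)" using x(2) by (auto simp: x_def lattice_pt_def)
      then have "1 \<le> \<bar>m\<bar> + \<bar>n\<bar>" using mn by auto
      then have "1 \<le> \<bar>real_of_int m\<bar> + \<bar>real_of_int n\<bar>" by linarith
      \<comment> \<open>The left side is 1 + |m| + |n|, and the 1 is absorbed because (m, n) is not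
        (0, 0); this doubling is the 2 in 2 / c.\<close>
      then have "u + v - 1 \<le> 2 * (\<bar>real_of_int m\<bar> + \<bar>real_of_int n\<bar>)"
        by (simp add: u_def v_def)
      moreover have "(u * v) powr (1/2) \<le> u + v - 1"
      proof -
        \<comment> \<open>This sum of nonnegative terms equals (u + v - 1)^2 - u v.\<close>
        have "0 \<le> (u - 1) * (v - 1) + (u - 1)^2 + (v - 1)^2 + (u - 1) + (v - 1)" using uv by (intro add_nonneg_nonneg) auto
        then have "u * v \<le> (u + v - 1)^2" by (simp add: power2_eq_square algebra_simps)
        then show ?thesis using uv by (simp add: powr_half_sqrt real_le_lsqrt)
      qed
      ultimately have "c / 2 * (u * v) powr (1/2) \<le> c / 2 * (2 * (\<bar>real_of_int m\<bar> + \<bar>real_of_int n\<bar>))"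
        using c(1) by (intro mult_left_mono) auto
      also have "\<dots> = c * (\<bar>real_of_int m\<bar> + \<bar>real_of_int n\<bar>)" by simp
      also have "\<dots> \<le> norm x" using c(2)[of m n] by (simp only: x_def mn)
      finally have "1 / norm x \<le> 1 / (c / 2 * (u * v) powr (1/2))"
        using uv c(1) by (intro divide_left_mono mult_pos_pos x(2)) auto
      then have "(1 / norm x) ^ 3 \<le> (1 / (c / 2 * (u * v) powr (1/2))) ^ 3"
        using x(2) by (intro power_mono) auto
      also have "\<dots> = (2 / c) ^ 3 * (1 / ((u * v) powr (1/2)) ^ 3)"
        by (simp add: power_divide power_mult_distrib)
      also have "((u * v) powr (1/2)) ^ 3 = (u * v) powr (3/2)"
        using uv by (simp add: powr_powr flip: powr_realpow)
      also have "1 / (u * v) powr (3/2) = cubic_majorant p"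
        using uv by (simp add: cubic_majorant_def mn u_def v_def powr_minus_divide powr_mult)
      finally show ?thesis using assms(2) by (intro mult_left_mono) auto
    qed
    finally show ?thesis by (simp add: mult_ac)
  qed
  then show ?thesis using that by blast
qed

lemma finite_lattice_ball:
  assumes "Im \<tau> > 0"
  shows "finite {p. norm (lattice_pt \<tau> p) < r}"
proof -
  obtain c where c: "c > 0" "\<And>m n. c * (\<bar>of_int m\<bar> + \<bar>of_int n\<bar>) \<le> norm (lattice_pt \<tau> (m, n))"
    using lattice_norm_bound[OF assms] by metis
  define B where "B = \<lceil>r / c\<rceil>"
  have "{p. norm (lattice_pt \<tau> p) < r} \<subseteq> {-B..B} \<times> {-B..B}"
  proof
    fix p assume p: "p \<in> {p. norm (lattice_pt \<tau> p) < r}"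
    obtain m n where mn: "p = (m, n)" by (cases p)
    have "c * (\<bar>real_of_int m\<bar> + \<bar>real_of_int n\<bar>) < r" using p c(2)[of m n] mn by simp
    then have "\<bar>real_of_int m\<bar> + \<bar>real_of_int n\<bar> < r / c" using c(1) by (simp add: field_simps)
    also have "\<dots> \<le> of_int B" unfolding B_def by (rule le_of_int_ceiling)
    finally show "p \<in> {-B..B} \<times> {-B..B}" unfolding mn by auto
  qed
  then show ?thesis by (rule finite_subset) auto
qed

text \<open>On the disc of radius R the lattice points of norm at least 2 R cause no poles and admit
  one majorant for all z. The rest of the Weierstrass series is a finite sum.\<close>

definition wp_tail :: "complex \<Rightarrow> real \<Rightarrow> complex \<Rightarrow> complex" where
  "wp_tail \<tau> R z = (\<Sum>\<^sub>\<infinity>p\<in>{p. 2 * R \<le> norm (lattice_pt \<tau> p)}. wp_term \<tau> z p)"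

lemma summable_wp_tail:
  assumes "Im \<tau> > 0" "R > 0" "norm z \<le> R"
  shows "wp_term \<tau> z summable_on {p. 2 * R \<le> norm (lattice_pt \<tau> p)}"
proof -
  obtain K where K: "\<And>z p. norm z \<le> R \<Longrightarrow> 2 * R \<le> norm (lattice_pt \<tau> p) \<Longrightarrow>
      norm (wp_term \<tau> z p) \<le> K * cubic_majorant p"
    using wp_term_bound[OF assms(1,2)] by metis
  have "(\<lambda>p. K * cubic_majorant p) summable_on {p. 2 * R \<le> norm (lattice_pt \<tau> p)}"
    by (intro summable_on_cmult_right summable_on_subset_banach[OF summable_cubic_majorant]) auto
  then have "(\<lambda>p. norm (wp_term \<tau> z p)) summable_on {p. 2 * R \<le> norm (lattice_pt \<tau> p)}"
    by (rule summable_on_comparison_test) (use K assms in auto)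
  then show ?thesis by (rule abs_summable_summable)
qed

lemma holomorphic_wp_tail:
  assumes "Im \<tau> > 0" "R > 0"
  shows "wp_tail \<tau> R holomorphic_on ball 0 R"
proof -
  obtain K where K: "\<And>z p. norm z \<le> R \<Longrightarrow> 2 * R \<le> norm (lattice_pt \<tau> p) \<Longrightarrow>
      norm (wp_term \<tau> z p) \<le> K * cubic_majorant p"
    using wp_term_bound[OF assms] by metis
  have M: "(\<lambda>p. K * cubic_majorant p) summable_on {p. 2 * R \<le> norm (lattice_pt \<tau> p)}"
    by (intro summable_on_cmult_right summable_on_subset_banach[OF summable_cubic_majorant]) auto
  show ?thesis
    unfolding wp_tail_def[abs_def]
  proof (rule holomorphic_infsum)
    fix p assume p: "p \<in> {p. 2 * R \<le> norm (lattice_pt \<tau> p)}"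
    have "z - lattice_pt \<tau> p \<noteq> 0" if "z \<in> ball 0 R" for z
      using that p assms(2) by auto
    then show "(\<lambda>z. wp_term \<tau> z p) holomorphic_on ball 0 R"
      unfolding wp_term_def by (intro holomorphic_intros) auto
  next
    fix z :: complex assume z: "z \<in> ball 0 R"
    then obtain r where r: "r > 0" "cball z r \<subseteq> ball 0 R"
      by (metis open_ball open_contains_cball)
    then have "\<forall>w\<in>cball z r. norm w \<le> R" by auto
    with r K M show "\<exists>r M. r > 0 \<and> cball z r \<subseteq> ball 0 R \<and>
        M summable_on {p. 2 * R \<le> norm (lattice_pt \<tau> p)} \<and>
        (\<forall>p\<in>{p. 2 * R \<le> norm (lattice_pt \<tau> p)}. \<forall>w\<in>cball z r. norm (wp_term \<tau> w p) \<le> M p)"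
      by (intro exI[of _ r] exI[of _ "\<lambda>p. K * cubic_majorant p"]) auto
  qed auto
qed

lemma summable_wp_term:
  assumes "Im \<tau> > 0"
  shows "wp_term \<tau> z summable_on UNIV"
proof -
  define R where "R = norm z + 1"
  have "R > 0" by (simp add: R_def add_nonneg_pos)
  then have "wp_term \<tau> z summable_on {p. 2 * R \<le> norm (lattice_pt \<tau> p)}"
    using assms by (intro summable_wp_tail) (auto simp: R_def)
  moreover have "wp_term \<tau> z summable_on {p. norm (lattice_pt \<tau> p) < 2 * R}"
    by (intro summable_on_finite finite_lattice_ball assms)
  ultimately have "wp_term \<tau> z summable_on {p. 2 * R \<le> norm (lattice_pt \<tau> p)} \<union> {p. norm (lattice_pt \<tau> p) < 2 * R}"
    by (rule summable_on_union)
  also have "{p. 2 * R \<le> norm (lattice_pt \<tau> p)} \<union> {p. norm (lattice_pt \<tau> p) < 2 * R} = UNIV" by auto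
  finally show ?thesis .
qed

lemma weierstrass_p_eq:
  assumes "Im \<tau> > 0"
  shows "weierstrass_p \<tau> z = (\<Sum>\<^sub>\<infinity>p. wp_term \<tau> z p)"
proof -
  have "(\<Sum>\<^sub>\<infinity>p. wp_term \<tau> z p) = (\<Sum>\<^sub>\<infinity>p\<in>{(0, 0)} \<union> - {(0, 0)}. wp_term \<tau> z p)"
    by (simp add: Un_commute)
  also have "\<dots> = (\<Sum>\<^sub>\<infinity>p\<in>{(0, 0)}. wp_term \<tau> z p) + (\<Sum>\<^sub>\<infinity>p\<in>- {(0, 0)}. wp_term \<tau> z p)"
    by (intro infsum_Un_disjoint summable_on_subset_banach[OF summable_wp_term[OF assms]]) auto
  also have "(\<Sum>\<^sub>\<infinity>p\<in>{(0, 0)}. wp_term \<tau> z p) = 1 / z^2"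
    by (simp add: wp_term_def lattice_pt_def)
  finally show ?thesis
    by (simp add: weierstrass_p_def wp_term_def lattice_pt_def case_prod_unfold)
qed

lemma weierstrass_p_split:
  assumes "Im \<tau> > 0" "R > 0" "norm z \<le> R"
  shows "weierstrass_p \<tau> z = (\<Sum>p\<in>{p. norm (lattice_pt \<tau> p) < 2 * R}. wp_term \<tau> z p) + wp_tail \<tau> R z"
proof -
  have "UNIV = {p. norm (lattice_pt \<tau> p) < 2 * R} \<union> {p. 2 * R \<le> norm (lattice_pt \<tau> p)}" by auto
  then have "weierstrass_p \<tau> z =
      infsum (wp_term \<tau> z) ({p. norm (lattice_pt \<tau> p) < 2 * R} \<union> {p. 2 * R \<le> norm (lattice_pt \<tau> p)})"
    unfolding weierstrass_p_eq[OF assms(1)] by (rule arg_cong)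
  also have "\<dots> = infsum (wp_term \<tau> z) {p. norm (lattice_pt \<tau> p) < 2 * R} + wp_tail \<tau> R z"
    unfolding wp_tail_def
    by (intro infsum_Un_disjoint summable_wp_tail summable_on_finite finite_lattice_ball assms) auto
  also have "infsum (wp_term \<tau> z) {p. norm (lattice_pt \<tau> p) < 2 * R} =
      (\<Sum>p\<in>{p. norm (lattice_pt \<tau> p) < 2 * R}. wp_term \<tau> z p)"
    by (intro infsum_finite finite_lattice_ball assms)
  finally show ?thesis .
qed

lemma holomorphic_weierstrass_p:
  assumes "Im \<tau> > 0"
  shows "weierstrass_p \<tau> holomorphic_on - lattice \<tau>"
proof -
  have "weierstrass_p \<tau> field_differentiable at z" if z: "z \<notin> lattice \<tau>" for z
  proof -
    define R where "R = norm z + 1"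
    have R: "R > 0" by (simp add: R_def add_nonneg_pos)
    define S where "S = ball 0 R \<inter> - lattice \<tau>"
    have "open S" unfolding S_def by (intro open_Int open_ball open_lattice_complement assms)
    have "(\<lambda>z. wp_term \<tau> z p) holomorphic_on S" for p
    proof -
      have "z - lattice_pt \<tau> p \<noteq> 0" if "z \<in> S" for z
        using that by (auto simp: S_def lattice_eq_range)
      then show ?thesis unfolding wp_term_def by (intro holomorphic_intros) auto
    qed
    then have "(\<lambda>z. (\<Sum>p\<in>{p. norm (lattice_pt \<tau> p) < 2 * R}. wp_term \<tau> z p) + wp_tail \<tau> R z) holomorphic_on S"
      by (intro holomorphic_intros holomorphic_on_subset[OF holomorphic_wp_tail[OF assms R]]) (auto simp: S_def)
    then have "weierstrass_p \<tau> holomorphic_on S"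
      by (rule holomorphic_transform) (use weierstrass_p_split[OF assms R] in \<open>auto simp: S_def\<close>)
    moreover have "z \<in> S" using z by (simp add: S_def R_def)
    ultimately show ?thesis using \<open>open S\<close> holomorphic_on_imp_differentiable_at by blast
  qed
  then show ?thesis by (auto simp: holomorphic_on_def field_differentiable_at_within)
qed

lemma weierstrass_p_near_0:
  assumes "Im \<tau> > 0"
  obtains R h where "R > 0" "h holomorphic_on ball 0 R"
    "\<And>z. z \<in> ball 0 R \<Longrightarrow> weierstrass_p \<tau> z = 1 / z^2 + h z"
proof -
  obtain c where c: "c > 0" "\<And>p. p \<noteq> (0, 0) \<Longrightarrow> c \<le> norm (lattice_pt \<tau> p)"
    using lattice_separated[OF assms] by metis
  \<comment> \<open>With this radius, 0 is the only lattice point of norm below 2 R, so the finite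
    part consists of 1 / z^2 alone.\<close>
  define R where "R = c / 2"
  have R: "R > 0" using c by (simp add: R_def)
  have "{p. norm (lattice_pt \<tau> p) < 2 * R} = {(0, 0)}"
    using c by (auto simp: R_def lattice_pt_def not_le[symmetric])
  then have "weierstrass_p \<tau> z = 1 / z^2 + wp_tail \<tau> R z" if "z \<in> ball 0 R" for z
    using weierstrass_p_split[OF assms R, of z] that by (simp add: wp_term_def lattice_pt_def)
  then show ?thesis using that R holomorphic_wp_tail[OF assms R] by blast
qed

lemma weierstrass_p_minus:
  assumes "Im \<tau> > 0"
  shows "weierstrass_p \<tau> (- z) = weierstrass_p \<tau> z"
proof -
  have "bij_betw (\<lambda>p. (- fst p, - snd p) :: int \<times> int) UNIV UNIV"
    by (rule bij_betwI[where g = "\<lambda>p. (- fst p, - snd p)"]) auto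
  then have "weierstrass_p \<tau> (- z) = (\<Sum>\<^sub>\<infinity>p. wp_term \<tau> (- z) (- fst p, - snd p))"
    unfolding weierstrass_p_eq[OF assms] by (rule infsum_reindex_bij_betw[symmetric])
  also have "\<dots> = (\<Sum>\<^sub>\<infinity>p. wp_term \<tau> z p)"
  proof (rule infsum_cong)
    fix p
    have "lattice_pt \<tau> (- fst p, - snd p) = - lattice_pt \<tau> p" by (simp add: lattice_pt_def)
    then show "wp_term \<tau> (- z) (- fst p, - snd p) = wp_term \<tau> z p"
      by (simp add: wp_term_def power2_eq_square algebra_simps)
  qed
  finally show ?thesis unfolding weierstrass_p_eq[OF assms] .
qed

text \<open>\<open>\<wp> (z + \<omega>) - \<wp> z\<close> does not depend on \<open>z\<close>, and it vanishes at \<open>z = - \<omega> / 2\<close> by parity.\<close>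

lemma weierstrass_p_periodic:
  assumes "Im \<tau> > 0"
  shows "weierstrass_p \<tau> (z + lattice_pt \<tau> q) = weierstrass_p \<tau> z"
proof -
  define k where "k = lattice_pt \<tau> q"
  define s where "s p = (fst p + fst q, snd p + snd q)" for p
  define C where "C = (\<Sum>\<^sub>\<infinity>p. 1 / (lattice_pt \<tau> p)^2 - 1 / (lattice_pt \<tau> p + k)^2)"
  have s: "lattice_pt \<tau> (s p) = lattice_pt \<tau> p + k" for p
    by (simp add: s_def k_def lattice_pt_def algebra_simps)
  have bij: "bij_betw s UNIV UNIV"
    unfolding s_def by (rule bij_betwI[where g = "\<lambda>p. (fst p - fst q, snd p - snd q)"]) auto
  have diff: "weierstrass_p \<tau> (z + k) - weierstrass_p \<tau> z = C" for z
  proof -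
    have "wp_term \<tau> (z + k) summable_on UNIV" by (rule summable_wp_term[OF assms])
    then have "(\<lambda>p. wp_term \<tau> (z + k) (s p)) summable_on UNIV"
      by (subst summable_on_reindex_bij_betw[OF bij])
    then have "(\<Sum>\<^sub>\<infinity>p. wp_term \<tau> (z + k) (s p) + - wp_term \<tau> z p) =
        (\<Sum>\<^sub>\<infinity>p. wp_term \<tau> (z + k) (s p)) + (\<Sum>\<^sub>\<infinity>p. - wp_term \<tau> z p)"
      using summable_on_uminus[of "wp_term \<tau> z" UNIV] summable_wp_term[OF assms, of z]
      by (intro infsum_add) auto
    also have "(\<Sum>\<^sub>\<infinity>p. - wp_term \<tau> z p) = - (\<Sum>\<^sub>\<infinity>p. wp_term \<tau> z p)"
      by (rule infsum_uminus)
    also have "(\<Sum>\<^sub>\<infinity>p. wp_term \<tau> (z + k) (s p)) = (\<Sum>\<^sub>\<infinity>p. wp_term \<tau> (z + k) p)"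
      by (rule infsum_reindex_bij_betw[OF bij])
    \<comment> \<open>After the reindexing the parts that depend on z cancel, and only the
      convergence corrections survive.\<close>
    also have "(\<lambda>p. wp_term \<tau> (z + k) (s p) + - wp_term \<tau> z p) =
        (\<lambda>p. 1 / (lattice_pt \<tau> p)^2 - 1 / (lattice_pt \<tau> p + k)^2)"
      by (simp add: fun_eq_iff wp_term_def s)
    finally show ?thesis by (simp add: C_def weierstrass_p_eq[OF assms])
  qed
  \<comment> \<open>Legitimate even if k / 2 is a lattice point: parity and the formula for the
    difference hold everywhere under the convention 1 / 0 = 0.\<close>
  have "weierstrass_p \<tau> (k / 2) = weierstrass_p \<tau> (- (k / 2))"
    by (rule weierstrass_p_minus[OF assms, symmetric])
  then have "C = 0" using diff[of "- (k / 2)"] by simp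
  then show ?thesis using diff[of z] by (simp add: k_def)
qed


subsection \<open>Comparison of \<open>E\<^sub>2\<close> and \<open>\<wp>\<close>\<close>

definition theta_logderiv :: "complex \<Rightarrow> complex \<Rightarrow> complex" where
  "theta_logderiv \<tau> u = deriv (theta \<tau>) u / theta \<tau> u"

lemma E2_eq: "E2 \<tau> z = - deriv (theta_logderiv \<tau>) z"
  by (simp add: E2_def theta_logderiv_def[abs_def])

lemma holomorphic_theta_logderiv:
  assumes "Im \<tau> > 0"
  shows "theta_logderiv \<tau> holomorphic_on - lattice \<tau>"
  unfolding theta_logderiv_def[abs_def]
  by (intro holomorphic_on_divide holomorphic_deriv holomorphic_theta assms open_lattice_complement)
     (use theta_eq_0_iff[OF assms] in auto)

lemma holomorphic_E2:
  assumes "Im \<tau> > 0"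
  shows "E2 \<tau> holomorphic_on - lattice \<tau>"
  unfolding E2_eq[abs_def]
  by (intro holomorphic_intros holomorphic_deriv holomorphic_theta_logderiv open_lattice_complement assms)

lemma deriv_theta_plus_1:
  assumes "Im \<tau> > 0"
  shows "deriv (theta \<tau>) (u + 1) = - deriv (theta \<tau>) u"
proof -
  have "((\<lambda>u. theta \<tau> (u + 1)) has_field_derivative deriv (theta \<tau>) (u + 1)) (at u)"
    using theta_has_derivative[OF assms] by (simp only: DERIV_shift[symmetric])
  then have "((\<lambda>u. - theta \<tau> u) has_field_derivative deriv (theta \<tau>) (u + 1)) (at u)"
    by (simp only: theta_plus_1)
  moreover have "((\<lambda>u. - theta \<tau> u) has_field_derivative - deriv (theta \<tau>) u) (at u)"
    by (intro DERIV_minus theta_has_derivative assms)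
  ultimately show ?thesis by (rule DERIV_unique)
qed

lemma deriv_theta_plus_tau:
  assumes "Im \<tau> > 0"
  shows "deriv (theta \<tau>) (u + \<tau>) = - exp (- of_real pi * \<i> * \<tau> - 2 * of_real pi * \<i> * u) *
    (deriv (theta \<tau>) u - 2 * of_real pi * \<i> * theta \<tau> u)"
proof -
  have "((\<lambda>u. theta \<tau> (u + \<tau>)) has_field_derivative deriv (theta \<tau>) (u + \<tau>)) (at u)"
    using theta_has_derivative[OF assms] by (simp only: DERIV_shift[symmetric])
  then have "((\<lambda>u. - exp (- of_real pi * \<i> * \<tau> - 2 * of_real pi * \<i> * u) * theta \<tau> u)
      has_field_derivative deriv (theta \<tau>) (u + \<tau>)) (at u)"
    by (simp only: theta_plus_tau)
  moreover have "((\<lambda>u. - exp (- of_real pi * \<i> * \<tau> - 2 * of_real pi * \<i> * u) * theta \<tau> u)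
      has_field_derivative - exp (- of_real pi * \<i> * \<tau> - 2 * of_real pi * \<i> * u) *
    (deriv (theta \<tau>) u - 2 * of_real pi * \<i> * theta \<tau> u)) (at u)"
    by (auto intro!: derivative_eq_intros theta_has_derivative assms simp: algebra_simps)
  ultimately show ?thesis by (rule DERIV_unique)
qed

text \<open>Differentiation kills an additive period of the logarithmic derivative. That period is 0
  for k = 1 and -2 \<pi> i for k = \<tau>, which is why \<open>E2\<close> is periodic although
  theta'/theta is not.\<close>

lemma E2_shift:
  assumes \<tau>: "Im \<tau> > 0" and z: "z \<notin> lattice \<tau>" "z + k \<notin> lattice \<tau>"
    and eq: "\<And>u. u \<notin> lattice \<tau> \<Longrightarrow> theta_logderiv \<tau> (u + k) = theta_logderiv \<tau> u + c"
  shows "E2 \<tau> (z + k) = E2 \<tau> z"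
proof -
  have "(theta_logderiv \<tau> has_field_derivative deriv (theta_logderiv \<tau>) (z + k)) (at (z + k))"
    using holomorphic_derivI[OF holomorphic_theta_logderiv[OF \<tau>] open_lattice_complement[OF \<tau>]] z by auto
  then have "((\<lambda>u. theta_logderiv \<tau> (u + k) - c) has_field_derivative deriv (theta_logderiv \<tau>) (z + k) - 0) (at z)"
    by (intro DERIV_diff DERIV_const) (simp add: DERIV_shift)
  then have "(theta_logderiv \<tau> has_field_derivative deriv (theta_logderiv \<tau>) (z + k) - 0) (at z)"
    by (rule has_field_derivative_transform_within_open[OF _ open_lattice_complement[OF \<tau>]])
       (use z eq in auto)
  then show ?thesis unfolding E2_eq by (simp add: DERIV_imp_deriv)
qed

lemma lattice_plus_iff:
  assumes "k \<in> lattice \<tau>"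
  shows "z + k \<in> lattice \<tau> \<longleftrightarrow> z \<in> lattice \<tau>"
  using lattice_diff[of "z + k" \<tau> k] lattice_diff[of z \<tau> "0 - k"] lattice_diff[OF lattice_0 assms] assms
  by auto

lemma E2_periodic:
  assumes \<tau>: "Im \<tau> > 0" and z: "z \<notin> lattice \<tau>"
  shows "E2 \<tau> (z + 1) = E2 \<tau> z" "E2 \<tau> (z + \<tau>) = E2 \<tau> z"
proof -
  have k: "1 \<in> lattice \<tau>" "\<tau> \<in> lattice \<tau>"
    using rangeI[of "lattice_pt \<tau>" "(1, 0)"] rangeI[of "lattice_pt \<tau>" "(0, 1)"]
    by (simp_all add: lattice_eq_range lattice_pt_def)
  have "theta_logderiv \<tau> (u + 1) = theta_logderiv \<tau> u + 0" for u
    by (simp add: theta_logderiv_def deriv_theta_plus_1[OF \<tau>] theta_plus_1)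
  then show "E2 \<tau> (z + 1) = E2 \<tau> z"
    by (intro E2_shift[OF \<tau> z]) (use k z in \<open>simp_all add: lattice_plus_iff\<close>)
  have "theta_logderiv \<tau> (u + \<tau>) = theta_logderiv \<tau> u + (- (2 * of_real pi * \<i>))" if "u \<notin> lattice \<tau>" for u
    using that theta_eq_0_iff[OF \<tau>, of u]
    by (simp add: theta_logderiv_def deriv_theta_plus_tau[OF \<tau>] theta_plus_tau diff_divide_distrib)
  then show "E2 \<tau> (z + \<tau>) = E2 \<tau> z"
    by (intro E2_shift[OF \<tau> z]) (use k z in \<open>simp_all add: lattice_plus_iff\<close>)
qed

text \<open>Near 0, theta(z) = z \<eta>(z) with \<eta> holomorphic and nonvanishing, hence
  theta'/theta = 1/z + \<eta>'/\<eta>. Its negative derivative has polar part 1 / z^2 and no other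
  singular term.\<close>

lemma E2_near_0:
  assumes \<tau>: "Im \<tau> > 0"
  obtains R h where "R > 0" "h holomorphic_on ball 0 R"
    "\<And>z. z \<in> ball 0 R \<Longrightarrow> z \<noteq> 0 \<Longrightarrow> E2 \<tau> z = 1 / z^2 + h z"
proof -
  obtain R where R: "R > 0" "ball 0 R - {0} \<subseteq> - lattice \<tau>"
    using lattice_isolated[OF \<tau>] lattice_0 by metis
  define \<eta> where "\<eta> z = (if z = 0 then deriv (theta \<tau>) 0 else (theta \<tau> z - theta \<tau> 0) / (z - 0))" for z
  have "\<eta> holomorphic_on UNIV"
    unfolding \<eta>_def[abs_def] by (rule pole_lemma) (auto intro: holomorphic_theta \<tau>)
  then have hol: "\<eta> holomorphic_on ball 0 R" by (rule holomorphic_on_subset) auto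
  have nz: "\<eta> z \<noteq> 0" if "z \<in> ball 0 R" for z
  proof (cases "z = 0")
    case True
    then show ?thesis by (simp add: \<eta>_def deriv_theta_0_nonzero[OF \<tau>])
  next
    case False
    then have "z \<notin> lattice \<tau>" using that R(2) by blast
    then show ?thesis using False by (simp add: \<eta>_def theta_0 theta_eq_0_iff[OF \<tau>])
  qed
  define g where "g z = deriv \<eta> z / \<eta> z" for z
  have hg: "g holomorphic_on ball 0 R"
    unfolding g_def[abs_def] by (intro holomorphic_on_divide holomorphic_deriv hol nz) auto
  have "E2 \<tau> z = 1 / z^2 + - deriv g z" if z: "z \<in> ball 0 R" "z \<noteq> 0" for z
  proof -
    have "theta_logderiv \<tau> u = 1 / u + g u" if u: "u \<in> ball 0 R - {0}" for u
    proof -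
      have "((\<lambda>z. z * \<eta> z) has_field_derivative 1 * \<eta> u + deriv \<eta> u * u) (at u)"
        using holomorphic_derivI[OF hol _ , of u] u by (intro DERIV_mult) auto
      moreover have "(\<lambda>z. z * \<eta> z) = theta \<tau>" by (auto simp: \<eta>_def theta_0)
      ultimately have "deriv (theta \<tau>) u = \<eta> u + deriv \<eta> u * u" by (simp add: DERIV_imp_deriv)
      moreover have "theta \<tau> u = u * \<eta> u" by (auto simp: \<eta>_def theta_0)
      ultimately show ?thesis using u nz[of u] by (simp add: theta_logderiv_def g_def field_simps)
    qed
    moreover have "((\<lambda>u. 1 / u + g u) has_field_derivative - (1 / z^2) + deriv g z) (at z)"
      using holomorphic_derivI[OF hg _, of z] z
      by (auto intro!: derivative_eq_intros simp: power2_eq_square)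
    ultimately have "(theta_logderiv \<tau> has_field_derivative - (1 / z^2) + deriv g z) (at z)"
      using z by (elim has_field_derivative_transform_within_open[of _ _ _ "ball 0 R - {0}"]) auto
    then show ?thesis by (simp add: E2_eq DERIV_imp_deriv)
  qed
  moreover have "(\<lambda>z. - deriv g z) holomorphic_on ball 0 R"
    by (intro holomorphic_intros holomorphic_deriv hg) auto
  ultimately show ?thesis using that R(1) by blast
qed

lemma E2_weierstrass_p:
  assumes \<tau>: "Im \<tau> > 0"
  obtains c where "\<And>z. z \<notin> lattice \<tau> \<Longrightarrow> E2 \<tau> z = weierstrass_p \<tau> z + c"
proof -
  \<comment> \<open>Fixing the value 0 on the lattice makes the periodicity valid at every point,
    without appeal to the values of \<open>E2\<close> at its poles.\<close>
  define f where "f z = (if z \<in> lattice \<tau> then 0 else E2 \<tau> z - weierstrass_p \<tau> z)" for z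
  have "(\<lambda>z. E2 \<tau> z - weierstrass_p \<tau> z) holomorphic_on - lattice \<tau>"
    by (intro holomorphic_intros holomorphic_E2 holomorphic_weierstrass_p \<tau>)
  then have hol: "f holomorphic_on - lattice \<tau>"
    by (rule holomorphic_transform) (simp add: f_def)
  have k: "1 \<in> lattice \<tau>" "\<tau> \<in> lattice \<tau>"
    using rangeI[of "lattice_pt \<tau>" "(1, 0)"] rangeI[of "lattice_pt \<tau>" "(0, 1)"]
    by (simp_all add: lattice_eq_range lattice_pt_def)
  have wp: "weierstrass_p \<tau> (z + 1) = weierstrass_p \<tau> z" "weierstrass_p \<tau> (z + \<tau>) = weierstrass_p \<tau> z" for z
    using weierstrass_p_periodic[OF \<tau>, of z "(1, 0)"] weierstrass_p_periodic[OF \<tau>, of z "(0, 1)"]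
    by (simp_all add: lattice_pt_def)
  have per: "f (z + 1) = 1 * f z" "f (z + \<tau>) = 1 * f z" for z
    using k by (auto simp: f_def lattice_plus_iff wp E2_periodic[OF \<tau>])
  have iso: "isolated_singularity_at f z" for z
  proof -
    obtain r where r: "r > 0" "ball z r - {z} \<subseteq> - lattice \<tau>"
    proof (cases "z \<in> lattice \<tau>")
      case True
      then show ?thesis using lattice_isolated[OF \<tau>] that by metis
    next
      case False
      then obtain r where "r > 0" "ball z r \<subseteq> - lattice \<tau>"
        using open_lattice_complement[OF \<tau>] by (metis ComplI open_contains_ball)
      then show ?thesis using that[of r] by blast
    qed
    have "f analytic_on ball z r - {z}"
      by (subst analytic_on_open) (auto intro: holomorphic_on_subset[OF hol r(2)])
    then show ?thesis using r(1) unfolding isolated_singularity_at_def by blast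
  qed
  have cont: "f \<midarrow>z\<rightarrow> f z" if "z \<notin> lattice \<tau>" for z
    using holomorphic_on_imp_continuous_on[OF hol] open_lattice_complement[OF \<tau>] that
    by (simp add: continuous_on_eq_continuous_at isCont_def)
  obtain R h where R: "R > 0" "h holomorphic_on ball 0 R"
      "\<And>z. z \<in> ball 0 R \<Longrightarrow> weierstrass_p \<tau> z = 1 / z^2 + h z"
    using weierstrass_p_near_0[OF \<tau>] by metis
  obtain R' h' where R': "R' > 0" "h' holomorphic_on ball 0 R'"
      "\<And>z. z \<in> ball 0 R' \<Longrightarrow> z \<noteq> 0 \<Longrightarrow> E2 \<tau> z = 1 / z^2 + h' z"
    using E2_near_0[OF \<tau>] by metis
  \<comment> \<open>The polar parts 1 / z^2 of the two functions cancel.\<close>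
  have lim0: "f \<midarrow>0\<rightarrow> h' 0 - h 0"
  proof -
    have "(\<lambda>z. h' z - h z) \<midarrow>0\<rightarrow> h' 0 - h 0"
      using holomorphic_on_imp_continuous_on[OF R(2)] holomorphic_on_imp_continuous_on[OF R'(2)] R(1) R'(1)
      by (intro tendsto_diff) (auto simp: continuous_on_eq_continuous_at isCont_def)
    moreover obtain r where r: "r > 0" "ball 0 r - {0} \<subseteq> - lattice \<tau>"
      using lattice_isolated[OF \<tau>] lattice_0 by metis
    have "eventually (\<lambda>z. z \<in> ball 0 (min r (min R R')) - {0}) (at (0 :: complex))"
      using r R R' by (intro eventually_at_in_open) auto
    then have "eventually (\<lambda>z. h' z - h z = f z) (at 0)"
    proof eventually_elim
      case (elim z)
      then show ?case using R(3)[of z] R'(3)[of z] r(2) by (auto simp: f_def)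
    qed
    ultimately show ?thesis by (rule Lim_transform_eventually)
  qed
  have lim: "\<exists>m n c. f \<midarrow>z + of_int m + of_int n * \<tau>\<rightarrow> c" for z
  proof (cases "z \<in> lattice \<tau>")
    case True
    then obtain m n where "z = of_int m + of_int n * \<tau>" unfolding lattice_def by blast
    then have "z + of_int (- m) + of_int (- n) * \<tau> = 0" by simp
    then show ?thesis using lim0 by metis
  next
    case False
    then show ?thesis using cont[of z] by (intro exI[of _ 0] exI[of _ "f z"]) simp
  qed
  obtain c where c: "\<And>z. f \<midarrow>z\<rightarrow> c"
    using quasi_elliptic_constant[where f = f, OF \<tau> iso lim per] by auto
  have "E2 \<tau> z = weierstrass_p \<tau> z + c" if "z \<notin> lattice \<tau>" for z
  proof -
    have "f z = c" using cont[OF that] c LIM_unique by blast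
    then show ?thesis using that by (simp add: f_def algebra_simps)
  qed
  then show ?thesis using that by blast
qed

subsection \<open>Biderivations on polynomial functions\<close>

lemma polyfun_sum: "(\<And>i. i \<in> I \<Longrightarrow> f i \<in> polyfun) \<Longrightarrow> (\<lambda>x. \<Sum>i\<in>I. f i x) \<in> polyfun"
  by (induction I rule: infinite_finite_induct) (auto intro: polyfun.intros)

lemma polyfun_cmult: "f \<in> polyfun \<Longrightarrow> (\<lambda>x. c * f x) \<in> polyfun"
  by (rule polyfun.mult[OF polyfun.const])

lemma axis_0_eq: "axis a 0 = 0"
  by (simp add: axis_def vec_eq_iff)

lemma polyfun_has_partial:
  assumes "f \<in> polyfun"
  shows "\<exists>g\<in>polyfun. \<forall>x. ((\<lambda>t. f (x + axis a t)) has_field_derivative g x) (at 0)"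
  using assms
proof (induction f)
  case (const c)
  show ?case by (rule bexI[of _ "\<lambda>x. 0"]) (auto intro: polyfun.intros)
next
  case (coord b)
  have "((\<lambda>t. (x + axis a t) $ b) has_field_derivative (if b = a then 1 else 0)) (at 0)" for x :: "complex^'a"
    unfolding axis_def by (cases "b = a") (auto intro!: derivative_eq_intros)
  then show ?case by (intro bexI[of _ "\<lambda>x. if b = a then 1 else 0"]) (auto intro: polyfun.const)
next
  case (add f g)
  then obtain f' g' where *: "f' \<in> polyfun" "g' \<in> polyfun"
    "\<And>x. ((\<lambda>t. f (x + axis a t)) has_field_derivative f' x) (at 0)"
    "\<And>x. ((\<lambda>t. g (x + axis a t)) has_field_derivative g' x) (at 0)" by metis
  then show ?case
    by (intro bexI[of _ "\<lambda>x. f' x + g' x"]) (auto intro: polyfun.intros derivative_intros)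
next
  case (mult f g)
  then obtain f' g' where *: "f' \<in> polyfun" "g' \<in> polyfun"
    "\<And>x. ((\<lambda>t. f (x + axis a t)) has_field_derivative f' x) (at 0)"
    "\<And>x. ((\<lambda>t. g (x + axis a t)) has_field_derivative g' x) (at 0)" by metis
  have "((\<lambda>t. f (x + axis a t) * g (x + axis a t)) has_field_derivative f' x * g x + g' x * f x) (at 0)" for x
    using DERIV_mult[OF *(3)[of x] *(4)[of x]] by (simp add: axis_0_eq)
  with * mult.hyps show ?case
    by (intro bexI[of _ "\<lambda>x. f' x * g x + g' x * f x"]) (auto intro!: polyfun.intros)
qed

lemma partial_eqI:
  assumes "\<And>x. ((\<lambda>t. f (x + axis a t)) has_field_derivative g x) (at 0)"
  shows "partial a f = g"
  using assms DERIV_imp_deriv by (auto simp: partial_def fun_eq_iff)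

lemma has_partial:
  assumes "f \<in> polyfun"
  shows "((\<lambda>t. f (x + axis a t)) has_field_derivative partial a f x) (at 0)"
  using polyfun_has_partial[OF assms, of a] partial_eqI[of f a] by metis

lemma polyfun_partial: "f \<in> polyfun \<Longrightarrow> partial a f \<in> polyfun"
  using polyfun_has_partial[of f a] partial_eqI[of f a] by metis

lemma partial_const: "partial a (\<lambda>x. c) = (\<lambda>x. 0)"
  by (rule partial_eqI) auto

lemma partial_coord: "partial a (\<lambda>x. x $ b) = (\<lambda>x. if a = b then 1 else 0)"
  by (rule partial_eqI, unfold axis_def, cases "a = b") (auto intro!: derivative_eq_intros)

lemma partial_add:
  "f \<in> polyfun \<Longrightarrow> g \<in> polyfun \<Longrightarrow> partial a (\<lambda>x. f x + g x) = (\<lambda>x. partial a f x + partial a g x)"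
  by (intro partial_eqI DERIV_add has_partial)

lemma partial_mult:
  assumes "f \<in> polyfun" "g \<in> polyfun"
  shows "partial a (\<lambda>x. f x * g x) = (\<lambda>x. partial a f x * g x + f x * partial a g x)"
proof (rule partial_eqI)
  fix x
  show "((\<lambda>t. f (x + axis a t) * g (x + axis a t)) has_field_derivative
      partial a f x * g x + f x * partial a g x) (at 0)"
    using DERIV_mult[OF has_partial[OF assms(1), of x a] has_partial[OF assms(2), of x a]]
    by (simp add: axis_0_eq mult.commute)
qed

lemma partial_cmult: "f \<in> polyfun \<Longrightarrow> partial a (\<lambda>x. c * f x) = (\<lambda>x. c * partial a f x)"
  by (simp add: partial_mult polyfun.const partial_const)

lemma bracket_of_polyfun:
  assumes "\<And>i j. P i j \<in> polyfun" "f \<in> polyfun" "g \<in> polyfun"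
  shows "bracket_of P f g \<in> polyfun"
  unfolding bracket_of_def[abs_def]
  by (intro polyfun_sum polyfun.mult polyfun_partial assms)

lemma bracket_of_linear:
  assumes "f \<in> polyfun" "g \<in> polyfun"
  shows "bracket_of P (\<lambda>y. a * f y + b * g y) h x = a * bracket_of P f h x + b * bracket_of P g h x"
  using assms
  by (simp add: bracket_of_def partial_add polyfun_cmult partial_cmult sum.distrib sum_distrib_left algebra_simps)

lemma bracket_of_add:
  assumes "f \<in> polyfun" "g \<in> polyfun"
  shows "bracket_of P (\<lambda>y. f y + g y) h x = bracket_of P f h x + bracket_of P g h x"
  using bracket_of_linear[OF assms, of P 1 1] by simp

lemma bracket_of_const: "bracket_of P (\<lambda>y. c) h x = 0"
  by (simp add: bracket_of_def partial_const)

lemma bracket_of_mult: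
  assumes "f \<in> polyfun" "g \<in> polyfun"
  shows "bracket_of P (\<lambda>y. f y * g y) h x = f x * bracket_of P g h x + bracket_of P f h x * g x"
  using assms
  by (simp add: bracket_of_def partial_mult sum.distrib sum_distrib_left sum_distrib_right algebra_simps)

lemma bracket_of_antisym:
  assumes "\<And>i j x. P i j x = - P j i x"
  shows "bracket_of P f g x = - bracket_of P g f x"
proof -
  have "bracket_of P f g x = (\<Sum>b\<in>UNIV. \<Sum>a\<in>UNIV. partial a f x * partial b g x * P a b x)"
    unfolding bracket_of_def by (rule sum.swap)
  also have "\<dots> = (\<Sum>b\<in>UNIV. \<Sum>a\<in>UNIV. - (partial b g x * partial a f x * P b a x))"
    using assms by (intro sum.cong refl) (metis mult.commute mult_minus_right)
  finally show ?thesis by (simp add: bracket_of_def sum_negf)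
qed

lemma bracket_of_coord: "bracket_of P (\<lambda>x. x $ i) g x = (\<Sum>d\<in>UNIV. P i d x * partial d g x)"
proof -
  have "bracket_of P (\<lambda>x. x $ i) g x =
      (\<Sum>a\<in>UNIV. if a = i then \<Sum>d\<in>UNIV. P i d x * partial d g x else 0)"
    unfolding bracket_of_def partial_coord by (intro sum.cong refl) (auto simp: mult.commute)
  then show ?thesis by simp
qed

lemma bracket_of_coords: "bracket_of P (\<lambda>x. x $ i) (\<lambda>x. x $ j) = P i j"
proof
  fix x
  have "bracket_of P (\<lambda>x. x $ i) (\<lambda>x. x $ j) x = (\<Sum>d\<in>UNIV. if d = j then P i j x else 0)"
    unfolding bracket_of_coord partial_coord by (intro sum.cong refl) auto
  then show "bracket_of P (\<lambda>x. x $ i) (\<lambda>x. x $ j) x = P i j x" by simp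
qed

text \<open>The Jacobiator is a derivation in each argument, so it suffices to check it on coordinates.\<close>

lemma poisson_bracket_bracket_of:
  fixes P :: "'n::finite \<Rightarrow> 'n \<Rightarrow> complex^'n \<Rightarrow> complex"
  assumes poly: "\<And>i j. P i j \<in> polyfun"
    and anti: "\<And>i j x. P i j x = - P j i x"
    and jacobi: "\<And>i j k x. (\<Sum>d\<in>UNIV. P i d x * partial d (P j k) x + P j d x * partial d (P k i) x
      + P k d x * partial d (P i j) x) = 0"
  shows "poisson_bracket (bracket_of P)"
proof -
  define B where "B = bracket_of P"
  define J where "J f g h x = B f (B g h) x + B g (B h f) x + B h (B f g) x" for f g h x
  note B_poly = bracket_of_polyfun[of P, OF poly, folded B_def]
  note B_anti = bracket_of_antisym[of P, OF anti, folded B_def]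
  note B_add = bracket_of_add[of _ _ P, folded B_def]
  note B_mult = bracket_of_mult[of _ _ P, folded B_def]
  have B_add_right: "B h (\<lambda>y. f y + g y) x = B h f x + B h g x"
    if "f \<in> polyfun" "g \<in> polyfun" for f g h x
    using B_anti[of h "\<lambda>y. f y + g y" x] B_anti[of h f x] B_anti[of h g x] B_add[OF that] by simp
  have B_mult_right: "B h (\<lambda>y. f y * g y) x = f x * B h g x + B h f x * g x"
    if "f \<in> polyfun" "g \<in> polyfun" for f g h x
    using B_anti[of h "\<lambda>y. f y * g y" x] B_anti[of h f x] B_anti[of h g x] B_mult[OF that] by simp
  have J_induct: "J f g h x = 0"
    if "f \<in> polyfun" and gh: "g \<in> polyfun" "h \<in> polyfun" and coord: "\<And>i. J (\<lambda>x. x $ i) g h x = 0"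
    for f g h x
    using that(1)
  proof (induction f)
    case (const c)
    have 1: "B (\<lambda>x. c) k y = 0" for k y unfolding B_def by (rule bracket_of_const)
    then have 2: "B k (\<lambda>x. c) = (\<lambda>x. 0)" for k using B_anti[of k "\<lambda>x. c"] by (auto simp: fun_eq_iff)
    have 3: "B k (\<lambda>x. 0) y = 0" for k y
      using B_anti[of k "\<lambda>x. 0" y] bracket_of_const[of P 0 k y] by (simp add: B_def)
    have 4: "B (\<lambda>x. c) k = (\<lambda>x. 0)" for k using 1 by auto
    show ?case by (simp add: J_def 2 3 4)
  next
    case (coord i)
    show ?case by (rule that(4))
  next
    case (add f1 f2)
    have 1: "B h (\<lambda>x. f1 x + f2 x) = (\<lambda>x. B h f1 x + B h f2 x)"
      "B (\<lambda>x. f1 x + f2 x) g = (\<lambda>x. B f1 g x + B f2 g x)"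
      using add.hyps by (auto simp: B_add B_add_right)
    have "J (\<lambda>x. f1 x + f2 x) g h x = J f1 g h x + J f2 g h x"
      unfolding J_def 1 using add.hyps gh by (simp add: B_add B_add_right B_poly)
    then show ?case using add.IH by simp
  next
    case (mult f1 f2)
    have 1: "B h (\<lambda>x. f1 x * f2 x) = (\<lambda>x. f1 x * B h f2 x + B h f1 x * f2 x)"
      "B (\<lambda>x. f1 x * f2 x) g = (\<lambda>x. f1 x * B f2 g x + B f1 g x * f2 x)"
      using mult.hyps by (auto simp: B_mult B_mult_right)
    have "J (\<lambda>x. f1 x * f2 x) g h x = f1 x * J f2 g h x + f2 x * J f1 g h x
        + (B g f1 x * B h f2 x + B g f2 x * B h f1 x + B h f1 x * B f2 g x + B h f2 x * B f1 g x)"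
      unfolding J_def 1 using mult.hyps gh
      by (simp add: B_mult B_mult_right B_add_right B_poly polyfun.mult algebra_simps)
    \<comment> \<open>The cross terms of the two Leibniz rules, the only obstruction to the
      derivation property, cancel in pairs by antisymmetry.\<close>
    also have "B g f1 x * B h f2 x + B g f2 x * B h f1 x + B h f1 x * B f2 g x + B h f2 x * B f1 g x = 0"
      unfolding B_anti[of g f1] B_anti[of g f2] by (simp add: algebra_simps)
    finally show ?case using mult.IH by simp
  qed
  \<comment> \<open>Cyclic symmetry brings each argument in turn to the first place, so the
    induction in that place is used three times.\<close>
  have J_cyc: "J f g h x = J g h f x" for f g h x by (simp add: J_def)
  have J0: "J (\<lambda>x. x $ i) (\<lambda>x. x $ j) (\<lambda>x. x $ k) x = 0" for i j k x
    unfolding J_def B_def bracket_of_coords bracket_of_coord sum.distrib[symmetric]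
    by (rule jacobi)
  have J1: "J f (\<lambda>x. x $ j) (\<lambda>x. x $ k) x = 0" if "f \<in> polyfun" for f j k x
    by (rule J_induct[OF that polyfun.coord polyfun.coord J0])
  have J2: "J g (\<lambda>x. x $ k) f x = 0" if "f \<in> polyfun" "g \<in> polyfun" for f g k x
  proof (rule J_induct[OF that(2) polyfun.coord that(1)])
    show "J (\<lambda>x. x $ i) (\<lambda>x. x $ k) f x = 0" for i
      using J1[OF that(1), of i k x] J_cyc[of f "\<lambda>x. x $ i" "\<lambda>x. x $ k" x] by simp
  qed
  have J3: "J h f g x = 0" if "f \<in> polyfun" "g \<in> polyfun" "h \<in> polyfun" for f g h x
  proof (rule J_induct[OF that(3,1,2)])
    show "J (\<lambda>x. x $ i) f g x = 0" for i
      using J2[OF that(1,2), of i x] J_cyc[of g "\<lambda>x. x $ i" f x] by simp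
  qed
  have "poisson_bracket B"
    unfolding poisson_bracket_def
  proof (intro conjI ballI allI)
    fix f g h :: "complex^'n \<Rightarrow> complex" and a b x
    assume fgh: "f \<in> polyfun" "g \<in> polyfun" "h \<in> polyfun"
    show "B (\<lambda>y. a * f y + b * g y) h x = a * B f h x + b * B g h x"
      unfolding B_def by (rule bracket_of_linear[OF fgh(1,2)])
    show "B (\<lambda>y. f y * g y) h x = f x * B g h x + B f h x * g x" by (rule B_mult[OF fgh(1,2)])
    show "B f (B g h) x + B g (B h f) x + B h (B f g) x = 0"
      using J3[OF fgh(2,3,1)] by (simp add: J_def)
  qed (auto intro: B_poly B_anti)
  then show ?thesis by (simp add: B_def)
qed

subsection \<open>Compatibility of the two brackets\<close>

lemma sum_UNIV_option_3: "(\<Sum>d\<in>UNIV. f d) = f None + f (Some 1) + f (Some 2) + f (Some (3 :: 3))"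
proof -
  have "(\<Sum>d\<in>UNIV. f d) = f None + (\<Sum>d\<in>range Some. f d)"
    unfolding UNIV_option_conv by (subst sum.insert) auto
  also have "(\<Sum>d\<in>range Some. f d) = (\<Sum>\<alpha>\<in>UNIV. f (Some \<alpha>))"
    by (subst sum.reindex) auto
  finally show ?thesis by (simp add: sum_3 add.assoc)
qed

lemma Svec_component: "Svec x $ \<alpha> = x $ Some \<alpha>"
  by (simp add: Svec_def)

lemma S0_bracket_eq:
  "S0_bracket \<nu> \<tau> 1 x = 2 * \<i> * (x $ Some 2 * x $ Some 3 * (E2 \<tau> (omega 2 \<tau>) - E2 \<tau> (omega 3 \<tau>))
     + x $ Some 2 * nu' \<nu> \<tau> $ 3 - x $ Some 3 * nu' \<nu> \<tau> $ 2)"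
  "S0_bracket \<nu> \<tau> 2 x = 2 * \<i> * (x $ Some 3 * x $ Some 1 * (E2 \<tau> (omega 3 \<tau>) - E2 \<tau> (omega 1 \<tau>))
     + x $ Some 3 * nu' \<nu> \<tau> $ 1 - x $ Some 1 * nu' \<nu> \<tau> $ 3)"
  "S0_bracket \<nu> \<tau> 3 x = 2 * \<i> * (x $ Some 1 * x $ Some 2 * (E2 \<tau> (omega 1 \<tau>) - E2 \<tau> (omega 2 \<tau>))
     + x $ Some 1 * nu' \<nu> \<tau> $ 2 - x $ Some 2 * nu' \<nu> \<tau> $ 1)"
  by (simp_all add: S0_bracket_def sum_3 levi_civita_def Svec_component algebra_simps)

text \<open>The whole pencil is treated as one bracket with parameters, so that compatibility is a
  single Jacobi identity; a = 0, b = 1 recovers the linear bracket.\<close>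

definition pencil_tensor :: "complex^3 \<Rightarrow> complex \<Rightarrow> complex \<Rightarrow> complex \<Rightarrow>
    3 option \<Rightarrow> 3 option \<Rightarrow> phase \<Rightarrow> complex" where
  "pencil_tensor \<nu> \<tau> a b i j x = a * quadratic_tensor \<nu> \<tau> i j x + b * linear_tensor i j x"

lemma pencil_tensor_Some:
  "pencil_tensor \<nu> \<tau> a b (Some \<alpha>) (Some \<beta>) x =
    (2 * \<i> * (a * x $ None + b)) * (\<Sum>\<gamma>\<in>UNIV. levi_civita \<alpha> \<beta> \<gamma> * x $ Some \<gamma>)"
  by (simp add: pencil_tensor_def quadratic_tensor_def linear_tensor_def S0_def Svec_component
      sum_distrib_left sum.distrib[symmetric] algebra_simps)

lemma pencil_tensor_None:
  "pencil_tensor \<nu> \<tau> a b None None x = 0"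
  "pencil_tensor \<nu> \<tau> a b None (Some \<alpha>) x = a * S0_bracket \<nu> \<tau> \<alpha> x"
  "pencil_tensor \<nu> \<tau> a b (Some \<alpha>) None x = - (a * S0_bracket \<nu> \<tau> \<alpha> x)"
  by (simp_all add: pencil_tensor_def quadratic_tensor_def linear_tensor_def)

lemma levi_civita_antisym: "levi_civita \<alpha> \<beta> \<gamma> = - levi_civita \<beta> \<alpha> \<gamma>"
  using cases_3[of \<alpha>] cases_3[of \<beta>] cases_3[of \<gamma>] by (auto simp: levi_civita_def)

lemma pencil_tensor_antisym: "pencil_tensor \<nu> \<tau> a b i j x = - pencil_tensor \<nu> \<tau> a b j i x"
proof (cases i; cases j)
  fix \<alpha> \<beta> assume "i = Some \<alpha>" "j = Some \<beta>"
  then show ?thesis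
    by (simp only: pencil_tensor_Some levi_civita_antisym[of \<alpha> \<beta>]) (simp add: sum_negf)
qed (simp_all add: pencil_tensor_None)

text \<open>The right-hand sides use only constants, coordinates, sums and products, with signs
  moved into the coefficients: this is the form that \<open>polyfun.intros\<close> and the rules for
  \<open>partial\<close> can process.\<close>

lemma pencil_tensor_table:
  fixes \<nu> \<tau> a b
  defines "P \<equiv> pencil_tensor \<nu> \<tau> a b" and "e \<equiv> \<lambda>\<alpha>. E2 \<tau> (omega \<alpha> \<tau>)" and "n \<equiv> \<lambda>\<alpha>. nu' \<nu> \<tau> $ \<alpha>"
  shows "P None None = (\<lambda>x. 0)"
    "P (Some 1) (Some 1) = (\<lambda>x. 0)" "P (Some 2) (Some 2) = (\<lambda>x. 0)" "P (Some 3) (Some 3) = (\<lambda>x. 0)"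
    "P (Some 1) (Some 2) = (\<lambda>x. 2 * \<i> * (a * x $ None + b) * x $ Some 3)"
    "P (Some 2) (Some 3) = (\<lambda>x. 2 * \<i> * (a * x $ None + b) * x $ Some 1)"
    "P (Some 3) (Some 1) = (\<lambda>x. 2 * \<i> * (a * x $ None + b) * x $ Some 2)"
    "P (Some 2) (Some 1) = (\<lambda>x. - (2 * \<i>) * (a * x $ None + b) * x $ Some 3)"
    "P (Some 3) (Some 2) = (\<lambda>x. - (2 * \<i>) * (a * x $ None + b) * x $ Some 1)"
    "P (Some 1) (Some 3) = (\<lambda>x. - (2 * \<i>) * (a * x $ None + b) * x $ Some 2)"
    "P None (Some 1) = (\<lambda>x. 2 * \<i> * a * ((e 2 - e 3) * (x $ Some 2 * x $ Some 3) + n 3 * x $ Some 2 + - n 2 * x $ Some 3))"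
    "P None (Some 2) = (\<lambda>x. 2 * \<i> * a * ((e 3 - e 1) * (x $ Some 3 * x $ Some 1) + n 1 * x $ Some 3 + - n 3 * x $ Some 1))"
    "P None (Some 3) = (\<lambda>x. 2 * \<i> * a * ((e 1 - e 2) * (x $ Some 1 * x $ Some 2) + n 2 * x $ Some 1 + - n 1 * x $ Some 2))"
    "P (Some 1) None = (\<lambda>x. - (2 * \<i> * a) * ((e 2 - e 3) * (x $ Some 2 * x $ Some 3) + n 3 * x $ Some 2 + - n 2 * x $ Some 3))"
    "P (Some 2) None = (\<lambda>x. - (2 * \<i> * a) * ((e 3 - e 1) * (x $ Some 3 * x $ Some 1) + n 1 * x $ Some 3 + - n 3 * x $ Some 1))"
    "P (Some 3) None = (\<lambda>x. - (2 * \<i> * a) * ((e 1 - e 2) * (x $ Some 1 * x $ Some 2) + n 2 * x $ Some 1 + - n 1 * x $ Some 2))"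
  unfolding P_def e_def n_def
  by (simp_all add: fun_eq_iff pencil_tensor_None pencil_tensor_Some S0_bracket_eq sum_3
      levi_civita_def algebra_simps)

lemma option_3_cases: "i = None \<or> i = Some 1 \<or> i = Some 2 \<or> i = Some (3 :: 3)"
  using cases_3 by (cases i) auto

lemma polyfun_pencil_tensor: "pencil_tensor \<nu> \<tau> a b i j \<in> polyfun"
  using option_3_cases[of i] option_3_cases[of j]
  by (elim disjE; hypsubst; simp only: pencil_tensor_table; intro polyfun.intros)

text \<open>A cyclic and antisymmetric expression is totally alternating, so the 64 index triples
  reduce to the four 3-element subsets of the four indices.\<close>

lemma alternating_option_3_eq_0:
  fixes J :: "3 option \<Rightarrow> 3 option \<Rightarrow> 3 option \<Rightarrow> complex"
  assumes cyc: "\<And>i j k. J i j k = J j k i" and swap: "\<And>i j k. J j i k = - J i j k"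
    and "J None (Some 1) (Some 2) = 0" "J None (Some 2) (Some 3) = 0"
    and "J None (Some 3) (Some 1) = 0" "J (Some 1) (Some 2) (Some 3) = 0"
  shows "J i j k = 0"
proof -
  have diag: "J i i k = 0" for i k using swap[of i i k] by (simp add: eq_neg_iff_add_eq_0)
  have diag': "J i k i = 0" "J k i i = 0" for i k
    using diag[of i k] cyc[of k i i] cyc[of i k i] by metis+
  have zero: "J i j k = 0 \<and> J j k i = 0 \<and> J k i j = 0 \<and> J j i k = 0 \<and> J i k j = 0 \<and> J k j i = 0"
    if "J i j k = 0" for i j k
    using that cyc[of i j k] cyc[of j k i] swap[of i j k] swap[of j k i] swap[of k i j] by simp
  show ?thesis
    using option_3_cases[of i] option_3_cases[of j] option_3_cases[of k]
      zero[OF assms(3)] zero[OF assms(4)] zero[OF assms(5)] zero[OF assms(6)]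
    by (elim disjE) (simp_all add: diag diag')
qed

text \<open>For the indices 1, 2, 3 the identity says that {S_0, S} is orthogonal to S, being a sum
  of cross products with S. For triples containing S_0 the differences of \<open>E2\<close> values
  sum cyclically to 0 and the \<open>nu'\<close> terms cancel in pairs.\<close>

lemma pencil_tensor_jacobi:
  "(\<Sum>d\<in>UNIV. pencil_tensor \<nu> \<tau> a b i d x * partial d (pencil_tensor \<nu> \<tau> a b j k) x
     + pencil_tensor \<nu> \<tau> a b j d x * partial d (pencil_tensor \<nu> \<tau> a b k i) x
     + pencil_tensor \<nu> \<tau> a b k d x * partial d (pencil_tensor \<nu> \<tau> a b i j) x) = 0"
proof (rule alternating_option_3_eq_0[where i = i and j = j and k = k])
  let ?P = "pencil_tensor \<nu> \<tau> a b"
  have neg: "partial d (?P j i) x = - partial d (?P i j) x" for d i j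
  proof -
    have "?P j i = (\<lambda>x. (-1) * ?P i j x)" using pencil_tensor_antisym[of \<nu> \<tau> a b j i] by auto
    then have "partial d (?P j i) = (\<lambda>x. (-1) * partial d (?P i j) x)"
      by (simp only: partial_cmult[OF polyfun_pencil_tensor])
    then show ?thesis by simp
  qed
  fix i j k
  show "(\<Sum>d\<in>UNIV. ?P i d x * partial d (?P j k) x + ?P j d x * partial d (?P k i) x + ?P k d x * partial d (?P i j) x)
      = (\<Sum>d\<in>UNIV. ?P j d x * partial d (?P k i) x + ?P k d x * partial d (?P i j) x + ?P i d x * partial d (?P j k) x)"
    by (simp add: add_ac)
  show "(\<Sum>d\<in>UNIV. ?P j d x * partial d (?P i k) x + ?P i d x * partial d (?P k j) x + ?P k d x * partial d (?P j i) x)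
      = - (\<Sum>d\<in>UNIV. ?P i d x * partial d (?P j k) x + ?P j d x * partial d (?P k i) x + ?P k d x * partial d (?P i j) x)"
    unfolding sum_negf[symmetric] neg[of _ i k] neg[of _ k j] neg[of _ j i] by (simp add: algebra_simps)
qed (simp only: sum_UNIV_option_3 pencil_tensor_table; simp only: partial_add partial_mult
      partial_const partial_coord polyfun.intros; simp; simp add: algebra_simps)+

lemma poisson_bracket_pencil:
  "poisson_bracket (\<lambda>f g x. a * quadratic_bracket \<nu> \<tau> f g x + b * linear_bracket f g x)"
proof -
  have "poisson_bracket (bracket_of (pencil_tensor \<nu> \<tau> a b))"
    by (intro poisson_bracket_bracket_of polyfun_pencil_tensor pencil_tensor_antisym pencil_tensor_jacobi)
  also have "bracket_of (pencil_tensor \<nu> \<tau> a b) =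
      (\<lambda>f g x. a * quadratic_bracket \<nu> \<tau> f g x + b * linear_bracket f g x)"
    by (simp add: fun_eq_iff bracket_of_def quadratic_bracket_def linear_bracket_def pencil_tensor_def
        sum.distrib sum_distrib_left algebra_simps)
  finally show ?thesis .
qed

subsection \<open>The equations of motion\<close>

lemma mscale_component: "(c *ms A) $ i $ j = c * A $ i $ j"
  by (simp add: mscale_def map_matrix_def)

lemma pauli_component:
  "pauli 1 $ 1 $ 1 = 0" "pauli 1 $ 1 $ 2 = 1" "pauli 1 $ 2 $ 1 = 1" "pauli 1 $ 2 $ 2 = 0"
  "pauli 2 $ 1 $ 1 = 0" "pauli 2 $ 1 $ 2 = - \<i>" "pauli 2 $ 2 $ 1 = \<i>" "pauli 2 $ 2 $ 2 = 0"
  "pauli 3 $ 1 $ 1 = 1" "pauli 3 $ 1 $ 2 = 0" "pauli 3 $ 2 $ 1 = 0" "pauli 3 $ 2 $ 2 = - 1"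
  by (simp_all add: pauli_def)

text \<open>The products of basis elements satisfy tr(T_\<alpha> T_\<beta>) = -2 / \<pi>^2 for
  \<alpha> = \<beta> and 0 otherwise; the prefactor of \<open>H_ZVG\<close> is the inverse of this
  constant.\<close>

lemma trace_sum_T_basis:
  "trace ((\<Sum>\<alpha>\<in>UNIV. u \<alpha> *ms T_basis \<alpha>) ** (\<Sum>\<alpha>\<in>UNIV. v \<alpha> *ms T_basis \<alpha>)) =
    - 2 / (of_real pi)^2 * (\<Sum>\<alpha>\<in>UNIV. u \<alpha> * v \<alpha>)"
  by (simp add: trace_def matrix_matrix_mult_def sum_2 sum_3 T_basis_def mscale_component
      pauli_component power2_eq_square field_simps)

lemma H_ZVG_eq:
  "H_ZVG \<nu> \<tau> x = (\<Sum>\<alpha>\<in>UNIV. E2 \<tau> (omega \<alpha> \<tau>) * (x $ Some \<alpha> * x $ Some \<alpha>) + nu' \<nu> \<tau> $ \<alpha> * x $ Some \<alpha>)"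
proof -
  have "(\<Sum>\<alpha>\<in>UNIV. (E2 \<tau> (omega \<alpha> \<tau>) * Svec x $ \<alpha>) *ms T_basis \<alpha>) + (\<Sum>\<alpha>\<in>UNIV. nu' \<nu> \<tau> $ \<alpha> *ms T_basis \<alpha>)
      = (\<Sum>\<alpha>\<in>UNIV. (E2 \<tau> (omega \<alpha> \<tau>) * Svec x $ \<alpha> + nu' \<nu> \<tau> $ \<alpha>) *ms T_basis \<alpha>)"
    unfolding sum.distrib[symmetric]
    by (rule sum.cong) (simp_all add: vec_eq_iff mscale_component algebra_simps)
  then show ?thesis
    unfolding H_ZVG_def by (simp only: trace_sum_T_basis) (simp add: Svec_component sum_3 field_simps)
qed

lemma partial_H_ZVG:
  "partial None (H_ZVG \<nu> \<tau>) x = 0"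
  "partial (Some \<alpha>) (H_ZVG \<nu> \<tau>) x = 2 * E2 \<tau> (omega \<alpha> \<tau>) * x $ Some \<alpha> + nu' \<nu> \<tau> $ \<alpha>"
proof -
  have H: "H_ZVG \<nu> \<tau> = (\<lambda>x. E2 \<tau> (omega 1 \<tau>) * (x $ Some 1 * x $ Some 1) + nu' \<nu> \<tau> $ 1 * x $ Some 1
      + (E2 \<tau> (omega 2 \<tau>) * (x $ Some 2 * x $ Some 2) + nu' \<nu> \<tau> $ 2 * x $ Some 2)
      + (E2 \<tau> (omega 3 \<tau>) * (x $ Some 3 * x $ Some 3) + nu' \<nu> \<tau> $ 3 * x $ Some 3))"
    by (simp add: fun_eq_iff H_ZVG_eq sum_3)
  show "partial None (H_ZVG \<nu> \<tau>) x = 0"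
    unfolding H by (simp only: partial_add partial_mult partial_const partial_coord polyfun.intros) simp
  show "partial (Some \<alpha>) (H_ZVG \<nu> \<tau>) x = 2 * E2 \<tau> (omega \<alpha> \<tau>) * x $ Some \<alpha> + nu' \<nu> \<tau> $ \<alpha>"
    using cases_3[of \<alpha>] unfolding H
    by (simp only: partial_add partial_mult partial_const partial_coord polyfun.intros) auto
qed

text \<open>For any H without S_0 the bracket is 2 i times S cross the gradient of H. The quadratic
  part of \<open>H_ZVG\<close> doubles under differentiation, the linear part does not, whence 4 i
  against 2 i.\<close>

lemma linear_bracket_H_ZVG:
  "linear_bracket (H_ZVG \<nu> \<tau>) (\<lambda>x. Svec x $ \<alpha>) x =
    (4 * \<i>) * ccross (Svec x) (\<chi> \<beta>. E2 \<tau> (omega \<beta> \<tau>) * Svec x $ \<beta>) $ \<alpha>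
    + (2 * \<i>) * ccross (Svec x) (nu' \<nu> \<tau>) $ \<alpha>"
proof -
  have "linear_bracket (H_ZVG \<nu> \<tau>) (\<lambda>x. Svec x $ \<alpha>) x = - linear_bracket (\<lambda>x. x $ Some \<alpha>) (H_ZVG \<nu> \<tau>) x"
    unfolding linear_bracket_def Svec_component
  proof (rule bracket_of_antisym)
    show "linear_tensor i j x = - linear_tensor j i x" for i j x
      using pencil_tensor_antisym[of 0 0 0 1 i j x] by (simp add: pencil_tensor_def)
  qed
  also have "linear_bracket (\<lambda>x. x $ Some \<alpha>) (H_ZVG \<nu> \<tau>) x =
      (\<Sum>d\<in>UNIV. linear_tensor (Some \<alpha>) d x * partial d (H_ZVG \<nu> \<tau>) x)"
    unfolding linear_bracket_def by (rule bracket_of_coord)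
  finally show ?thesis
    unfolding sum_UNIV_option_3 partial_H_ZVG using cases_3[of \<alpha>]
    by (elim disjE; simp add: linear_tensor_def ccross_def sum_3 levi_civita_def Svec_component;
        simp add: algebra_simps)
qed

text \<open>By antisymmetry in \<beta> and \<gamma> both halves of the difference of
  \<open>E2\<close> values contribute the same cross product with a minus sign, whence -2 i.\<close>

lemma quadratic_bracket_S0:
  "quadratic_bracket \<nu> \<tau> S0 (\<lambda>x. Svec x $ \<alpha>) x =
    (- 2 * \<i>) * ccross (Svec x) (\<chi> \<beta>. E2 \<tau> (omega \<beta> \<tau>) * Svec x $ \<beta>) $ \<alpha>
    + (2 * \<i>) * ccross (Svec x) (nu' \<nu> \<tau>) $ \<alpha>"
proof -
  have "quadratic_bracket \<nu> \<tau> S0 (\<lambda>x. Svec x $ \<alpha>) x = S0_bracket \<nu> \<tau> \<alpha> x"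
    unfolding quadratic_bracket_def S0_def[abs_def] Svec_component bracket_of_coords
    by (simp add: quadratic_tensor_def)
  then show ?thesis
    using cases_3[of \<alpha>]
    by (elim disjE; simp add: S0_bracket_eq ccross_def sum_3 levi_civita_def Svec_component; simp add: algebra_simps)
qed

lemma nu'_scale: "nu' (c *s \<nu>) \<tau> = c *s nu' \<nu> \<tau>"
  by (simp add: nu'_def vec_eq_iff)

text \<open>The constant by which \<open>E2\<close> and the Weierstrass function differ adds a
  multiple of S, which is annihilated by the cross product with S.\<close>

lemma ccross_J_times:
  assumes "Im \<tau> > 0"
  shows "ccross S (J_times \<tau> S) = ccross S (\<chi> \<beta>. E2 \<tau> (omega \<beta> \<tau>) * S $ \<beta>)"
proof -
  obtain c where "\<And>z. z \<notin> lattice \<tau> \<Longrightarrow> E2 \<tau> z = weierstrass_p \<tau> z + c"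
    using E2_weierstrass_p[OF assms] by metis
  then have "E2 \<tau> (omega \<alpha> \<tau>) = weierstrass_p \<tau> (omega \<alpha> \<tau>) + c" for \<alpha>
    using omega_not_in_lattice[OF assms] by blast
  then show ?thesis
    by (simp add: vec_eq_iff forall_3 ccross_def J_times_def sum_3 levi_civita_def algebra_simps)
qed

lemma ccross_scale: "ccross (c *s u) (d *s v) = (c * d) *s ccross u v"
  by (simp add: vec_eq_iff forall_3 ccross_def sum_3 levi_civita_def algebra_simps)

lemma J_times_scale: "J_times \<tau> (c *s S) = c *s J_times \<tau> S"
  by (simp add: vec_eq_iff J_times_def)

lemma has_field_derivative_cmult_iff:
  fixes f :: "complex \<Rightarrow> complex"
  assumes "c \<noteq> 0"
  shows "((\<lambda>t. c * f t) has_field_derivative c * d) (at x) \<longleftrightarrow> (f has_field_derivative d) (at x)"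
proof
  assume "((\<lambda>t. c * f t) has_field_derivative c * d) (at x)"
  from DERIV_cmult[OF this, of "1 / c"] show "(f has_field_derivative d) (at x)" using assms by simp
qed (rule DERIV_cmult)

text \<open>Under S -> c S the quadratic term of the gyrostat equation scales by c^2 and the
  \<open>nu'\<close> term by c. Dividing by c leaves the coefficient c on the former, while the
  latter takes its 2 i from the rescaled \<nu>.\<close>

lemma ZVG_solution_iff_hamiltonian_flow:
  assumes U: "U \<subseteq> upper_half_plane" and c: "c \<noteq> 0"
    and H: "\<And>\<tau> \<alpha> x. B \<tau> (H \<tau>) (\<lambda>x. Svec x $ \<alpha>) x =
      c * ccross (Svec x) (\<chi> \<beta>. E2 \<tau> (omega \<beta> \<tau>) * Svec x $ \<beta>) $ \<alpha>
      + (2 * \<i>) * ccross (Svec x) (nu' \<nu> \<tau>) $ \<alpha>"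
  shows "ZVG_solution ((2 * \<i>) *s \<nu>) U (\<lambda>\<tau>. c *s Svec (X \<tau>)) \<longleftrightarrow> hamiltonian_flow B H U X"
proof -
  have "((\<lambda>t. (c *s Svec (X t)) $ \<alpha>) has_field_derivative
      (ccross (c *s Svec (X \<tau>)) (J_times \<tau> (c *s Svec (X \<tau>)))
        + ccross (c *s Svec (X \<tau>)) (nu' ((2 * \<i>) *s \<nu>) \<tau>)) $ \<alpha>) (at \<tau>) \<longleftrightarrow>
    ((\<lambda>t. Svec (X t) $ \<alpha>) has_field_derivative B \<tau> (H \<tau>) (\<lambda>x. Svec x $ \<alpha>) (X \<tau>)) (at \<tau>)"
    if "\<tau> \<in> U" for \<tau> \<alpha>
  proof -
    have "Im \<tau> > 0" using that U by (auto simp: upper_half_plane_def)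
    then have "(ccross (c *s Svec (X \<tau>)) (J_times \<tau> (c *s Svec (X \<tau>)))
        + ccross (c *s Svec (X \<tau>)) (nu' ((2 * \<i>) *s \<nu>) \<tau>)) $ \<alpha> = c * B \<tau> (H \<tau>) (\<lambda>x. Svec x $ \<alpha>) (X \<tau>)"
      unfolding H J_times_scale nu'_scale ccross_scale by (simp add: ccross_J_times algebra_simps)
    then show ?thesis using has_field_derivative_cmult_iff[OF c] by simp
  qed
  then show ?thesis unfolding ZVG_solution_def hamiltonian_flow_def by blast
qed

subsection \<open>The linear r-matrix bracket\<close>

lemma kron_component: "kron A B $ i $ j = A $ fst i $ fst j * B $ snd i $ snd j"
  by (simp add: kron_def)

lemma Lax_component:
  "Lax \<nu> \<tau> z x $ i $ j =
    (\<Sum>\<alpha>\<in>UNIV. (x $ Some \<alpha> * varphi \<tau> \<alpha> z + \<nu> $ \<alpha> * varphi \<tau> \<alpha> (z - omega \<alpha> \<tau>)) * pauli \<alpha> $ i $ j)"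
  by (simp add: Lax_def mscale_component Svec_component)

lemma partial_Lax:
  "partial (Some \<alpha>) (\<lambda>x. Lax \<nu> \<tau> z x $ i $ j) y = varphi \<tau> \<alpha> z * pauli \<alpha> $ i $ j"
proof -
  have "(\<lambda>x. Lax \<nu> \<tau> z x $ i $ j) =
      (\<lambda>x. (x $ Some 1 * varphi \<tau> 1 z + \<nu> $ 1 * varphi \<tau> 1 (z - omega 1 \<tau>)) * pauli 1 $ i $ j
        + (x $ Some 2 * varphi \<tau> 2 z + \<nu> $ 2 * varphi \<tau> 2 (z - omega 2 \<tau>)) * pauli 2 $ i $ j
        + (x $ Some 3 * varphi \<tau> 3 z + \<nu> $ 3 * varphi \<tau> 3 (z - omega 3 \<tau>)) * pauli 3 $ i $ j)"
    by (simp add: fun_eq_iff Lax_component sum_3)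
  then show ?thesis
    using cases_3[of \<alpha>]
    by (simp only: partial_add partial_mult partial_const partial_coord polyfun.intros) auto
qed

lemma linear_bracket_Lax:
  "tensor_bracket linear_bracket (Lax \<nu> \<tau> z) (Lax \<nu> \<tau> w) x $ i $ j =
    (\<Sum>\<alpha>\<in>UNIV. \<Sum>\<beta>\<in>UNIV. (varphi \<tau> \<alpha> z * pauli \<alpha> $ fst i $ fst j) * (varphi \<tau> \<beta> w * pauli \<beta> $ snd i $ snd j)
      * (\<Sum>\<gamma>\<in>UNIV. 2 * \<i> * levi_civita \<alpha> \<beta> \<gamma> * x $ Some \<gamma>))"
proof -
  have None: "linear_tensor None k x = 0" "linear_tensor k None x = 0" for k
    by (simp_all add: linear_tensor_def split: option.split)
  show ?thesis
    by (simp add: tensor_bracket_def linear_bracket_def bracket_of_def sum_UNIV_option_3 None partial_Lax sum_3)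
       (simp add: linear_tensor_def Svec_component sum_3)
qed

lemma sum_UNIV_2_2: "(\<Sum>k\<in>UNIV. f k) = f (1, 1) + f (1, 2) + f (2, 1) + f (2 :: 2, 2 :: 2)"
proof -
  have "(\<Sum>k\<in>UNIV. f k) = (\<Sum>i\<in>UNIV. \<Sum>j\<in>UNIV. f (i, j))"
    unfolding UNIV_Times_UNIV[symmetric] sum.cartesian_product by simp
  then show ?thesis by (simp add: sum_2 add.assoc)
qed

text \<open>Comparing the coefficients of \<open>\<sigma>\<^sub>\<gamma> \<otimes> \<sigma>\<^sub>\<alpha>\<close> on both sides of the r-matrix relation gives the
  hypothesis.\<close>

lemma r_matrix_relation:
  fixes S p q m s l l' :: "3 \<Rightarrow> complex" and i j :: "2 \<times> 2"
  assumes rel: "\<And>\<alpha> \<beta> \<gamma>. \<alpha> \<noteq> \<beta> \<Longrightarrow> \<beta> \<noteq> \<gamma> \<Longrightarrow> \<alpha> \<noteq> \<gamma> \<Longrightarrow>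
    2 * S \<beta> * p \<gamma> * q \<alpha> = (s \<alpha> - m \<alpha>) * l \<beta> + (s \<gamma> + m \<gamma>) * l' \<beta>"
  defines "A \<equiv> \<Sum>\<alpha>\<in>UNIV. l \<alpha> *ms pauli \<alpha>" and "A' \<equiv> \<Sum>\<alpha>\<in>UNIV. l' \<alpha> *ms pauli \<alpha>"
  shows "(\<Sum>\<alpha>\<in>UNIV. \<Sum>\<beta>\<in>UNIV. (p \<alpha> * pauli \<alpha> $ fst i $ fst j) * (q \<beta> * pauli \<beta> $ snd i $ snd j)
      * (\<Sum>\<gamma>\<in>UNIV. 2 * \<i> * levi_civita \<alpha> \<beta> \<gamma> * S \<gamma>)) =
    ((- (1/2)) *ms commutator (\<Sum>\<alpha>\<in>UNIV. m \<alpha> *ms kron (pauli \<alpha>) (pauli \<alpha>)) (kron A (mat 1) + kron (mat 1) A')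
      + (1/2) *ms commutator (\<Sum>\<alpha>\<in>UNIV. s \<alpha> *ms kron (pauli \<alpha>) (pauli \<alpha>)) (kron A (mat 1) - kron (mat 1) A')) $ i $ j"
    (is "?lhs = ?rhs")
proof -
  define a b where "a \<alpha> = pauli \<alpha> $ fst i $ fst j" and "b \<alpha> = pauli \<alpha> $ snd i $ snd j" for \<alpha>
  \<comment> \<open>Repeated indices drop out with \<open>levi_civita\<close>; the six remaining
    terms are grouped to match the left side of \<open>rel\<close>.\<close>
  have "?lhs = \<i> * (a 1 * b 2 * (2 * S 3 * p 1 * q 2) - a 2 * b 1 * (2 * S 3 * p 2 * q 1)
      + a 2 * b 3 * (2 * S 1 * p 2 * q 3) - a 3 * b 2 * (2 * S 1 * p 3 * q 2)
      + a 3 * b 1 * (2 * S 2 * p 3 * q 1) - a 1 * b 3 * (2 * S 2 * p 1 * q 3))"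
    by (simp add: sum_3 levi_civita_def a_def b_def algebra_simps)
  also have "\<dots> = \<i> * (a 1 * b 2 * ((s 2 - m 2) * l 3 + (s 1 + m 1) * l' 3)
      - a 2 * b 1 * ((s 1 - m 1) * l 3 + (s 2 + m 2) * l' 3)
      + a 2 * b 3 * ((s 3 - m 3) * l 1 + (s 2 + m 2) * l' 1)
      - a 3 * b 2 * ((s 2 - m 2) * l 1 + (s 3 + m 3) * l' 1)
      + a 3 * b 1 * ((s 1 - m 1) * l 2 + (s 3 + m 3) * l' 2)
      - a 1 * b 3 * ((s 3 - m 3) * l 2 + (s 1 + m 1) * l' 2))"
    by (simp add: rel)
  \<comment> \<open>Behind the entrywise check stand the commutators of \<sigma>_\<alpha> \<otimes>
    \<sigma>_\<alpha> with \<sigma>_\<beta> \<otimes> 1 and 1 \<otimes> \<sigma>_\<beta>, namely 2 i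
    \<epsilon> times \<sigma>_\<gamma> \<otimes> \<sigma>_\<alpha> and \<sigma>_\<alpha> \<otimes>
    \<sigma>_\<gamma>.\<close>
  also have "\<dots> = ?rhs"
  proof -
    have cases_2: "k = 1 \<or> k = (2 :: 2)" for k by (rule exhaust_2)
    obtain i1 i2 j1 j2 where ij: "i = (i1, i2)" "j = (j1, j2)" by (cases i; cases j)
    show ?thesis
      using cases_2[of i1] cases_2[of i2] cases_2[of j1] cases_2[of j2]
      unfolding ij a_def b_def A_def A'_def
      by (elim disjE; simp add: commutator_def matrix_matrix_mult_def sum_UNIV_2_2 sum_3 mscale_component
          kron_component mat_def pauli_component; simp add: field_simps)
  qed
  finally show ?thesis .
qed

lemma lattice_uminus: "- z \<in> lattice \<tau> \<longleftrightarrow> z \<in> lattice \<tau>"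
  using lattice_diff[OF lattice_0, of z \<tau>] lattice_diff[OF lattice_0, of "- z" \<tau>] by auto

text \<open>Oddness turns the addition formula at -w into a second expression for the same product,
  with z + w in place of z - w. The sum of the two expressions is the S part of the relation; their
  difference, with \<alpha> and \<gamma> exchanged, yields the \<nu> part.\<close>

lemma varphi_r_matrix_relations:
  assumes \<tau>: "Im \<tau> > 0" and z: "z \<notin> lattice \<tau>" and w: "w \<notin> lattice \<tau>"
    and zw: "z - w \<notin> lattice \<tau>" "z + w \<notin> lattice \<tau>"
    and om: "\<And>\<alpha>. z - omega \<alpha> \<tau> \<notin> lattice \<tau>" "\<And>\<alpha>. w - omega \<alpha> \<tau> \<notin> lattice \<tau>"
    and neq: "\<alpha> \<noteq> \<beta>" "\<beta> \<noteq> \<gamma>" "\<alpha> \<noteq> \<gamma>"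
  shows "2 * varphi \<tau> \<gamma> z * varphi \<tau> \<alpha> w = (varphi \<tau> \<alpha> (z + w) - varphi \<tau> \<alpha> (z - w)) * varphi \<tau> \<beta> z
      + (varphi \<tau> \<gamma> (z + w) + varphi \<tau> \<gamma> (z - w)) * varphi \<tau> \<beta> w"
    and "(varphi \<tau> \<alpha> (z + w) - varphi \<tau> \<alpha> (z - w)) * varphi \<tau> \<beta> (z - omega \<beta> \<tau>)
      + (varphi \<tau> \<gamma> (z + w) + varphi \<tau> \<gamma> (z - w)) * varphi \<tau> \<beta> (w - omega \<beta> \<tau>) = 0"
proof -
  have w': "- w \<notin> lattice \<tau>" "z - - w \<notin> lattice \<tau>" using w zw by (simp_all add: lattice_uminus)
  have add: "varphi \<tau> \<gamma> z * varphi \<tau> \<alpha> w =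
      varphi \<tau> \<gamma> (z - w) * varphi \<tau> \<beta> w - varphi \<tau> \<alpha> (z - w) * varphi \<tau> \<beta> z"
    "varphi \<tau> \<gamma> z * varphi \<tau> \<alpha> w =
      varphi \<tau> \<gamma> (z + w) * varphi \<tau> \<beta> w + varphi \<tau> \<alpha> (z + w) * varphi \<tau> \<beta> z"
    if "\<alpha> \<noteq> \<beta>" "\<beta> \<noteq> \<gamma>" "\<alpha> \<noteq> \<gamma>" for \<alpha> \<gamma>
  proof -
    show "varphi \<tau> \<gamma> z * varphi \<tau> \<alpha> w =
        varphi \<tau> \<gamma> (z - w) * varphi \<tau> \<beta> w - varphi \<tau> \<alpha> (z - w) * varphi \<tau> \<beta> z"
      by (rule varphi_addition[OF \<tau> z w zw(1) that])
    have "- (varphi \<tau> \<gamma> z * varphi \<tau> \<alpha> w) =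
      - (varphi \<tau> \<gamma> (z + w) * varphi \<tau> \<beta> w + varphi \<tau> \<alpha> (z + w) * varphi \<tau> \<beta> z)"
      using varphi_addition[OF \<tau> z w' that] by (simp add: varphi_minus)
    then show "varphi \<tau> \<gamma> z * varphi \<tau> \<alpha> w =
      varphi \<tau> \<gamma> (z + w) * varphi \<tau> \<beta> w + varphi \<tau> \<alpha> (z + w) * varphi \<tau> \<beta> z"
      by (simp only: neg_equal_iff_equal)
  qed
  have "2 * varphi \<tau> \<gamma> z * varphi \<tau> \<alpha> w = varphi \<tau> \<gamma> z * varphi \<tau> \<alpha> w + varphi \<tau> \<gamma> z * varphi \<tau> \<alpha> w" by simp
  also have "\<dots> = (varphi \<tau> \<gamma> (z - w) * varphi \<tau> \<beta> w - varphi \<tau> \<alpha> (z - w) * varphi \<tau> \<beta> z) +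
      (varphi \<tau> \<gamma> (z + w) * varphi \<tau> \<beta> w + varphi \<tau> \<alpha> (z + w) * varphi \<tau> \<beta> z)"
    using add[OF neq] by (intro arg_cong2[where f = "(+)"])
  finally show "2 * varphi \<tau> \<gamma> z * varphi \<tau> \<alpha> w = (varphi \<tau> \<alpha> (z + w) - varphi \<tau> \<alpha> (z - w)) * varphi \<tau> \<beta> z
      + (varphi \<tau> \<gamma> (z + w) + varphi \<tau> \<gamma> (z - w)) * varphi \<tau> \<beta> w"
    by (simp add: algebra_simps)
  \<comment> \<open>The constant product of varphi_\<beta> with its translate by \<omega>_\<beta>,
    hence independent of the spectral parameter.\<close>
  define \<kappa> where "\<kappa> = - exp (- 2 * of_real pi * \<i> * omega_deriv \<beta> * omega \<beta> \<tau>) *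
        (deriv (theta \<tau>) 0 / theta \<tau> (omega \<beta> \<tau>))^2"
  have inv: "varphi \<tau> \<beta> (u - omega \<beta> \<tau>) = \<kappa> / varphi \<tau> \<beta> u" "varphi \<tau> \<beta> u \<noteq> 0"
    if "u \<notin> lattice \<tau>" "u - omega \<beta> \<tau> \<notin> lattice \<tau>" for u
    using varphi_minus_omega[OF \<tau> that] unfolding \<kappa>_def[symmetric] by (auto simp: field_simps)
  have "varphi \<tau> \<alpha> (z - w) * varphi \<tau> \<beta> w - varphi \<tau> \<gamma> (z - w) * varphi \<tau> \<beta> z =
      varphi \<tau> \<alpha> (z + w) * varphi \<tau> \<beta> w + varphi \<tau> \<gamma> (z + w) * varphi \<tau> \<beta> z"
    using add[of \<gamma> \<alpha>] neq by metis
  then have "(varphi \<tau> \<alpha> (z + w) - varphi \<tau> \<alpha> (z - w)) * varphi \<tau> \<beta> w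
      + (varphi \<tau> \<gamma> (z + w) + varphi \<tau> \<gamma> (z - w)) * varphi \<tau> \<beta> z = 0"
    by (simp add: algebra_simps)
  \<comment> \<open>Dividing by both values of varphi_\<beta> puts 1 / varphi_\<beta>(z) where
    varphi_\<beta>(w) stood and conversely; with \<kappa> these are the translated
    functions.\<close>
  then have "\<kappa> / (varphi \<tau> \<beta> z * varphi \<tau> \<beta> w) * ((varphi \<tau> \<alpha> (z + w) - varphi \<tau> \<alpha> (z - w)) * varphi \<tau> \<beta> w
      + (varphi \<tau> \<gamma> (z + w) + varphi \<tau> \<gamma> (z - w)) * varphi \<tau> \<beta> z) = 0" by simp
  then show "(varphi \<tau> \<alpha> (z + w) - varphi \<tau> \<alpha> (z - w)) * varphi \<tau> \<beta> (z - omega \<beta> \<tau>)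
      + (varphi \<tau> \<gamma> (z + w) + varphi \<tau> \<gamma> (z - w)) * varphi \<tau> \<beta> (w - omega \<beta> \<tau>) = 0"
    unfolding inv(1)[OF z om(1)] inv(1)[OF w om(2)]
    using inv(2)[OF z om(1)] inv(2)[OF w om(2)]
    by (simp add: algebra_simps add_divide_distrib diff_divide_distrib)
qed

text \<open>Each coefficient of \<open>Lax\<close> is a sum of an S part and a \<nu> part, and the
  required relation is linear in it: the S part reproduces the bracket, the \<nu> part contributes
  0. The excluded points are those where \<open>Lax\<close> or \<open>r_matrix\<close> may have a
  pole.\<close>

lemma linear_bracket_r_matrix:
  assumes \<tau>: "Im \<tau> > 0" and z: "z \<notin> lattice \<tau>" and w: "w \<notin> lattice \<tau>"
    and zw: "z - w \<notin> lattice \<tau>" "z + w \<notin> lattice \<tau>"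
    and om: "\<And>\<alpha>. z - omega \<alpha> \<tau> \<notin> lattice \<tau>" "\<And>\<alpha>. w - omega \<alpha> \<tau> \<notin> lattice \<tau>"
  shows "tensor_bracket linear_bracket (Lax \<nu> \<tau> z) (Lax \<nu> \<tau> w) x =
          (- (1/2)) *ms commutator (r_matrix \<tau> (z - w))
              (kron (Lax \<nu> \<tau> z x) (mat 1) + kron (mat 1) (Lax \<nu> \<tau> w x))
          + (1/2) *ms commutator (r_matrix \<tau> (z + w))
              (kron (Lax \<nu> \<tau> z x) (mat 1) - kron (mat 1) (Lax \<nu> \<tau> w x))"
proof -
  define l where "l u \<alpha> = x $ Some \<alpha> * varphi \<tau> \<alpha> u + \<nu> $ \<alpha> * varphi \<tau> \<alpha> (u - omega \<alpha> \<tau>)" for u \<alpha>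
  have L: "Lax \<nu> \<tau> u x = (\<Sum>\<alpha>\<in>UNIV. l u \<alpha> *ms pauli \<alpha>)" for u
    by (simp add: Lax_def l_def Svec_component)
  have rel: "2 * x $ Some \<beta> * varphi \<tau> \<gamma> z * varphi \<tau> \<alpha> w =
      (varphi \<tau> \<alpha> (z + w) - varphi \<tau> \<alpha> (z - w)) * l z \<beta> + (varphi \<tau> \<gamma> (z + w) + varphi \<tau> \<gamma> (z - w)) * l w \<beta>"
    if "\<alpha> \<noteq> \<beta>" "\<beta> \<noteq> \<gamma>" "\<alpha> \<noteq> \<gamma>" for \<alpha> \<beta> \<gamma>
  proof -
    note r = varphi_r_matrix_relations[OF \<tau> z w zw om that]
    have "(varphi \<tau> \<alpha> (z + w) - varphi \<tau> \<alpha> (z - w)) * l z \<beta> + (varphi \<tau> \<gamma> (z + w) + varphi \<tau> \<gamma> (z - w)) * l w \<beta>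
      = x $ Some \<beta> * ((varphi \<tau> \<alpha> (z + w) - varphi \<tau> \<alpha> (z - w)) * varphi \<tau> \<beta> z
          + (varphi \<tau> \<gamma> (z + w) + varphi \<tau> \<gamma> (z - w)) * varphi \<tau> \<beta> w)
      + \<nu> $ \<beta> * ((varphi \<tau> \<alpha> (z + w) - varphi \<tau> \<alpha> (z - w)) * varphi \<tau> \<beta> (z - omega \<beta> \<tau>)
      + (varphi \<tau> \<gamma> (z + w) + varphi \<tau> \<gamma> (z - w)) * varphi \<tau> \<beta> (w - omega \<beta> \<tau>))"
      by (simp add: l_def algebra_simps)
    also have "\<dots> = x $ Some \<beta> * (2 * varphi \<tau> \<gamma> z * varphi \<tau> \<alpha> w)"
      unfolding r(1)[symmetric] r(2) by simp
    finally show ?thesis by (simp add: mult_ac)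
  qed
  show ?thesis
    unfolding vec_eq_iff
  proof (intro allI)
    fix i j
    show "tensor_bracket linear_bracket (Lax \<nu> \<tau> z) (Lax \<nu> \<tau> w) x $ i $ j =
          ((- (1/2)) *ms commutator (r_matrix \<tau> (z - w))
              (kron (Lax \<nu> \<tau> z x) (mat 1) + kron (mat 1) (Lax \<nu> \<tau> w x))
          + (1/2) *ms commutator (r_matrix \<tau> (z + w))
              (kron (Lax \<nu> \<tau> z x) (mat 1) - kron (mat 1) (Lax \<nu> \<tau> w x))) $ i $ j"
      unfolding linear_bracket_Lax L r_matrix_def
      by (rule r_matrix_relation[where S = "\<lambda>\<alpha>. x $ Some \<alpha>"]) (rule rel)
  qed
qed

theorem mainTheorem8:
  fixes \<nu> :: "complex^3"
  shows
    "(\<forall>\<tau>\<in>upper_half_plane. \<forall>z w x.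
        z \<notin> lattice \<tau> \<and> w \<notin> lattice \<tau> \<and> z - w \<notin> lattice \<tau> \<and> z + w \<notin> lattice \<tau> \<and>
        (\<forall>\<alpha>. z - omega \<alpha> \<tau> \<notin> lattice \<tau> \<and> w - omega \<alpha> \<tau> \<notin> lattice \<tau>) \<longrightarrow>
        tensor_bracket linear_bracket (Lax \<nu> \<tau> z) (Lax \<nu> \<tau> w) x =
          (- (1/2)) *ms commutator (r_matrix \<tau> (z - w))
              (kron (Lax \<nu> \<tau> z x) (mat 1) + kron (mat 1) (Lax \<nu> \<tau> w x))
          + (1/2) *ms commutator (r_matrix \<tau> (z + w))
              (kron (Lax \<nu> \<tau> z x) (mat 1) - kron (mat 1) (Lax \<nu> \<tau> w x)))
     \<and>
     (\<forall>\<tau>\<in>upper_half_plane. \<forall>a b.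
        poisson_bracket (\<lambda>f g x. a * quadratic_bracket \<nu> \<tau> f g x + b * linear_bracket f g x))
     \<and>
     (\<forall>U X. open U \<and> U \<subseteq> upper_half_plane \<longrightarrow>
        (ZVG_solution ((2 * \<i>) *s \<nu>) U (\<lambda>\<tau>. (4 * \<i>) *s Svec (X \<tau>))
          \<longleftrightarrow> hamiltonian_flow (\<lambda>\<tau>. linear_bracket) (H_ZVG \<nu>) U X) \<and>
        (ZVG_solution ((2 * \<i>) *s \<nu>) U (\<lambda>\<tau>. (- 2 * \<i>) *s Svec (X \<tau>))
          \<longleftrightarrow> hamiltonian_flow (quadratic_bracket \<nu>) (\<lambda>\<tau>. S0) U X))"
proof (intro conjI ballI allI impI)
  fix \<tau> z w x
  assume "\<tau> \<in> upper_half_plane"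
    and "z \<notin> lattice \<tau> \<and> w \<notin> lattice \<tau> \<and> z - w \<notin> lattice \<tau> \<and> z + w \<notin> lattice \<tau> \<and>
      (\<forall>\<alpha>. z - omega \<alpha> \<tau> \<notin> lattice \<tau> \<and> w - omega \<alpha> \<tau> \<notin> lattice \<tau>)"
  then show "tensor_bracket linear_bracket (Lax \<nu> \<tau> z) (Lax \<nu> \<tau> w) x =
          (- (1/2)) *ms commutator (r_matrix \<tau> (z - w))
              (kron (Lax \<nu> \<tau> z x) (mat 1) + kron (mat 1) (Lax \<nu> \<tau> w x))
          + (1/2) *ms commutator (r_matrix \<tau> (z + w))
              (kron (Lax \<nu> \<tau> z x) (mat 1) - kron (mat 1) (Lax \<nu> \<tau> w x))"
    by (intro linear_bracket_r_matrix) (auto simp: upper_half_plane_def)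
next
  fix \<tau> a b
  show "poisson_bracket (\<lambda>f g x. a * quadratic_bracket \<nu> \<tau> f g x + b * linear_bracket f g x)"
    by (rule poisson_bracket_pencil)
next
  fix U and X :: "complex \<Rightarrow> phase"
  assume U: "open U \<and> U \<subseteq> upper_half_plane"
  show "ZVG_solution ((2 * \<i>) *s \<nu>) U (\<lambda>\<tau>. (4 * \<i>) *s Svec (X \<tau>))
          \<longleftrightarrow> hamiltonian_flow (\<lambda>\<tau>. linear_bracket) (H_ZVG \<nu>) U X"
    using U by (intro ZVG_solution_iff_hamiltonian_flow linear_bracket_H_ZVG) auto
  show "ZVG_solution ((2 * \<i>) *s \<nu>) U (\<lambda>\<tau>. (- 2 * \<i>) *s Svec (X \<tau>))
          \<longleftrightarrow> hamiltonian_flow (quadratic_bracket \<nu>) (\<lambda>\<tau>. S0) U X"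
    using U by (intro ZVG_solution_iff_hamiltonian_flow quadratic_bracket_S0) auto
qed

end
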